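(* Let $d\ge 2$, let $n\ge 0$ be an integer and let $x,y\in\mathbb{B}^d$. For $\lambda>0$ and $\mu>0$, $$P_n(W_{\lambda,\mu};x,y)=a_{\lambda,\mu}\int_{-1}^1\int_0^1\int_{-1}^1 Z_n^{\lambda+\mu+\frac{d-1}{2}}\bigl(\zeta(x,y,u,v,t)\bigr)(1-t^2)^{\mu-1}\,dt\;u^{\lambda-1}(1-u)^{\frac{d-2}{2}}\,du\,(1-v^2)^{\lambda-\frac12}\,dv,$$ where $a_{\lambda,\mu}$ is the constant such that the right-hand side equals $1$ if $n=0$, and $$\zeta(x,y,u,v,t)=\|x\|\,\|y\|\,uv+\langle x,y\rangle(1-u)+\sqrt{1-\|x\|^2}\sqrt{1-\|y\|^2}\;t .$$ Furthermore, if $\lambda>0$ and $\mu=0$, then $$P_n(W_{\lambda,0};x,y)=a_{\lambda,0}\int_{-1}^1\int_0^1\frac12\Bigl[Z_n^{\lambda+\frac{d-1}{2}}\bigl(\zeta(x,y,u,v,1)\bigr)+Z_n^{\lambda+\frac{d-1}{2}}\bigl(\zeta(x,y,u,v,-1)\bigr)\Bigr]u^{\lambda-1}(1-u)^{\frac{d-2}{2}}\,du\,(1-v^2)^{\lambda-\frac12}\,dv,$$ where $a_{\lambda,0}$ is the constant such that the right-hand side equals $1$ if $n=0$.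
   Context: $\mathbb{B}^d=\{x\in\mathbb{R}^d:\|x\|\le 1\}$ with Euclidean norm and inner product $\langle\cdot,\cdot\rangle$. The weight function is $W_{\lambda,\mu}(x)=b_{\lambda,\mu}\|x\|^{2\lambda}(1-\|x\|^2)^{\mu-\frac12}$ on $\mathbb{B}^d$, with $b_{\lambda,\mu}$ the constant such that $\int_{\mathbb{B}^d}W_{\lambda,\mu}(x)\,dx=1$. $\mathcal{V}_n^d(W_{\lambda,\mu})$ is the space of polynomials of degree $n$ in $d$ variables orthogonal to all polynomials of lower degree with respect to $\langle f,g\rangle=\int_{\mathbb{B}^d}fg\,W_{\lambda,\mu}\,dx$ (together with $0$), and $P_n(W_{\lambda,\mu};x,y)=\sum_j P_j^n(x)P_j^n(y)$, for any orthonormal basis $\{P_j^n\}$ of $\mathcal{V}_n^d(W_{\lambda,\mu})$, is its reproducing kernel. For $\nu>0$, $Z_n^\nu(t)=\frac{n+\nu}{\nu}C_n^\nu(t)$, where $C_n^\nu$ is the Gegenbauer polynomial of degree $n$, orthogonal with respect to $(1-t^2)^{\nu-1/2}$ on $(-1,1)$ and normalized by $C_n^\nu(1)=\binom{n+2\nu-1}{n}$. *)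

theory Defs
  imports "HOL-Analysis.Analysis"
begin

section \<open>Polynomials on \<open>\<real>\<^sup>d\<close> and orthogonality on the unit ball\<close>

text \<open>
  The dimension is \<open>d = CARD('d)\<close> and the unit ball is \<open>cball 0 1\<close>.  Polynomials in \<open>d\<close> real
  variables are identified with the polynomial functions they induce; \<open>\<alpha> :: 'd \<Rightarrow> nat\<close> is a
  multi-index.
\<close>

definition poly_deg_le :: "nat \<Rightarrow> (real ^ 'd \<Rightarrow> real) \<Rightarrow> bool" where
  "poly_deg_le n f \<longleftrightarrow>
     (\<exists>c. f = (\<lambda>x. \<Sum>\<alpha> | (\<Sum>i\<in>UNIV. \<alpha> i) \<le> n. c \<alpha> * (\<Prod>i\<in>UNIV. x $ i ^ \<alpha> i)))"

definition poly_deg_less :: "nat \<Rightarrow> (real ^ 'd \<Rightarrow> real) \<Rightarrow> bool" where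
  "poly_deg_less n f \<longleftrightarrow> (\<exists>m<n. poly_deg_le m f)"

definition ball_inner :: "(real ^ 'd \<Rightarrow> real) \<Rightarrow> (real ^ 'd \<Rightarrow> real) \<Rightarrow> (real ^ 'd \<Rightarrow> real) \<Rightarrow> real" where
  "ball_inner W f g = (LINT x:cball 0 1|lborel. f x * g x * W x)"

definition orth_poly_space :: "(real ^ 'd \<Rightarrow> real) \<Rightarrow> nat \<Rightarrow> (real ^ 'd \<Rightarrow> real) set" where
  "orth_poly_space W n =
     {f. poly_deg_le n f \<and> \<not> poly_deg_less n f \<and>
         (\<forall>g. poly_deg_less n g \<longrightarrow> ball_inner W f g = 0)} \<union> {\<lambda>x. 0}"

text \<open>Linear independence is implied by orthonormality.\<close>

definition orthonormal_basis :: "(real ^ 'd \<Rightarrow> real) \<Rightarrow> nat \<Rightarrow> (real ^ 'd \<Rightarrow> real) set \<Rightarrow> bool" where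
  "orthonormal_basis W n B \<longleftrightarrow>
     finite B \<and> B \<subseteq> orth_poly_space W n \<and>
     (\<forall>p\<in>B. \<forall>q\<in>B. ball_inner W p q = (if p = q then 1 else 0)) \<and>
     (\<forall>f\<in>orth_poly_space W n. \<exists>c. f = (\<lambda>x. \<Sum>p\<in>B. c p * p x))"

text \<open>
  The common value of the sum over all orthonormal bases; the description determines a number
  only if an orthonormal basis exists and the sum does not depend on its choice.
\<close>

definition repr_kernel :: "(real ^ 'd \<Rightarrow> real) \<Rightarrow> nat \<Rightarrow> real ^ 'd \<Rightarrow> real ^ 'd \<Rightarrow> real" where
  "repr_kernel W n x y = (THE s. \<forall>B. orthonormal_basis W n B \<longrightarrow> s = (\<Sum>p\<in>B. p x * p y))"


section \<open>The weight function\<close>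

text \<open>
  Since \<open>0 powr a = 0\<close> for every \<open>a\<close>, powers of \<open>0\<close> (here and in the integrals below) may differ
  from the usual convention, but only on null sets of integration.
\<close>

definition ball_weight0 :: "real \<Rightarrow> real \<Rightarrow> real ^ 'd \<Rightarrow> real" where
  "ball_weight0 lam mu x = norm x powr (2 * lam) * (1 - (norm x)\<^sup>2) powr (mu - 1 / 2)"

definition ball_weight :: "real \<Rightarrow> real \<Rightarrow> real ^ 'd \<Rightarrow> real" where
  "ball_weight lam mu x =
     (THE b. (LINT z:cball 0 1|lborel. b * ball_weight0 lam mu (z :: real ^ 'd)) = 1) *
     ball_weight0 lam mu x"


section \<open>Gegenbauer polynomials\<close>

definition gegenbauer :: "nat \<Rightarrow> real \<Rightarrow> real poly" where
  "gegenbauer n \<nu> =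
     (THE p. degree p = n \<and>
        (\<forall>q. degree q < n \<longrightarrow>
           (LINT t:{-1<..<1}|lborel. poly p t * poly q t * (1 - t\<^sup>2) powr (\<nu> - 1 / 2)) = 0) \<and>
        poly p 1 = (real n + 2 * \<nu> - 1) gchoose n)"

definition gegenbauer_Z :: "nat \<Rightarrow> real \<Rightarrow> real \<Rightarrow> real" where
  "gegenbauer_Z n \<nu> t = (real n + \<nu>) / \<nu> * poly (gegenbauer n \<nu>) t"


section \<open>The integrals\<close>

definition zeta_arg :: "real ^ 'd \<Rightarrow> real ^ 'd \<Rightarrow> real \<Rightarrow> real \<Rightarrow> real \<Rightarrow> real" where
  "zeta_arg x y u v t =
     norm x * norm y * u * v + (x \<bullet> y) * (1 - u) +
     sqrt (1 - (norm x)\<^sup>2) * sqrt (1 - (norm y)\<^sup>2) * t"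

definition kernel_integral :: "real \<Rightarrow> real \<Rightarrow> nat \<Rightarrow> real ^ 'd \<Rightarrow> real ^ 'd \<Rightarrow> real" where
  "kernel_integral lam mu n x y =
     (LINT v:{-1..1}|lborel.
       (LINT u:{0..1}|lborel.
         (LINT t:{-1..1}|lborel.
            gegenbauer_Z n (lam + mu + (real CARD('d) - 1) / 2) (zeta_arg x y u v t) *
            (1 - t\<^sup>2) powr (mu - 1)) *
         u powr (lam - 1) * (1 - u) powr ((real CARD('d) - 2) / 2)) *
       (1 - v\<^sup>2) powr (lam - 1 / 2))"

definition kernel_integral_0 :: "real \<Rightarrow> nat \<Rightarrow> real ^ 'd \<Rightarrow> real ^ 'd \<Rightarrow> real" where
  "kernel_integral_0 lam n x y =
     (LINT v:{-1..1}|lborel.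
       (LINT u:{0..1}|lborel.
         1 / 2 *
         (gegenbauer_Z n (lam + (real CARD('d) - 1) / 2) (zeta_arg x y u v 1) +
          gegenbauer_Z n (lam + (real CARD('d) - 1) / 2) (zeta_arg x y u v (- 1))) *
         u powr (lam - 1) * (1 - u) powr ((real CARD('d) - 2) / 2)) *
       (1 - v\<^sup>2) powr (lam - 1 / 2))"

text \<open>
  The constant \<open>a\<close> for which \<open>a * K n x y\<close> equals \<open>1\<close> on the ball if \<open>n = 0\<close>, to be used with
  \<open>K = kernel_integral lam mu\<close> and \<open>K = kernel_integral_0 lam\<close>.
\<close>

definition normalizer :: "(nat \<Rightarrow> real ^ 'd \<Rightarrow> real ^ 'd \<Rightarrow> real) \<Rightarrow> real" where
  "normalizer K = (THE a. \<forall>x\<in>cball 0 1. \<forall>y\<in>cball 0 1. a * K 0 x y = 1)"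

end

theory Submission
  imports Defs
begin

text \<open>
  Put \<open>\<sigma> = (d - 2) / 2\<close>, \<open>\<nu> = \<lambda> + \<mu> + (d - 1) / 2\<close>, and let \<open>z\<^sub>n\<^sub>i\<close> be the coefficient of \<open>t\<^sup>i / i!\<close> in
  \<open>Z\<^sub>n\<^sup>\<nu>\<close>.  The normalized average of \<open>\<zeta>\<^sup>i / i!\<close> over \<open>t\<close>, \<open>u\<close> and \<open>v\<close> depends only on the moments of
  three one-dimensional weights; expanding it gives an explicit polynomial \<open>zpow i x y\<close>.  The moments
  of the weight \<open>(1 - t\<^sup>2)\<^bsup>\<mu>-1\<^esup>\<close>, divided by its mass, have a limit for \<open>\<mu> \<rightarrow> 0\<close>, namely the moments of two
  equal point masses at \<open>\<plusminus>1\<close>; this is why both formulas of the theorem have the same right-hand side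
  \<open>zonal_kernel n x y = (\<Sum>i. z\<^sub>n\<^sub>i * zpow i x y)\<close>, and why \<open>\<mu> > 0\<close> and \<open>\<mu> = 0\<close> can be treated at once.
  It has to be shown that this polynomial is the reproducing kernel.

  The heart of the matter is the pairing formula \<open>ball_E_zpow\<close>,
  \<open>\<integral> zpow n x y * zpow m x z * W x dx = (\<Sum>K. conv_coeff \<nu> n m K * zpow K y z)\<close>.
  Its coefficients know about the geometry only through the index \<open>\<nu>\<close>: they are those of the
  convolution of \<open>t\<^sup>n / n!\<close> and \<open>t\<^sup>m / m!\<close> that belongs to the Gegenbauer weight of index \<open>\<nu>\<close>, and this
  convolution is diagonal in the polynomials \<open>Z\<^sub>n\<^sup>\<nu>\<close> (\<open>convolution_diagonal\<close>).  Consequently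
  \<open>\<integral> zonal_kernel k x y * zonal_kernel l x z * W x dx\<close> is \<open>zonal_kernel k y z\<close> for \<open>k = l\<close> and \<open>0\<close>
  otherwise (\<open>ball_E_kernel\<close>).  The pairing formula is built up in three steps, each of which adds
  its share to the index.  Rotation invariance gives index \<open>\<sigma>\<close> for the ridge functions
  \<open>(x \<bullet> y)\<^sup>n / n!\<close> (\<open>ball_E_ridge_product\<close>).  The average over \<open>u\<close> and \<open>v\<close> takes \<open>Z\<^sub>k\<close> of index \<open>\<lambda> + \<sigma>\<close>
  to \<open>Z\<^sub>k\<close> of index \<open>\<sigma>\<close> (\<open>expand_zonal_coeff\<close>), hence it turns the convolution of index \<open>\<lambda> + \<sigma>\<close> into that
  of index \<open>\<sigma>\<close> (\<open>mix_convolution\<close>).  Finally the variable \<open>t\<close> contributes \<open>\<mu> + 1/2\<close>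
  (\<open>zeta_power_convolution\<close>); here the binomial theorem meets \<open>(1 - \<parallel>y\<parallel>\<^sup>2) + \<parallel>y\<parallel>\<^sup>2 = 1\<close>.

  Orthogonality alone does not exclude that the kernels miss some polynomials.  A linear functional
  that vanishes on all \<open>zpow m x z\<close> with \<open>m \<le> n\<close> vanishes on all polynomials of degree at most \<open>n\<close>:
  varying the length of \<open>z\<close> separates the powers of \<open>1 - \<parallel>x\<parallel>\<^sup>2\<close> in \<open>zpow m x z\<close>, their coefficients are
  triangular in the powers of \<open>x \<bullet> z\<close>, and varying the direction of \<open>z\<close> (polarization) leads from
  \<open>(x \<bullet> z)\<^sup>p\<close> to monomials.  Applied to the defect of the reproducing property this yields
  \<open>kernel_reproduces\<close>.  The rest is Hilbert space theory: the kernel bounds the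
  size of orthonormal sets through Bessel's inequality, so that orthonormal bases exist, and each of
  them sums to the kernel (\<open>repr_kernel_eq\<close>).
\<close>

section \<open>Sums of rising factorials\<close>

lemma pochhammer_ne_0: "0 < (a::real) \<Longrightarrow> pochhammer a n \<noteq> 0"
  using pochhammer_pos[of a n] by simp

lemma pochhammer_add: "pochhammer (z::real) (n + m) = pochhammer z n * pochhammer (z + real n) m"
  using pochhammer_product'[of z n m] by simp

lemma alternating_binomial_sum_Suc:
  fixes f :: "nat \<Rightarrow> real"
  shows "(\<Sum>i\<le>Suc b. (-1) ^ i * real (Suc b choose i) * f i) =
         (\<Sum>i\<le>b. (-1) ^ i * real (b choose i) * (f i - f (Suc i)))"
proof -
  have "(\<Sum>i\<le>Suc b. (-1) ^ i * real (Suc b choose i) * f i)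
      = f 0 + (\<Sum>i\<le>b. (-1) ^ Suc i * (real (b choose i) + real (b choose Suc i)) * f (Suc i))"
    by (subst sum.atMost_Suc_shift) simp
  also have "\<dots> = f 0 + (\<Sum>i\<le>b. (-1) ^ Suc i * real (b choose Suc i) * f (Suc i))
                   - (\<Sum>i\<le>b. (-1) ^ i * real (b choose i) * f (Suc i))"
    by (simp add: sum.distrib algebra_simps sum_subtractf sum_negf)
  also have "f 0 + (\<Sum>i\<le>b. (-1) ^ Suc i * real (b choose Suc i) * f (Suc i)) =
             (\<Sum>i\<le>Suc b. (-1) ^ i * real (b choose i) * f i)"
    by (subst sum.atMost_Suc_shift) simp
  also have "\<dots> = (\<Sum>i\<le>b. (-1) ^ i * real (b choose i) * f i)"
    by simp
  finally show ?thesis by (simp add: sum_subtractf algebra_simps)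
qed

text \<open>
  The Chu-Vandermonde identity.  The shifts \<open>c\<close> and \<open>e\<close> make it provable by induction on \<open>b\<close> with the
  finite difference formula above; the hypergeometric sums below reduce to it.
\<close>

lemma alternating_pochhammer_sum:
  fixes x a :: real
  assumes "a > 0"
  shows "(\<Sum>i\<le>b. (-1) ^ i * real (b choose i) * (pochhammer x (c + i) / pochhammer a (e + i))) =
         pochhammer x c * pochhammer (a - x + real e - real c) b / pochhammer a (e + b)"
proof (induction b arbitrary: c e)
  case 0
  show ?case by simp
next
  case (Suc b)
  define u where "u = a - x + real e - real c"
  have ne: "pochhammer a n \<noteq> 0" for n using pochhammer_ne_0[OF assms] .
  have pos: "a + real e + real b \<noteq> 0" using assms by linarith
  have "(\<Sum>i\<le>Suc b. (-1) ^ i * real (Suc b choose i) * (pochhammer x (c + i) / pochhammer a (e + i)))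
      = (\<Sum>i\<le>b. (-1) ^ i * real (b choose i) * (pochhammer x (c + i) / pochhammer a (e + i)))
      - (\<Sum>i\<le>b. (-1) ^ i * real (b choose i) *
            (pochhammer x (Suc c + i) / pochhammer a (Suc e + i)))"
    by (subst alternating_binomial_sum_Suc) (simp add: sum_subtractf algebra_simps)
  also have "\<dots> = pochhammer x c * pochhammer u b / pochhammer a (e + b)
                 - pochhammer x (Suc c) * pochhammer u b / pochhammer a (Suc e + b)"
  proof -
    have "a - x + real (Suc e) - real (Suc c) = u" by (simp add: u_def)
    then show ?thesis unfolding Suc.IH by (simp only: u_def)
  qed
  also have "\<dots> = pochhammer x c * pochhammer u b * ((a + real (e + b)) - (x + real c))
                 / pochhammer a (Suc (e + b))"
  proof -
    have *: "p / P - q / (P * D) = (p * D - q) / (P * D)" if "P \<noteq> 0" "D \<noteq> 0" for p q P D :: real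
      using that by (simp add: field_simps)
    have D: "a + real (e + b) \<noteq> 0" using pos by (simp add: add_ac)
    show ?thesis
      unfolding pochhammer_Suc[of _ c] add_Suc pochhammer_Suc[of _ "e + b"]
      unfolding *[OF ne D] by (simp add: algebra_simps)
  qed
  also have "(a + real (e + b)) - (x + real c) = u + real b" by (simp add: u_def)
  finally show ?case by (simp add: pochhammer_Suc u_def mult_ac)
qed

section \<open>Expansions and convolutions of Gegenbauer type\<close>

text \<open>
  \<open>half_fact n k\<close> is the coefficient of \<open>t\<^bsup>n-k\<^esup>\<close> in \<open>exp t\<^sup>2\<close>.  Since it vanishes for \<open>k > n\<close> and for
  wrong parity, sums over \<open>k\<close> with \<open>n - k\<close> even can run over plain intervals.
\<close>

definition half_fact :: "nat \<Rightarrow> nat \<Rightarrow> real" where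
  "half_fact n k = (if k \<le> n \<and> even (n - k) then 1 / fact ((n - k) div 2) else 0)"

lemma half_fact_simps [simp]:
  "half_fact (k + 2 * i) k = 1 / fact i"
  "half_fact (k + i * 2) k = 1 / fact i"
  "half_fact k k = 1"
  "n < k \<Longrightarrow> half_fact n k = 0"
  by (auto simp: half_fact_def)

lemma half_fact_cases:
  obtains "half_fact n k = 0" "\<And>i. n \<noteq> k + 2 * i"
  | i where "n = k + 2 * i" "half_fact n k = 1 / fact i"
proof (cases "k \<le> n \<and> even (n - k)")
  case True
  then obtain i where "n - k = 2 * i" by blast
  with True have "n = k + 2 * i" by linarith
  with that(2) show ?thesis by simp
next
  case False
  then have "half_fact n k = 0" "\<And>i. n \<noteq> k + 2 * i" by (auto simp: half_fact_def)
  with that(1) show ?thesis by simp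
qed

lemma half_fact_shift: "half_fact (k + 2 * i) (k + 2 * l) = (if l \<le> i then 1 / fact (i - l) else 0)"
  by (auto simp: half_fact_def diff_mult_distrib2[symmetric])

lemma half_fact_chain_eq_0:
  assumes "half_fact n k = 0" shows "half_fact n K * half_fact K k = 0"
proof (cases n K rule: half_fact_cases)
  case n: (2 i)
  show ?thesis
  proof (cases K k rule: half_fact_cases)
    case (2 j)
    then have "n = k + 2 * (i + j)" using n by simp
    then have "half_fact n k = 1 / fact (i + j)" by (simp only: half_fact_simps)
    with assms show ?thesis by simp
  qed simp
qed simp

lemma sum_same_parity:
  fixes f :: "nat \<Rightarrow> 'a::comm_monoid_add"
  assumes "\<And>K. K \<le> k + 2 * i \<Longrightarrow> (\<And>l. K \<noteq> k + 2 * l) \<Longrightarrow> f K = 0"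
  shows "(\<Sum>K\<le>k + 2 * i. f K) = (\<Sum>l\<le>i. f (k + 2 * l))"
proof -
  have "(\<Sum>l\<le>i. f (k + 2 * l)) = sum f ((\<lambda>l. k + 2 * l) ` {..i})"
    by (subst sum.reindex) (auto simp: inj_on_def)
  also have "\<dots> = (\<Sum>K\<le>k + 2 * i. f K)"
    by (rule sum.mono_neutral_left) (use assms in \<open>force+\<close>)
  finally show ?thesis by simp
qed

lemma sum_atMost_extend:
  fixes f :: "nat \<Rightarrow> 'a::comm_monoid_add"
  assumes "n \<le> m" "\<And>k. n < k \<Longrightarrow> f k = 0"
  shows "(\<Sum>k\<le>n. f k) = (\<Sum>k\<le>m. f k)"
  by (rule sum.mono_neutral_left) (use assms in auto)

text \<open>
  \<open>expand_coeff \<nu> n k\<close> is the coefficient of \<open>Z\<^sub>k\<^sup>\<nu>(t)\<close> in the expansion of \<open>t\<^sup>n / n!\<close>.  If \<open>*\<close> is the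
  bilinear operation on polynomials with \<open>Z\<^sub>k\<^sup>\<nu> * Z\<^sub>l\<^sup>\<nu> = (if k = l then Z\<^sub>k\<^sup>\<nu> else 0)\<close>, then
  \<open>conv_coeff \<nu> n m K\<close> is the coefficient of \<open>t\<^sup>K / K!\<close> in \<open>(t\<^sup>n / n!) * (t\<^sup>m / m!)\<close>.
\<close>

definition expand_coeff :: "real \<Rightarrow> nat \<Rightarrow> nat \<Rightarrow> real" where
  "expand_coeff \<nu> n k = half_fact n k / (2 ^ n * pochhammer (\<nu> + 1) ((n + k) div 2))"

definition conv_coeff :: "real \<Rightarrow> nat \<Rightarrow> nat \<Rightarrow> nat \<Rightarrow> real" where
  "conv_coeff \<nu> n m K = half_fact n K * half_fact m K * 2 ^ K /
     (2 ^ (n + m) * pochhammer (\<nu> + 1) ((n + m) div 2))"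

lemma expand_coeff_eq_0: "n < k \<Longrightarrow> expand_coeff \<nu> n k = 0"
  by (simp add: expand_coeff_def)

lemma pochhammer_ratio_sum:
  assumes "(a::real) > 0"
  shows "(\<Sum>l\<le>i. (if l \<le> j then 1 / (fact (i - l) * fact (j - l) * fact l * pochhammer a l) else 0))
       = pochhammer a (i + j) / (fact i * fact j * pochhammer a i * pochhammer a j)"
proof -
  let ?t = "\<lambda>l. if l \<le> j then 1 / (fact (i - l) * fact (j - l) * fact l * pochhammer a l) else 0"
  let ?s = "\<lambda>l. (-1) ^ l * real (i choose l) * (pochhammer (- real j) l / pochhammer a l)"
  have ne: "pochhammer a n \<noteq> 0" for n using pochhammer_ne_0[OF assms] .
  have "(\<Sum>l\<le>i. (-1) ^ l * real (i choose l) * (pochhammer (- real j) (0 + l) / pochhammer a (0 + l)))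
      = pochhammer (a + real j) i / pochhammer a i"
    using alternating_pochhammer_sum[OF assms, of i "- real j" 0 0] by simp
  also have "pochhammer (a + real j) i = pochhammer a (i + j) / pochhammer a j"
    using pochhammer_add[of a j i] ne[of j] by (simp add: add.commute)
  finally have 1: "(\<Sum>l\<le>i. ?s l)
      = pochhammer a (i + j) / (pochhammer a i * pochhammer a j)" by (simp add: mult_ac)
  have 2: "?s l
      = fact i * fact j *
        ?t l"
    if "l \<le> i" for l
  proof (cases "l \<le> j")
    case True
    have "real (j choose l) = (- 1) ^ l * pochhammer (- real j) l / fact l"
      by (simp add: binomial_gbinomial gbinomial_pochhammer)
    then have *: "(- 1) ^ l * pochhammer (- real j) l = real (j choose l) * fact l" by (simp add: field_simps)
    have "?s l
       = real (i choose l) * ((-1) ^ l * pochhammer (- real j) l) / pochhammer a l" by simp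
    also have "\<dots> = real (i choose l) * (real (j choose l) * fact l) / pochhammer a l" by (simp only: *)
    also have "\<dots> = fact i * fact j *
        ?t l"
      using True that ne[of l] by (simp add: binomial_fact field_simps)
    finally show ?thesis .
  next
    case False
    then have "pochhammer (- real j) l = 0" by (simp add: pochhammer_of_nat_eq_0_lemma)
    with False show ?thesis by simp
  qed
  have "(\<Sum>l\<le>i. ?s l)
     = fact i * fact j * (\<Sum>l\<le>i. ?t l)"
    unfolding sum_distrib_left by (rule sum.cong) (use 2 in auto)
  with 1 have "fact i * fact j * (\<Sum>l\<le>i. ?t l)
    = pochhammer a (i + j) / (pochhammer a i * pochhammer a j)" by simp
  moreover have "S = r / (u * v * s * t)" if "u * v * S = r / (s * t)" "u \<noteq> 0" "v \<noteq> 0" for u v S r s t :: real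
  proof -
    have "S = u * v * S / (u * v)" using that(2,3) by simp
    also have "\<dots> = r / (u * v * s * t)" unfolding that(1) by (simp add: mult_ac)
    finally show ?thesis .
  qed
  ultimately show ?thesis by simp
qed

text \<open>
  Both sides are the coefficient of \<open>Z\<^sub>k\<^sup>\<nu>\<close> in the convolution of \<open>t\<^sup>n / n!\<close> and \<open>t\<^sup>m / m!\<close>.
\<close>

lemma expand_coeff_mult:
  assumes "\<nu> \<ge> 0"
  shows "expand_coeff \<nu> n k * expand_coeff \<nu> m k = (\<Sum>K\<le>n. conv_coeff \<nu> n m K * expand_coeff \<nu> K k)"
proof (cases n k rule: half_fact_cases)
  case 1
  then have "conv_coeff \<nu> n m K * expand_coeff \<nu> K k = 0" for K
    using half_fact_chain_eq_0[of n k K] by (auto simp: conv_coeff_def expand_coeff_def)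
  with 1(1) show ?thesis by (simp only: expand_coeff_def[of _ n] sum.neutral_const mult_zero_left mult_zero_right div_0)
next
  case (2 i)
  note n = 2
  show ?thesis
  proof (cases m k rule: half_fact_cases)
    case 1
    then have "conv_coeff \<nu> n m K * expand_coeff \<nu> K k = 0" for K
      using half_fact_chain_eq_0[of m k K] by (auto simp: conv_coeff_def expand_coeff_def)
    with 1(1) show ?thesis by (simp only: expand_coeff_def[of _ m] sum.neutral_const mult_zero_left mult_zero_right div_0)
  next
    case (2 j)
    define a where "a = \<nu> + 1 + real k"
    have a: "a > 0" using assms by (simp add: a_def)
    have ne: "pochhammer a n \<noteq> 0" "pochhammer (\<nu> + 1) n \<noteq> 0" for n
      using pochhammer_ne_0[OF a] assms by (auto intro!: pochhammer_ne_0)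
    have pk: "pochhammer (\<nu> + 1) (k + l) = pochhammer (\<nu> + 1) k * pochhammer a l" for l
      unfolding a_def by (rule pochhammer_add)
    have dv: "(k + 2 * i + k) div 2 = k + i" "(k + 2 * i + (k + 2 * j)) div 2 = k + (i + j)" for i j
      by simp_all
    define C where "C = 1 / (2 ^ (n + m) * pochhammer (\<nu> + 1) ((n + m) div 2) * pochhammer (\<nu> + 1) k)"
    have "(\<Sum>K\<le>n. conv_coeff \<nu> n m K * expand_coeff \<nu> K k)
        = (\<Sum>l\<le>i. conv_coeff \<nu> n m (k + 2 * l) * expand_coeff \<nu> (k + 2 * l) k)"
      unfolding n(1)
    proof (rule sum_same_parity)
      fix K assume "\<And>l. K \<noteq> k + 2 * l"
      then have "expand_coeff \<nu> K k = 0"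
        by (cases K k rule: half_fact_cases) (auto simp: expand_coeff_def)
      then show "conv_coeff \<nu> (k + 2 * i) m K * expand_coeff \<nu> K k = 0" by simp
    qed
    also have "\<dots> = (\<Sum>l\<le>i. C * (if l \<le> j then 1 / (fact (i - l) * fact (j - l) * fact l * pochhammer a l) else 0))"
    proof (rule sum.cong)
      fix l assume "l \<in> {..i}"
      then have li: "l \<le> i" by simp
      show "conv_coeff \<nu> n m (k + 2 * l) * expand_coeff \<nu> (k + 2 * l) k =
         C * (if l \<le> j then 1 / (fact (i - l) * fact (j - l) * fact l * pochhammer a l) else 0)"
        unfolding conv_coeff_def expand_coeff_def n(1) 2(1) half_fact_shift C_def dv half_fact_simps pk
        using li ne by (simp add: power_add field_simps)
    qed simp
    also have "\<dots> = C * (pochhammer a (i + j) / (fact i * fact j * pochhammer a i * pochhammer a j))"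
      unfolding sum_distrib_left[symmetric] pochhammer_ratio_sum[OF a] ..
    also have "\<dots> = expand_coeff \<nu> n k * expand_coeff \<nu> m k"
      unfolding expand_coeff_def n(1) 2(1) C_def dv half_fact_simps pk
      using ne by (simp add: power_add power_mult power2_eq_square field_simps)
    finally show ?thesis ..
  qed
qed

text \<open>
  The coefficients \<open>expand_coeff\<close> form triangular matrices with nonzero diagonal, so a family \<open>D\<close> is
  determined by its transform \<open>b\<close>; by \<open>expand_coeff_mult\<close> the diagonal family built from \<open>f\<close> has the
  same transform.
\<close>

lemma convolution_diagonal:
  assumes nu: "\<nu> \<ge> 0"
    and b: "\<And>n m. b n m = (\<Sum>k\<le>n. \<Sum>l\<le>m. expand_coeff \<nu> n k * expand_coeff \<nu> m l * D k l)"
    and c: "\<And>n m. b n m = (\<Sum>K\<le>n. conv_coeff \<nu> n m K * (\<Sum>k\<le>K. expand_coeff \<nu> K k * f k))"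
  shows "D k l = (if k = l then f k else 0)"
proof -
  define G where "G k l = D k l - (if k = l then f k else 0)" for k l
  have diag: "(\<Sum>k\<le>n. \<Sum>l\<le>m. expand_coeff \<nu> n k * expand_coeff \<nu> m l * (if k = l then f k else 0)) = b n m" for n m
  proof -
    have "b n m = (\<Sum>K\<le>n. \<Sum>k\<le>n. conv_coeff \<nu> n m K * (expand_coeff \<nu> K k * f k))"
      unfolding c sum_distrib_left
      by (intro sum.cong refl sum_atMost_extend) (auto simp: expand_coeff_eq_0)
    also have "\<dots> = (\<Sum>k\<le>n. (\<Sum>K\<le>n. conv_coeff \<nu> n m K * expand_coeff \<nu> K k) * f k)"
      by (subst sum.swap) (simp add: sum_distrib_left sum_distrib_right mult_ac)
    also have "\<dots> = (\<Sum>k\<le>n. expand_coeff \<nu> n k * expand_coeff \<nu> m k * f k)"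
      by (simp add: expand_coeff_mult[OF nu, symmetric])
    also have "\<dots> = (\<Sum>k\<le>n. \<Sum>l\<le>m. expand_coeff \<nu> n k * expand_coeff \<nu> m l * (if k = l then f k else 0))"
    proof (rule sum.cong[OF refl])
      fix k
      have "(\<Sum>l\<le>m. expand_coeff \<nu> n k * expand_coeff \<nu> m l * (if k = l then f k else 0)) =
            (\<Sum>l\<le>m. if k = l then expand_coeff \<nu> n k * expand_coeff \<nu> m l * f k else 0)"
        by (rule sum.cong) auto
      also have "\<dots> = expand_coeff \<nu> n k * expand_coeff \<nu> m k * f k"
        by (auto simp: expand_coeff_eq_0)
      finally show "expand_coeff \<nu> n k * expand_coeff \<nu> m k * f k =
         (\<Sum>l\<le>m. expand_coeff \<nu> n k * expand_coeff \<nu> m l * (if k = l then f k else 0))" ..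
    qed
    finally show ?thesis ..
  qed
  have zero: "(\<Sum>k\<le>n. \<Sum>l\<le>m. expand_coeff \<nu> n k * expand_coeff \<nu> m l * G k l) = 0" for n m
    unfolding G_def right_diff_distrib sum_subtractf diag b[symmetric] by simp
  have "G k l = 0"
  proof (induction "k + l" arbitrary: k l rule: less_induct)
    case less
    have ne: "expand_coeff \<nu> n n \<noteq> 0" for n
      using pochhammer_ne_0[of "\<nu> + 1"] nu by (simp add: expand_coeff_def)
    have "(\<Sum>i\<le>k. \<Sum>j\<le>l. expand_coeff \<nu> k i * expand_coeff \<nu> l j * G i j)
       = (\<Sum>i\<le>k. \<Sum>j\<le>l. if i = k \<and> j = l then expand_coeff \<nu> k k * expand_coeff \<nu> l l * G k l else 0)"
      by (intro sum.cong refl) (use less in auto)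
    also have "\<dots> = (\<Sum>i\<le>k. if i = k then (\<Sum>j\<le>l. if j = l then expand_coeff \<nu> k k * expand_coeff \<nu> l l * G k l else 0) else 0)"
      by (intro sum.cong refl) auto
    also have "\<dots> = expand_coeff \<nu> k k * expand_coeff \<nu> l l * G k l" by simp
    finally show ?case using zero[of k l] ne by simp
  qed
  then show ?thesis by (simp add: G_def)
qed

text \<open>
  The coefficient of \<open>t\<^sup>i / i!\<close> in \<open>Z\<^sub>n\<^sup>\<nu>\<close>.  Usually it is written with
  \<open>(n + \<nu>) * pochhammer (\<nu> + 1) ((n + i) div 2 - 1)\<close>, which fails for \<open>n = 0\<close>; the sum below agrees with it
  for \<open>n \<ge> 1\<close> and gives \<open>Z\<^sub>0 = 1\<close>.  Nothing is divided by \<open>\<nu>\<close>, so that \<open>\<nu> = 0\<close>, that is \<open>\<sigma>\<close> for \<open>d = 2\<close>,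
  is included.
\<close>

definition zonal_coeff :: "real \<Rightarrow> nat \<Rightarrow> nat \<Rightarrow> real" where
  "zonal_coeff \<nu> n i = half_fact n i * (-1) ^ ((n - i) div 2) * 2 ^ i *
     (pochhammer (\<nu> + 1) ((n + i) div 2) +
      real ((n - i) div 2) * pochhammer (\<nu> + 1) ((n + i) div 2 - 1))"

text \<open>
  The coefficient of \<open>s\<^sup>c / c!\<close> in the average of \<open>(u * v + s * (1 - u))\<^sup>n / n!\<close> with respect to the
  normalized weights \<open>u\<^bsup>\<lambda>-1\<^esup> * (1 - u)\<^sup>\<sigma>\<close> on \<open>[0, 1]\<close> and \<open>(1 - v\<^sup>2)\<^bsup>\<lambda>-1/2\<^esup>\<close> on \<open>[-1, 1]\<close>.
\<close>

definition mix_coeff :: "real \<Rightarrow> real \<Rightarrow> nat \<Rightarrow> nat \<Rightarrow> real" where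
  "mix_coeff lam sig n c = half_fact n c * pochhammer lam (n - c) * pochhammer (sig + 1) c /
     (2 ^ (n - c) * pochhammer (lam + 1) ((n - c) div 2) * pochhammer (lam + sig + 1) n)"

lemma zonal_coeff_eq_0: "n < k \<Longrightarrow> zonal_coeff \<nu> n k = 0"
  by (simp add: zonal_coeff_def)

text \<open>
  Expand \<open>t\<^sup>n / n!\<close> in the \<open>Z\<^sub>k\<close> of index \<open>\<lambda> + \<sigma>\<close>, and average the argument \<open>u * v + s * (1 - u)\<close> over
  \<open>u\<close> and \<open>v\<close>.  The identity says that each \<open>Z\<^sub>k\<close> of index \<open>\<lambda> + \<sigma>\<close> has become the \<open>Z\<^sub>k(s)\<close> of index \<open>\<sigma>\<close>.
  The two terms of \<open>zonal_coeff\<close> give two Chu-Vandermonde sums.  The case \<open>\<lambda> = 0\<close>, in which mixing is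
  the identity, shows that \<open>expand_coeff\<close> and \<open>zonal_coeff\<close> are inverse matrices.
\<close>

lemma expand_zonal_coeff:
  assumes lam: "lam \<ge> 0" and sig: "sig \<ge> 0"
  shows "(\<Sum>k\<le>n. expand_coeff (lam + sig) n k * zonal_coeff sig k c) = mix_coeff lam sig n c"
proof (cases n c rule: half_fact_cases)
  case 1
  then have "expand_coeff (lam + sig) n K * zonal_coeff sig K c = 0" for K
    using half_fact_chain_eq_0[of n c K] by (auto simp: expand_coeff_def zonal_coeff_def)
  with 1(1) show ?thesis by (simp only: mix_coeff_def sum.neutral_const mult_zero_left mult_zero_right div_0)
next
  case (2 b)
  define a where "a = lam + sig + 1"
  define x where "x = sig + 1"
  have a: "a > 0" and x: "x > 0" using assms by (auto simp: a_def x_def)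
  have ne: "pochhammer a n \<noteq> 0" "pochhammer (lam + 1) n \<noteq> 0" for n
      using pochhammer_ne_0[OF a] assms by (auto intro!: pochhammer_ne_0)
  have dv: "(c + 2 * b + (c + 2 * i)) div 2 = c + b + i" "(c + 2 * i + c) div 2 = c + i"
    "(c + 2 * i - c) div 2 = i" for i by simp_all
  define F where "F x c e b = (\<Sum>i\<le>b. (-1) ^ i * real (b choose i) * (pochhammer x (c + i) / pochhammer a (e + i)))" for x c e b
  have Feq: "F y c e b = pochhammer y c * pochhammer (a - y + real e - real c) b / pochhammer a (e + b)" for y c e b
    unfolding F_def by (rule alternating_pochhammer_sum[OF a])
  \<comment> \<open>The second term of \<open>zonal_coeff\<close>.  Its summand for \<open>i = 0\<close> vanishes, and a shift of \<open>i\<close> leads back to \<open>F\<close>.\<close>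
  define S2 where "S2 = (\<Sum>i\<le>b. (-1) ^ i * real i / (fact i * fact (b - i)) * (pochhammer x (c + i - 1) / pochhammer a (c + b + i)))"
  have S2: "S2 = - (real b / fact b) * (pochhammer x c * pochhammer (lam + real b + 1) (b - 1) / pochhammer a (c + 2 * b))"
  proof (cases b)
    case 0 then show ?thesis by (simp add: S2_def)
  next
    case (Suc b')
    have "S2 = (\<Sum>i\<le>b'. (-1) ^ Suc i * real (Suc i) / (fact (Suc i) * fact (b' - i)) * (pochhammer x (c + i) / pochhammer a (c + b + 1 + i)))"
      unfolding S2_def Suc by (subst sum.atMost_Suc_shift) simp
    also have "\<dots> = (\<Sum>i\<le>b'. - (1 / fact b') * ((-1) ^ i * real (b' choose i) * (pochhammer x (c + i) / pochhammer a (c + b + 1 + i))))"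
    proof (intro sum.cong refl)
      fix i assume "i \<in> {..b'}"
      then have 1: "real (b' choose i) = fact b' / (fact i * fact (b' - i))" by (simp add: binomial_fact)
      have 2: "real (Suc i) / (fact (Suc i) * fact (b' - i)) = 1 / (fact i * fact (b' - i))"
        unfolding fact_Suc by (simp del: of_nat_Suc)
      have "(-1) ^ Suc i * real (Suc i) / (fact (Suc i) * fact (b' - i)) = (-1) ^ Suc i * (1 / (fact i * fact (b' - i)))"
        by (simp only: 2[symmetric] times_divide_eq_right)
      also have "\<dots> = - (1 / fact b') * ((-1) ^ i * real (b' choose i))" unfolding 1 by simp
      finally show "(-1) ^ Suc i * real (Suc i) / (fact (Suc i) * fact (b' - i)) * (pochhammer x (c + i) / pochhammer a (c + b + 1 + i)) =
        - (1 / fact b') * ((-1) ^ i * real (b' choose i) * (pochhammer x (c + i) / pochhammer a (c + b + 1 + i)))"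
        by (simp only: mult.assoc)
    qed
    also have "\<dots> = - (1 / fact b') * F x c (c + b + 1) b'"
      unfolding F_def sum_distrib_left ..
    also have "\<dots> = - (1 / fact b') * (pochhammer x c * pochhammer (lam + real b + 1) b' / pochhammer a (c + 2 * b))"
    proof -
      have "c + b + 1 + b' = c + 2 * b" "a - x + real (c + b + 1) - real c = lam + real b + 1"
        using Suc by (simp_all add: a_def x_def)
      then show ?thesis unfolding Feq by (simp only:)
    qed
    also have "1 / fact b' = real b / (fact b :: real)" by (simp add: Suc)
    finally show ?thesis using Suc by simp
  qed
  have S1: "F x c (c + b) b = pochhammer x c * pochhammer (lam + real b) b / pochhammer a (c + 2 * b)"
    unfolding Feq by (simp add: a_def x_def mult_2 add_ac)
  define C where "C = 2 ^ c / (2 ^ n :: real)"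
  have "(\<Sum>k\<le>n. expand_coeff (lam + sig) n k * zonal_coeff sig k c)
      = (\<Sum>i\<le>b. expand_coeff (lam + sig) n (c + 2 * i) * zonal_coeff sig (c + 2 * i) c)"
    unfolding 2(1)
  proof (rule sum_same_parity)
    fix K assume "\<And>l. K \<noteq> c + 2 * l"
    then have "zonal_coeff sig K c = 0"
      by (cases K c rule: half_fact_cases) (auto simp: zonal_coeff_def)
    then show "expand_coeff (lam + sig) (c + 2 * b) K * zonal_coeff sig K c = 0" by simp
  qed
  also have "\<dots> = (\<Sum>i\<le>b. C * (1 / fact b * ((-1) ^ i * real (b choose i) * (pochhammer x (c + i) / pochhammer a (c + b + i)))
       + (-1) ^ i * real i / (fact i * fact (b - i)) * (pochhammer x (c + i - 1) / pochhammer a (c + b + i))))"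
  proof (intro sum.cong refl)
    fix i assume "i \<in> {..b}"
    then have i: "i \<le> b" by simp
    then have 1: "real (b choose i) = fact b / (fact i * fact (b - i))" by (simp add: binomial_fact)
    show "expand_coeff (lam + sig) n (c + 2 * i) * zonal_coeff sig (c + 2 * i) c =
      C * (1 / fact b * ((-1) ^ i * real (b choose i) * (pochhammer x (c + i) / pochhammer a (c + b + i)))
       + (-1) ^ i * real i / (fact i * fact (b - i)) * (pochhammer x (c + i - 1) / pochhammer a (c + b + i)))"
      unfolding 1 expand_coeff_def zonal_coeff_def 2(1) half_fact_shift dv half_fact_simps C_def
      unfolding a_def[symmetric] x_def[symmetric]
      using i ne(1)[of "c + b + i"] by (simp add: field_simps)
  qed
  also have "\<dots> = C * (1 / fact b * F x c (c + b) b + S2)"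
    unfolding F_def S2_def sum_distrib_left sum.distrib[symmetric] by (simp add: distrib_left)
  also have "\<dots> = C * (pochhammer x c / (fact b * pochhammer a (c + 2 * b)) *
      (pochhammer (lam + real b) b - real b * pochhammer (lam + real b + 1) (b - 1)))"
    unfolding S1 S2 by (simp add: right_diff_distrib diff_divide_distrib mult_ac)
  also have "pochhammer (lam + real b) b - real b * pochhammer (lam + real b + 1) (b - 1)
     = pochhammer lam (2 * b) / pochhammer (lam + 1) b"
  proof (cases b)
    case 0 then show ?thesis by simp
  next
    case (Suc b')
    have "2 * b = Suc (b + b')" using Suc by simp
    then have "pochhammer lam (2 * b) = pochhammer lam (Suc (b + b'))" by (simp only:)
    also have "\<dots> = lam * (pochhammer (lam + 1) b * pochhammer (lam + real b + 1) b')"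
      unfolding pochhammer_rec pochhammer_add by (simp add: add_ac)
    finally have "pochhammer lam (2 * b) / pochhammer (lam + 1) b = lam * pochhammer (lam + real b + 1) b'"
      using ne(2)[of b] by simp
    moreover have "pochhammer (lam + real b) b = (lam + real b) * pochhammer (lam + real b + 1) b'"
      by (simp only: Suc pochhammer_rec)
    moreover have "b - 1 = b'" using Suc by simp
    ultimately show ?thesis by (simp add: algebra_simps)
  qed
  also have "C * (pochhammer x c / (fact b * pochhammer a (c + 2 * b)) * (pochhammer lam (2 * b) / pochhammer (lam + 1) b)) = mix_coeff lam sig n c"
    unfolding mix_coeff_def 2(1) half_fact_simps C_def a_def x_def
    by (simp add: power_add field_simps)
  finally show ?thesis .
qed

lemma zonal_coeff_inverse:
  assumes "\<nu> \<ge> 0"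
  shows "(\<Sum>k\<le>n. expand_coeff \<nu> n k * zonal_coeff \<nu> k c) = (if n = c then 1 else 0)"
proof -
  have "(\<Sum>k\<le>n. expand_coeff \<nu> n k * zonal_coeff \<nu> k c) = mix_coeff 0 \<nu> n c"
    using expand_zonal_coeff[of 0 \<nu> n c] assms by simp
  also have "\<dots> = (if n = c then 1 else 0)"
    using pochhammer_ne_0[of "\<nu> + 1" n] assms
    by (cases "n \<le> c") (auto simp: mix_coeff_def pochhammer_0_left)
  finally show ?thesis .
qed

section \<open>Moments of the one-dimensional weights\<close>

lemma set_integrable_symmetric_weight:
  assumes "\<beta> > (-1::real)"
  shows "set_integrable lborel {-1..1} (\<lambda>t. (1 - t\<^sup>2) powr \<beta>)"
proof -
  have "set_integrable lborel {0..1} (\<lambda>t::real. t powr \<beta> * (1 - t) powr \<beta>)"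
    using integrable_Beta[of "\<beta> + 1" "\<beta> + 1"] assms by simp
  then have "integrable lborel (\<lambda>t. indicator {0..1} (1/2 + 1/2 * t) *\<^sub>R
       ((1/2 + 1/2 * t) powr \<beta> * (1 - (1/2 + 1/2 * t)) powr \<beta>) :: real)"
    unfolding set_integrable_def by (rule lborel_integrable_real_affine) simp
  then have "integrable lborel (\<lambda>t. (1/4) powr (-\<beta>) * (indicator {0..1} (1/2 + 1/2 * t) *\<^sub>R
       ((1/2 + 1/2 * t) powr \<beta> * (1 - (1/2 + 1/2 * t)) powr \<beta>)) :: real)"
    by (rule integrable_mult_right)
  also have "(\<lambda>t. (1/4) powr (-\<beta>) * (indicator {0..1} (1/2 + 1/2 * t) *\<^sub>R
       ((1/2 + 1/2 * t) powr \<beta> * (1 - (1/2 + 1/2 * t)) powr \<beta>)) :: real) =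
      (\<lambda>t. indicator {-1..1} t *\<^sub>R (1 - t\<^sup>2) powr \<beta>)"
  proof
    fix t :: real
    show "(1/4) powr (-\<beta>) * (indicator {0..1} (1/2 + 1/2 * t) *\<^sub>R
       ((1/2 + 1/2 * t) powr \<beta> * (1 - (1/2 + 1/2 * t)) powr \<beta>)) = indicator {-1..1} t *\<^sub>R (1 - t\<^sup>2) powr \<beta>"
    proof (cases "t \<in> {-1..1}")
      case True
      then have "(1/2 + 1/2 * t) powr \<beta> * (1 - (1/2 + 1/2 * t)) powr \<beta>
               = ((1/2 + 1/2 * t) * (1 - (1/2 + 1/2 * t))) powr \<beta>" by (simp add: powr_mult)
      also have "(1/2 + 1/2 * t) * (1 - (1/2 + 1/2 * t)) = 1/4 * (1 - t\<^sup>2)"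
        by (simp add: field_simps power2_eq_square)
      also have "\<dots> powr \<beta> = (1/4) powr \<beta> * (1 - t\<^sup>2) powr \<beta>"
        by (rule powr_mult)
      finally show ?thesis using True by (simp add: powr_minus)
    next
      case False
      then have "1/2 + 1/2 * t \<notin> {0..1}" by auto
      with False show ?thesis by simp
    qed
  qed
  finally show ?thesis unfolding set_integrable_def .
qed

lemma set_integrable_continuous_mult:
  fixes w g :: "'a::euclidean_space \<Rightarrow> real"
  assumes "set_integrable lborel S w" "compact S" "continuous_on S g"
  shows "set_integrable lborel S (\<lambda>t. g t * w t)"
proof -
  obtain M where M: "\<And>t. t \<in> S \<Longrightarrow> \<bar>g t\<bar> \<le> M"
    using compact_imp_bounded[OF compact_continuous_image[OF assms(3,2)]]
    by (auto simp: bounded_iff)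
  have S: "S \<in> sets lborel" using assms(2) by (simp add: borel_compact)
  have gm: "(\<lambda>t. indicator S t *\<^sub>R g t) \<in> borel_measurable borel"
    by (rule borel_measurable_continuous_on_indicator) (use S assms(3) in auto)
  have wm: "(\<lambda>t. indicator S t * w t) \<in> borel_measurable borel"
    using assms(1) unfolding set_integrable_def by (auto dest: borel_measurable_integrable)
  have "integrable lborel (\<lambda>t. indicator S t * (g t * w t))"
  proof (rule Bochner_Integration.integrable_bound)
    show "integrable lborel (\<lambda>t. M * (indicator S t *\<^sub>R w t))"
      using assms(1) unfolding set_integrable_def by (rule integrable_mult_right)
    have "(\<lambda>t. (indicator S t *\<^sub>R g t) * (indicator S t * w t)) \<in> borel_measurable borel"
      using gm wm by measurable
    also have "(\<lambda>t. (indicator S t *\<^sub>R g t) * (indicator S t * w t)) = (\<lambda>t. indicator S t * (g t * w t))"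
      by (auto simp: indicator_def)
    finally show "(\<lambda>t. indicator S t * (g t * w t)) \<in> borel_measurable lborel" by simp
    show "AE x in lborel. norm (indicator S x * (g x * w x)) \<le> norm (M * indicator S x *\<^sub>R w x)"
    proof (rule AE_I2)
      fix x
      show "norm (indicator S x * (g x * w x)) \<le> norm (M * indicator S x *\<^sub>R w x)"
      proof (cases "x \<in> S")
        case True
        then have "\<bar>g x\<bar> \<le> \<bar>M\<bar>" using M[of x] by linarith
        then show ?thesis using True by (simp add: abs_mult mult_right_mono)
      qed simp
    qed
  qed
  then show ?thesis unfolding set_integrable_def by simp
qed

definition even_moment :: "real \<Rightarrow> nat \<Rightarrow> real" where
  "even_moment \<alpha> k = (if even k then pochhammer (1/2) (k div 2) / pochhammer (\<alpha> + 1) (k div 2) else 0)"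

text \<open>
  The function \<open>t\<^sup>j * (1 - t\<^sup>2)\<^bsup>\<alpha>+1/2\<^esup>\<close> vanishes at both ends, so its derivative has integral \<open>0\<close>.  This
  relates consecutive moments of equal parity; for \<open>j = 0\<close> it kills the first moment and hence all odd ones.
\<close>

lemma symmetric_weight_moment:
  fixes \<alpha> :: real
  assumes a: "\<alpha> > -1/2"
  defines "w \<equiv> \<lambda>t::real. (1 - t\<^sup>2) powr (\<alpha> - 1/2)"
  shows "(LINT t:{-1..1}|lborel. t ^ k * w t) = (LINT t:{-1..1}|lborel. w t) * even_moment \<alpha> k"
proof -
  have w: "set_integrable lborel {-1..1} w"
    unfolding w_def by (rule set_integrable_symmetric_weight) (use a in simp)
  have int: "set_integrable lborel {-1..1} (\<lambda>t. g t * w t)" if "continuous_on {-1..1} g" for g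
    by (rule set_integrable_continuous_mult[OF w]) (use that in auto)
  define J where "J k = (LINT t:{-1..1}|lborel. t ^ k * w t)" for k
  have rec: "real j * (J (j - 1) - J (j + 1)) = (2 * \<alpha> + 1) * J (j + 1)" for j
  proof -
    \<comment> \<open>In the case \<open>j = 0\<close> the truncated \<open>j - 1\<close> is harmless, because it comes with the factor \<open>j\<close>.\<close>
    let ?F = "\<lambda>t. t ^ j * (1 - t\<^sup>2) powr (\<alpha> + 1/2)"
    let ?f = "\<lambda>t. (real j * (t ^ (j - 1) - t ^ (j + 1)) - (2 * \<alpha> + 1) * t ^ (j + 1)) * w t"
    have "(?f has_integral (?F 1 - ?F (-1))) {-1..1}"
    proof (rule fundamental_theorem_of_calculus_interior)
      show "continuous_on {-1..1} ?F"
        using a by (intro continuous_intros continuous_on_powr') (auto simp: abs_square_le_1 abs_le_iff)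
      fix t :: real assume t: "t \<in> {-1<..<1}"
      then have pos: "1 - t\<^sup>2 > 0" by (simp add: abs_square_less_1 abs_less_iff)
      have e: "(1 - t\<^sup>2) powr (\<alpha> + 1/2) = (1 - t\<^sup>2) * w t"
        using powr_add[of "1 - t\<^sup>2" 1 "\<alpha> - 1/2"] pos by (simp add: w_def add.commute)
      have e2: "(1 - t\<^sup>2) powr (\<alpha> + 1/2 - 1) = w t" by (simp add: w_def)
      have "(?F has_real_derivative (real j * t ^ (j - 1) * (1 - t\<^sup>2) powr (\<alpha> + 1/2)
         + t ^ j * ((\<alpha> + 1/2) * (1 - t\<^sup>2) powr (\<alpha> + 1/2 - 1) * (- (2 * t))))) (at t)"
        using pos by (auto intro!: derivative_eq_intros DERIV_powr[THEN DERIV_cong] simp: field_simps)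
      also have "(real j * t ^ (j - 1) * (1 - t\<^sup>2) powr (\<alpha> + 1/2)
         + t ^ j * ((\<alpha> + 1/2) * (1 - t\<^sup>2) powr (\<alpha> + 1/2 - 1) * (- (2 * t)))) = ?f t"
        unfolding e e2 by (cases j) (simp_all add: algebra_simps power2_eq_square)
      finally show "(?F has_vector_derivative ?f t) (at t)"
        by (simp add: has_real_derivative_iff_has_vector_derivative)
    qed simp
    moreover have "?F 1 - ?F (-1) = 0" by simp
    ultimately have "integral {-1..1} ?f = 0" by (simp only: integral_unique)
    then have "(LINT t:{-1..1}|lborel. ?f t) = 0"
      by (subst set_borel_integral_eq_integral(2)[OF int]) (auto intro!: continuous_intros)
    also have "(LINT t:{-1..1}|lborel. ?f t)
       = (LINT t:{-1..1}|lborel. real j * (t ^ (j - 1) * w t) - real j * (t ^ (j + 1) * w t) - (2 * \<alpha> + 1) * (t ^ (j + 1) * w t))"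
      by (rule arg_cong[of _ _ "set_lebesgue_integral lborel {-1..1}"]) (auto simp: algebra_simps)
    also have "\<dots> = real j * J (j - 1) - real j * J (j + 1) - (2 * \<alpha> + 1) * J (j + 1)"
      unfolding J_def
      by (subst set_integral_diff(2) | intro set_integral_diff(1) set_integrable_mult_right int continuous_intros)+
         simp
    finally show ?thesis by (simp add: algebra_simps)
  qed
  have J1: "J 1 = 0" using rec[of 0] a by simp
  have step: "J (k + 2) = (real k + 1) / (real k + 2 * \<alpha> + 2) * J k" for k
  proof -
    have "real k + 2 * \<alpha> + 2 > 0" using a by linarith
    then show ?thesis using rec[of "k + 1"] by (simp add: field_simps)
  qed
  have ev: "J (2 * m) = J 0 * (pochhammer (1/2) m / pochhammer (\<alpha> + 1) m)" for m
  proof (induction m)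
    case (Suc m)
    have "J (2 * Suc m) = (real (2 * m) + 1) / (real (2 * m) + 2 * \<alpha> + 2) * J (2 * m)"
      using step[of "2 * m"] by simp
    also have "(real (2 * m) + 1) / (real (2 * m) + 2 * \<alpha> + 2) = (1/2 + real m) / (\<alpha> + 1 + real m)"
    proof -
      have "\<alpha> + 1 + real m > 0" using a by linarith
      then show ?thesis by (simp add: field_simps)
    qed
    finally show ?case unfolding Suc.IH by (simp add: pochhammer_Suc mult_ac)
  qed simp
  have od: "J (2 * m + 1) = 0" for m
  proof (induction m)
    case (Suc m)
    then show ?case using step[of "2 * m + 1"] by simp
  qed (use J1 in simp)
  have "J k = J 0 * even_moment \<alpha> k"
  proof (cases "even k")
    case True
    then obtain m where "k = 2 * m" by blast
    then show ?thesis using ev[of m] by (simp add: even_moment_def)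
  next
    case False
    then obtain m where "k = 2 * m + 1" by (rule oddE)
    then show ?thesis using od[of m] by (simp add: even_moment_def)
  qed
  then show ?thesis by (simp add: J_def)
qed

lemma set_integral_pos:
  fixes w :: "real \<Rightarrow> real"
  assumes "set_integrable lborel {a..b} w" "a < b" "\<And>t. t \<in> {a..b} \<Longrightarrow> w t \<ge> 0" "\<And>t. t \<in> {a<..<b} \<Longrightarrow> w t > 0"
  shows "(LINT t:{a..b}|lborel. w t) > 0"
proof -
  have nonneg: "(LINT t:{a..b}|lborel. w t) \<ge> 0"
    unfolding set_lebesgue_integral_def by (rule integral_nonneg_AE) (use assms(3) in \<open>auto simp: indicator_def\<close>)
  have "(LINT t:{a..b}|lborel. w t) \<noteq> 0"
  proof
    assume "(LINT t:{a..b}|lborel. w t) = 0"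
    then have "AE t in lborel. indicator {a..b} t *\<^sub>R w t = 0"
      unfolding set_lebesgue_integral_def
      by (subst (asm) integral_nonneg_eq_0_iff_AE)
         (use assms(1,3) in \<open>auto simp: indicator_def set_integrable_def\<close>)
    then have "AE t in lborel. t \<notin> {a<..<b}"
      by eventually_elim (use assms(4) in \<open>force simp: indicator_def\<close>)
    then have "emeasure lborel {a<..<b} = 0"
      by (subst (asm) AE_iff_measurable[where N = "{a<..<b}"]) auto
    with assms(2) show False by simp
  qed
  with nonneg show ?thesis by simp
qed

lemma symmetric_weight_integral_pos:
  assumes "\<alpha> > (-1/2::real)"
  shows "(LINT t:{-1..1}|lborel. (1 - t\<^sup>2) powr (\<alpha> - 1/2)) > 0"
  by (rule set_integral_pos[OF set_integrable_symmetric_weight])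
     (use assms in \<open>auto simp: abs_square_less_1 abs_less_iff abs_square_eq_1 power2_eq_1_iff less_imp_neq\<close>)

lemma Beta_add_nat:
  assumes "a > 0" "b > (0::real)"
  shows "Beta (a + real i) (b + real j) = Beta a b * (pochhammer a i * pochhammer b j / pochhammer (a + b) (i + j))"
proof -
  have G: "Gamma (z + real n) = pochhammer z n * Gamma z" if "z > 0" for z :: real and n
  proof -
    have "z \<notin> \<int>\<^sub>\<le>\<^sub>0" using that by auto
    moreover have "Gamma z \<noteq> 0" using Gamma_real_pos[OF that] by simp
    ultimately show ?thesis by (simp add: pochhammer_Gamma)
  qed
  have "Gamma (a + b) \<noteq> 0" using assms Gamma_real_pos[of "a + b"] by (metis add_pos_pos less_irrefl)
  moreover have "pochhammer (a + b) (i + j) \<noteq> 0" using assms by (intro pochhammer_ne_0) simp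
  ultimately have ne: "Gamma (a + b) \<noteq> 0" "pochhammer (a + b) (i + j) \<noteq> 0" by simp_all
  have e: "a + real i + (b + real j) = a + b + real (i + j)" by simp
  show ?thesis
    unfolding Beta_def e G[OF assms(1)] G[OF assms(2)] using G[of "a + b" "i + j"] assms ne
    by (simp add: field_simps)
qed

lemma Beta_weight_moment:
  fixes a b :: real
  assumes "a > 0" "b > 0"
  shows "set_integrable lborel {0..1} (\<lambda>u. u ^ i * (1 - u) ^ j * (u powr (a - 1) * (1 - u) powr (b - 1)))"
    and "(LINT u:{0..1}|lborel. u ^ i * (1 - u) ^ j * (u powr (a - 1) * (1 - u) powr (b - 1))) =
         Beta a b * (pochhammer a i * pochhammer b j / pochhammer (a + b) (i + j))"
proof -
  show *: "set_integrable lborel {0..1} (\<lambda>u. u ^ i * (1 - u) ^ j * (u powr (a - 1) * (1 - u) powr (b - 1)))"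
    by (rule set_integrable_continuous_mult[OF integrable_Beta[OF assms]]) (auto intro!: continuous_intros)
  have eq: "u ^ i * (1 - u) ^ j * (u powr (a - 1) * (1 - u) powr (b - 1)) =
       u powr (a + real i - 1) * (1 - u) powr (b + real j - 1)" if "u \<in> {0<..<1}" for u
  proof -
    have "u ^ i * u powr (a - 1) = u powr (a + real i - 1)"
      "(1 - u) ^ j * (1 - u) powr (b - 1) = (1 - u) powr (b + real j - 1)"
      using that by (simp_all add: powr_realpow[symmetric] powr_add[symmetric] algebra_simps)
    then show ?thesis by (metis mult.assoc mult.left_commute)
  qed
  have "(LINT u:{0..1}|lborel. u ^ i * (1 - u) ^ j * (u powr (a - 1) * (1 - u) powr (b - 1)))
      = integral {0..1} (\<lambda>u. u ^ i * (1 - u) ^ j * (u powr (a - 1) * (1 - u) powr (b - 1)))"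
    by (rule set_borel_integral_eq_integral(2)[OF *])
  also have "\<dots> = integral {0<..<1} (\<lambda>u. u ^ i * (1 - u) ^ j * (u powr (a - 1) * (1 - u) powr (b - 1)))"
    by (simp add: integral_open_interval_real)
  also have "\<dots> = integral {0<..<1} (\<lambda>u. u powr (a + real i - 1) * (1 - u) powr (b + real j - 1))"
    by (rule integral_cong) (rule eq)
  also have "\<dots> = integral {0..1} (\<lambda>u. u powr (a + real i - 1) * (1 - u) powr (b + real j - 1))"
    by (simp add: integral_open_interval_real)
  also have "\<dots> = Beta (a + real i) (b + real j)"
    using has_integral_Beta_real[of "a + real i" "b + real j"] assms by (intro integral_unique) auto
  finally show "(LINT u:{0..1}|lborel. u ^ i * (1 - u) ^ j * (u powr (a - 1) * (1 - u) powr (b - 1))) =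
         Beta a b * (pochhammer a i * pochhammer b j / pochhammer (a + b) (i + j))"
    using Beta_add_nat[OF assms] by simp
qed

lemma Beta_real_pos: "a > 0 \<Longrightarrow> b > 0 \<Longrightarrow> Beta a b > (0::real)"
  unfolding Beta_def by (simp add: Gamma_real_pos)

section \<open>Rotations and radial functions on the unit ball\<close>

text \<open>
  By Vitali's covering theorem an open set is, up to a null set, a countable disjoint union of balls,
  and an orthogonal transformation maps these to disjoint balls of the same radii.  Together with the
  same estimate for the inverse this gives rotation invariance of Lebesgue measure without
  determinants.
\<close>

lemma emeasure_orthogonal_image_ge:
  fixes f :: "'a::euclidean_space \<Rightarrow> 'a"
  assumes f: "orthogonal_transformation f" and U: "open U"
  shows "emeasure lborel U \<le> emeasure lborel (f ` U)"
proof -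
  define K where "K = {(x, r). 0 < r \<and> ball x r \<subseteq> U}"
  have cov: "\<exists>i. i \<in> K \<and> x \<in> ball (fst i) (snd i) \<and> snd i < d" if x: "x \<in> U" and d: "0 < d" for x and d :: real
  proof -
    obtain e where e: "e > 0" "ball x e \<subseteq> U" using U x openE by blast
    then show ?thesis using d
      by (intro exI[of _ "(x, min e (d / 2))"]) (auto simp: K_def subset_eq)
  qed
  obtain C where C: "countable C" "C \<subseteq> K"
     "pairwise (\<lambda>i j. disjnt (ball (fst i) (snd i)) (ball (fst j) (snd j))) C"
     "negligible (U - (\<Union>i \<in> C. ball (fst i) (snd i)))"
    using Vitali_covering_theorem_balls[of U K fst snd] cov by blast
  define B where "B = (\<Union>i \<in> C. ball (fst i) (snd i))"
  have lin: "linear f" and inj: "inj f" using f orthogonal_transformation_linear orthogonal_transformation_inj by blast+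
  have Bopen: "open B" by (auto simp: B_def)
  have BU: "B \<subseteq> U" using C(2) unfolding B_def K_def by fastforce
  have disj: "disjoint_family_on (\<lambda>i. ball (fst i) (snd i)) C"
    using C(3) by (auto simp: disjoint_family_on_def pairwise_def disjnt_def)
  have img: "f ` ball x r = ball (f x) r" for x r
    by (rule image_orthogonal_transformation_ball[OF f])
  have disj': "disjoint_family_on (\<lambda>i. ball (f (fst i)) (snd i)) C"
    unfolding disjoint_family_on_def img[symmetric] image_Int[OF inj, symmetric]
    using disj by (auto simp: disjoint_family_on_def)
  have fB: "f ` B = (\<Union>i\<in>C. ball (f (fst i)) (snd i))"
    by (simp add: B_def image_UN img)
  have "emeasure lborel (U - B) = 0"
  proof -
    have "U - B \<in> sets borel" using U Bopen by auto
    moreover have "emeasure lebesgue (U - B) = 0"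
      using C(4) \<open>U - B \<in> sets borel\<close> unfolding B_def[symmetric] by (subst negligible_iff_emeasure0[symmetric]) auto
    ultimately show ?thesis by simp
  qed
  moreover have "emeasure lborel U \<le> emeasure lborel B + emeasure lborel (U - B)"
  proof -
    have "U = B \<union> (U - B)" using BU by auto
    then show ?thesis using emeasure_subadditive[of B lborel "U - B"] U Bopen by auto
  qed
  ultimately have "emeasure lborel U \<le> emeasure lborel B" by simp
  also have "\<dots> = (\<integral>\<^sup>+i. emeasure lborel (ball (fst i) (snd i)) \<partial>count_space C)"
    unfolding B_def using C(1) disj by (intro emeasure_UN_countable) auto
  also have "\<dots> = (\<integral>\<^sup>+i. emeasure lborel (ball (f (fst i)) (snd i)) \<partial>count_space C)"
    using C(2) by (intro nn_integral_cong) (auto simp: K_def emeasure_ball)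
  also have "\<dots> = emeasure lborel (f ` B)"
    unfolding fB using C(1) disj' by (intro emeasure_UN_countable[symmetric]) auto
  also have "\<dots> \<le> emeasure lborel (f ` U)"
  proof (rule emeasure_mono)
    have "open (f ` U)"
      by (rule open_surjective_linear_image[OF U lin orthogonal_transformation_surj[OF f]])
    then show "f ` U \<in> sets lborel" by simp
  qed (use BU in auto)
  finally show ?thesis .
qed

lemma distr_lborel_orthogonal_transformation:
  fixes f :: "'a::euclidean_space \<Rightarrow> 'a"
  assumes f: "orthogonal_transformation f"
  shows "distr lborel borel f = lborel"
proof (rule lborel_eqI[symmetric])
  have fm: "f \<in> borel_measurable borel"
    using f by (intro borel_measurable_continuous_onI linear_continuous_on)
       (auto simp: orthogonal_transformation_linear linear_conv_bounded_linear[symmetric])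
  fix l u :: 'a
  assume lu: "\<And>b. b \<in> Basis \<Longrightarrow> l \<bullet> b \<le> u \<bullet> b"
  define g where "g = inv f"
  have g: "orthogonal_transformation g" unfolding g_def by (rule orthogonal_transformation_inv[OF f])
  have bij: "bij f" using f by (rule orthogonal_transformation_bij)
  have img: "f -` box l u = g ` box l u" unfolding g_def using bij by (simp add: bij_vimage_eq_inv_image)
  have fgbox: "f ` g ` box l u = box l u"
    unfolding g_def using bij by (simp add: bij_is_surj image_f_inv_f)
  have opn: "open (g ` box l u)"
    by (rule open_surjective_linear_image[OF open_box orthogonal_transformation_linear[OF g] orthogonal_transformation_surj[OF g]])
  have "emeasure (distr lborel borel f) (box l u) = emeasure lborel (g ` box l u)"
    by (subst emeasure_distr) (use fm in \<open>auto simp: img\<close>)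
  also have "\<dots> = emeasure lborel (box l u)"
    using emeasure_orthogonal_image_ge[OF g open_box[of l u]] emeasure_orthogonal_image_ge[OF f opn]
    unfolding fgbox by (rule antisym[rotated])
  finally show "emeasure (distr lborel borel f) (box l u) = ennreal (\<Prod>b\<in>Basis. (u - l) \<bullet> b)"
    using lu by simp
qed simp

lemma set_integral_orthogonal_transformation:
  fixes f :: "'a::euclidean_space \<Rightarrow> 'a" and h :: "'a \<Rightarrow> real"
  assumes f: "orthogonal_transformation f"
    and h: "set_integrable lborel (cball 0 1) h"
  shows "(LINT x:cball 0 1|lborel. h (f x)) = (LINT x:cball 0 1|lborel. h x)"
proof -
  have fm: "f \<in> measurable lborel borel"
    using f by (auto intro!: borel_measurable_continuous_onI linear_continuous_on
        simp: orthogonal_transformation_linear linear_conv_bounded_linear[symmetric])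
  have hm: "(\<lambda>x. indicator (cball 0 1) x *\<^sub>R h x) \<in> borel_measurable borel"
    using h unfolding set_integrable_def by (auto dest: borel_measurable_integrable)
  have "(LINT x:cball 0 1|lborel. h x) = (LINT x|distr lborel borel f. indicator (cball 0 1) x *\<^sub>R h x)"
    unfolding set_lebesgue_integral_def distr_lborel_orthogonal_transformation[OF f] ..
  also have "\<dots> = (LINT x|lborel. indicator (cball 0 1) (f x) *\<^sub>R h (f x))"
    by (rule integral_distr[OF fm hm])
  also have "\<dots> = (LINT x:cball 0 1|lborel. h (f x))"
    unfolding set_lebesgue_integral_def
    by (rule Bochner_Integration.integral_cong) (auto simp: indicator_def orthogonal_transformation_norm[OF f])
  finally show ?thesis ..
qed

text \<open>
  Polar coordinates are replaced by the distribution of \<open>\<parallel>x\<parallel>\<^sup>2\<close>: the ball of radius \<open>r\<close> has measure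
  proportional to \<open>r\<^sup>D\<close>, so this distribution has a density proportional to \<open>s\<^bsup>D/2-1\<^esup>\<close>.
\<close>

lemma distr_norm_square_ball:
  fixes V D :: real
  defines "D \<equiv> real DIM('a::euclidean_space)"
    and "V \<equiv> unit_ball_vol (real DIM('a))"
  shows "distr (density lborel (indicator (cball 0 1))) borel (\<lambda>x::'a. (norm x)\<^sup>2) =
         density lborel (\<lambda>s. ennreal (indicator {0..1} s * (V * D / 2 * s powr (D / 2 - 1))))"
    (is "?M = ?N")
proof (rule measure_eqI_lessThan)
  have D: "D > 0" by (simp add: D_def)
  have V: "V > 0" by (simp add: V_def)
  have M: "emeasure ?M {a<..} = ennreal (V * (1 - (max 0 (min 1 a)) powr (D / 2)))" for a
  proof -
    define r where "r = sqrt (max 0 (min 1 a))"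
    have r: "0 \<le> r" "r \<le> 1" by (auto simp: r_def)
    have "emeasure ?M {a<..} = emeasure (density lborel (indicator (cball 0 1))) {x::'a. (norm x)\<^sup>2 > a}"
      by (subst emeasure_distr) (auto simp: vimage_def)
    also have "\<dots> = emeasure lborel (cball 0 1 \<inter> {x::'a. (norm x)\<^sup>2 > a})"
      by (subst emeasure_density) (auto intro!: borel_measurable_indicator simp: nn_integral_indicator[symmetric] indicator_inter_arith
            simp del: nn_integral_indicator intro!: nn_integral_cong)
    also have "\<dots> = emeasure lborel (cball 0 1 - (if a < 0 then {} else cball (0::'a) r))"
    proof (rule arg_cong[of _ _ "emeasure lborel"])
      have "(norm x)\<^sup>2 > a \<longleftrightarrow> norm x > r" if "a \<ge> 0" "norm x \<le> 1" for x :: 'a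
      proof (cases "a \<le> 1")
        case True
        then have "r\<^sup>2 = a" "r \<ge> 0" using that by (auto simp: r_def)
        then show ?thesis using power_mono_iff[of "norm x" r 2] by (auto simp: not_le[symmetric])
      next
        case False
        have "(norm x)\<^sup>2 \<le> 1" using that(2) by (simp add: power_le_one)
        then show ?thesis using False that by (auto simp: r_def)
      qed
      then show "cball 0 1 \<inter> {x::'a. (norm x)\<^sup>2 > a} = cball 0 1 - (if a < 0 then {} else cball (0::'a) r)"
        by (auto simp: not_le intro: less_le_trans[OF _ zero_le_power2])
    qed
    also have "\<dots> = ennreal (V * (1 - (max 0 (min 1 a)) powr (D / 2)))"
    proof (cases "a < 0")
      case True
      then show ?thesis using emeasure_cball[of 1 "0::'a"] by (simp add: V_def)
    next
      case False
      have "r ^ DIM('a) = (max 0 (min 1 a)) powr (D / 2)"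
      proof (cases "max 0 (min 1 a) = 0")
        case True then show ?thesis using D by (simp add: r_def D_def power_0_left)
      next
        case False
        then have "r > 0" by (simp add: r_def)
        then have "r ^ DIM('a) = r powr D" by (simp add: D_def powr_realpow)
        also have "\<dots> = ((max 0 (min 1 a)) powr (1/2)) powr D" by (simp add: r_def powr_half_sqrt)
        finally show ?thesis by (simp add: powr_powr)
      qed
      then have e: "emeasure lborel (cball (0::'a) r) = ennreal (V * (max 0 (min 1 a)) powr (D / 2))"
        using emeasure_cball[of r "0::'a"] r by (simp add: V_def)
      have "emeasure lborel (cball 0 1 - cball (0::'a) r) = emeasure lborel (cball (0::'a) 1) - emeasure lborel (cball (0::'a) r)"
        by (rule emeasure_Diff) (use e r in auto)
      also have "\<dots> = ennreal V - ennreal (V * (max 0 (min 1 a)) powr (D / 2))"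
        using emeasure_cball[of 1 "0::'a"] e by (simp add: V_def)
      also have "\<dots> = ennreal (V - V * (max 0 (min 1 a)) powr (D / 2))"
        by (rule ennreal_minus) (use V in simp)
      finally show ?thesis using False by (simp add: right_diff_distrib)
    qed
    finally show ?thesis .
  qed
  have N: "emeasure ?N {a<..} = ennreal (V * (1 - (max 0 (min 1 a)) powr (D / 2)))" for a
  proof -
    define c where "c = max 0 (min 1 a)"
    have c: "0 \<le> c" "c \<le> 1" by (auto simp: c_def)
    let ?f = "\<lambda>s. V * D / 2 * s powr (D / 2 - 1)"
    have "(?f has_integral (V * 1 powr (D / 2) - V * c powr (D / 2))) {c..1}"
    proof (rule fundamental_theorem_of_calculus_interior)
      show "continuous_on {c..1} (\<lambda>s. V * s powr (D / 2))"
        using c D by (intro continuous_intros continuous_on_powr') auto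
      fix x assume "x \<in> {c<..<1}"
      then have "x > 0" using c by auto
      then show "((\<lambda>s. V * s powr (D / 2)) has_vector_derivative ?f x) (at x)"
        unfolding has_real_derivative_iff_has_vector_derivative[symmetric]
        by (auto intro!: derivative_eq_intros)
    qed (use c in simp)
    moreover have "(\<lambda>s. if s \<in> {c..1} then ?f s else 0) = (\<lambda>s. indicator {c..1} s * ?f s)"
      by (auto simp: indicator_def)
    ultimately have "((\<lambda>s. indicator {c..1} s * ?f s) has_integral (V * (1 - c powr (D / 2)))) UNIV"
      by (subst (asm) has_integral_restrict_UNIV[symmetric])
         (simp only: right_diff_distrib powr_one_eq_one)
    then have I: "(\<integral>\<^sup>+s. ennreal (indicator {c..1} s * ?f s) \<partial>lborel) = ennreal (V * (1 - c powr (D / 2)))"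
      by (intro nn_integral_has_integral_lborel) (use V D in \<open>auto simp: indicator_def\<close>)
    have "emeasure ?N {a<..} = (\<integral>\<^sup>+s. ennreal (indicator {0..1} s * ?f s) * indicator {a<..} s \<partial>lborel)"
      by (rule emeasure_density) auto
    also have "\<dots> = (\<integral>\<^sup>+s. ennreal (indicator {c..1} s * ?f s) \<partial>lborel)"
    proof (rule nn_integral_cong_AE)
      have "AE s in lborel. s \<noteq> c" by (rule AE_lborel_singleton)
      moreover have "AE s in lborel. s \<noteq> (1::real)" by (rule AE_lborel_singleton)
      ultimately show "AE s in lborel. ennreal (indicator {0..1} s * ?f s) * indicator {a<..} s = ennreal (indicator {c..1} s * ?f s)"
        by eventually_elim (auto simp: indicator_def c_def)
    qed
    finally show ?thesis unfolding I by (simp add: c_def)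
  qed
  show "emeasure ?M {a<..} < \<infinity>" for a unfolding M by simp
  show "emeasure ?M {a<..} = emeasure ?N {a<..}" for a unfolding M N ..
qed simp_all

lemma set_integral_norm_square_ball:
  fixes \<phi> :: "real \<Rightarrow> real"
  defines "D \<equiv> real DIM('a::euclidean_space)"
    and "V \<equiv> unit_ball_vol (real DIM('a))"
  assumes m: "\<phi> \<in> borel_measurable borel"
  shows "set_integrable lborel {0..1} (\<lambda>s. \<phi> s * s powr (D / 2 - 1)) \<Longrightarrow>
          set_integrable lborel (cball 0 1) (\<lambda>x::'a. \<phi> ((norm x)\<^sup>2))"
    and "(LINT x:cball 0 1|lborel. \<phi> ((norm (x::'a))\<^sup>2)) =
         V * D / 2 * (LINT s:{0..1}|lborel. \<phi> s * s powr (D / 2 - 1))"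
proof -
  let ?M = "distr (density lborel (indicator (cball 0 1))) borel (\<lambda>x::'a. (norm x)\<^sup>2)"
  let ?N = "density lborel (\<lambda>s. ennreal (indicator {0..1} s * (V * D / 2 * s powr (D / 2 - 1))))"
  have D: "D > 0" by (simp add: D_def)
  have V: "V > 0" by (simp add: V_def)
  have MN: "?M = ?N" unfolding D_def V_def by (rule distr_norm_square_ball)
  have dens: "density lborel (indicator (cball (0::'a) 1)) = density lborel (\<lambda>x. ennreal (indicator (cball 0 1) x))"
    by (simp add: ennreal_indicator)
  have "integral\<^sup>L ?M \<phi> = integral\<^sup>L (density lborel (indicator (cball 0 1))) (\<lambda>x::'a. \<phi> ((norm x)\<^sup>2))"
    using m by (intro integral_distr) auto
  also have "\<dots> = (LINT x|lborel. indicator (cball 0 1) x *\<^sub>R \<phi> ((norm (x::'a))\<^sup>2))"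
    unfolding dens using m by (intro integral_density) (auto intro!: borel_measurable_indicator)
  finally have 1: "integral\<^sup>L ?M \<phi> = (LINT x:cball 0 1|lborel. \<phi> ((norm (x::'a))\<^sup>2))"
    by (simp add: set_lebesgue_integral_def)
  have "integral\<^sup>L ?N \<phi> = (LINT s|lborel. (indicator {0..1} s * (V * D / 2 * s powr (D / 2 - 1))) *\<^sub>R \<phi> s)"
    using m V D by (intro integral_density) (auto simp: indicator_def)
  also have "\<dots> = (LINT s|lborel. (V * D / 2) * (indicator {0..1} s *\<^sub>R (\<phi> s * s powr (D / 2 - 1))))"
    by (intro Bochner_Integration.integral_cong) auto
  also have "\<dots> = V * D / 2 * (LINT s:{0..1}|lborel. \<phi> s * s powr (D / 2 - 1))"
    unfolding set_lebesgue_integral_def by (rule integral_mult_right_zero)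
  finally show "(LINT x:cball 0 1|lborel. \<phi> ((norm (x::'a))\<^sup>2)) =
         V * D / 2 * (LINT s:{0..1}|lborel. \<phi> s * s powr (D / 2 - 1))"
    unfolding 1[symmetric] MN by simp
  assume "set_integrable lborel {0..1} (\<lambda>s. \<phi> s * s powr (D / 2 - 1))"
  then have "integrable lborel (\<lambda>s. (V * D / 2) * (indicator {0..1} s *\<^sub>R (\<phi> s * s powr (D / 2 - 1))))"
    unfolding set_integrable_def by (rule integrable_mult_right)
  also have "(\<lambda>s. (V * D / 2) * (indicator {0..1} s *\<^sub>R (\<phi> s * s powr (D / 2 - 1)))) =
      (\<lambda>s. (indicator {0..1} s * (V * D / 2 * s powr (D / 2 - 1))) *\<^sub>R \<phi> s)" by auto
  finally have "integrable ?N \<phi>"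
    using m V D by (subst integrable_density) (auto simp: indicator_def)
  then have "integrable ?M \<phi>" unfolding MN .
  then have "integrable (density lborel (indicator (cball 0 1))) (\<lambda>x::'a. \<phi> ((norm x)\<^sup>2))"
    using m by (subst (asm) integrable_distr_eq) auto
  then show "set_integrable lborel (cball 0 1) (\<lambda>x::'a. \<phi> ((norm x)\<^sup>2))"
    unfolding dens set_integrable_def using m by (subst (asm) integrable_density) (auto intro!: borel_measurable_indicator)
qed

section \<open>Moments of the weight on the ball\<close>

text \<open>
  For unit vectors \<open>y\<close> and \<open>z\<close> with \<open>y \<bullet> z = s\<close> the left-hand side is \<open>\<parallel>y + \<tau> z\<parallel>\<^bsup>2p\<^esup>\<close>.
\<close>

lemma trinomial_expansion:
  fixes s \<tau> :: real
  shows "(1 + 2 * s * \<tau> + \<tau>\<^sup>2) ^ p =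
    (\<Sum>m\<le>2 * p. (fact p * (\<Sum>K\<le>m. (2 * s) ^ K / fact K * half_fact (2 * p - m) K * half_fact m K)) * \<tau> ^ m)"
proof -
  define F where "F K m = fact p * ((2 * s) ^ K / fact K * half_fact (2 * p - m) K * half_fact m K) * \<tau> ^ m" for K m
  have inner: "(\<Sum>m\<le>2 * p. F K m) = real (p choose K) * (2 * s * \<tau>) ^ K * (1 + \<tau>\<^sup>2) ^ (p - K)" if K: "K \<le> p" for K
  proof -
    have "(\<Sum>m\<le>2 * p. F K m) = sum (F K) ((\<lambda>j. K + 2 * j) ` {..p - K})"
    proof (rule sum.mono_neutral_right)
      show "\<forall>m\<in>{..2 * p} - (\<lambda>j. K + 2 * j) ` {..p - K}. F K m = 0"
      proof
        fix m assume m: "m \<in> {..2 * p} - (\<lambda>j. K + 2 * j) ` {..p - K}"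
        show "F K m = 0"
        proof (cases m K rule: half_fact_cases)
          case (2 j)
          then have "j > p - K" using m by (auto simp: image_iff)
          then have "2 * p - m < K" using 2 m K by auto
          then show ?thesis by (simp add: F_def)
        qed (simp add: F_def)
      qed
    qed (use K in auto)
    also have "\<dots> = (\<Sum>j\<le>p - K. F K (K + 2 * j))"
      by (subst sum.reindex) (auto simp: inj_on_def)
    also have "\<dots> = (\<Sum>j\<le>p - K. real (p choose K) * (2 * s * \<tau>) ^ K * (real ((p - K) choose j) * (\<tau>\<^sup>2) ^ j))"
    proof (rule sum.cong[OF refl])
      fix j assume "j \<in> {..p - K}"
      then have j: "j \<le> p - K" by simp
      have "2 * p - (K + 2 * j) = K + 2 * (p - K - j)" using j K by simp
      then have h: "half_fact (2 * p - (K + 2 * j)) K = 1 / fact (p - K - j)" by simp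
      show "F K (K + 2 * j) = real (p choose K) * (2 * s * \<tau>) ^ K * (real ((p - K) choose j) * (\<tau>\<^sup>2) ^ j)"
      proof -
        have e: "\<tau> ^ (K + 2 * j) = \<tau> ^ K * (\<tau>\<^sup>2) ^ j" by (simp add: power_add power_mult)
        show ?thesis
          unfolding F_def h half_fact_simps binomial_fact[OF K] binomial_fact[OF j] e
          by (simp add: power_mult_distrib mult_ac)
      qed
    qed
    also have "\<dots> = real (p choose K) * (2 * s * \<tau>) ^ K * (\<Sum>j\<le>p - K. real ((p - K) choose j) * (\<tau>\<^sup>2) ^ j)"
      by (simp add: sum_distrib_left)
    also have "(\<Sum>j\<le>p - K. real ((p - K) choose j) * (\<tau>\<^sup>2) ^ j) = (1 + \<tau>\<^sup>2) ^ (p - K)"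
      using binomial_ring[of "\<tau>\<^sup>2" 1 "p - K"] by (simp add: add.commute)
    finally show ?thesis .
  qed
  have big: "F K m = 0" if "p < K" for K m
  proof -
    have "m < K \<or> 2 * p - m < K" using that by linarith
    then show ?thesis by (auto simp: F_def)
  qed
  have "(\<Sum>m\<le>2 * p. (fact p * (\<Sum>K\<le>m. (2 * s) ^ K / fact K * half_fact (2 * p - m) K * half_fact m K)) * \<tau> ^ m)
      = (\<Sum>m\<le>2 * p. \<Sum>K\<le>m. F K m)"
    by (simp add: F_def sum_distrib_left sum_distrib_right)
  also have "\<dots> = (\<Sum>m\<le>2 * p. \<Sum>K\<le>2 * p. F K m)"
    by (intro sum.cong refl sum_atMost_extend) (auto simp: F_def)
  also have "\<dots> = (\<Sum>K\<le>2 * p. \<Sum>m\<le>2 * p. F K m)" by (rule sum.swap)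
  also have "\<dots> = (\<Sum>K\<le>p. \<Sum>m\<le>2 * p. F K m)"
    by (rule sum_atMost_extend[symmetric]) (auto simp: big)
  also have "\<dots> = (\<Sum>K\<le>p. real (p choose K) * (2 * s * \<tau>) ^ K * (1 + \<tau>\<^sup>2) ^ (p - K))"
    by (intro sum.cong refl inner) simp
  also have "\<dots> = (2 * s * \<tau> + (1 + \<tau>\<^sup>2)) ^ p" by (simp add: binomial_ring)
  finally show ?thesis by (simp add: add_ac)
qed

text \<open>
  The locale fixes the parameters together with \<open>\<sigma>\<close>, the index of the sphere in \<open>\<real>\<^sup>d\<close>, and \<open>\<nu>\<close>, the index
  of the Gegenbauer polynomials in the theorem.
\<close>

locale radial_ball_weight =
  fixes lam mu sig nu :: real and W :: "real ^ 'd \<Rightarrow> real"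
  assumes card_d: "2 \<le> CARD('d)" and lam: "0 < lam" and mu: "0 \<le> mu"
    and sig_def: "sig = (real CARD('d) - 2) / 2"
    and nu_def: "nu = lam + mu + (real CARD('d) - 1) / 2"
    and W_def: "W = ball_weight lam mu"
begin

lemma sig_nonneg: "0 \<le> sig" and nu_pos: "0 < nu" and nu_eq: "lam + sig + 1 + (mu + 1/2) = nu + 1"
  and dim_half: "real CARD('d) / 2 = sig + 1"
  using card_d lam mu by (auto simp: sig_def nu_def field_simps)

definition radial :: "nat \<Rightarrow> nat \<Rightarrow> real ^ 'd \<Rightarrow> real" where
  "radial A B x = (1 - (norm x)\<^sup>2) ^ A * ((norm x)\<^sup>2) ^ B"

definition radial_moment :: "nat \<Rightarrow> nat \<Rightarrow> real" where
  "radial_moment A B = pochhammer (mu + 1/2) A * pochhammer (lam + sig + 1) B / pochhammer (nu + 1) (A + B)"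

text \<open>
  Expectation with respect to the probability measure \<open>W x dx\<close> on the ball.
\<close>

definition ball_E :: "(real ^ 'd \<Rightarrow> real) \<Rightarrow> real" where
  "ball_E f = (LINT x:cball 0 1|lborel. f x * W x)"

lemma ball_weight0_radial:
  "set_integrable lborel (cball 0 1) (\<lambda>x::real^'d. radial A B x * ball_weight0 lam mu x)"
  "(LINT x:cball 0 1|lborel. radial A B x * ball_weight0 lam mu (x::real^'d)) =
     unit_ball_vol (real CARD('d)) * real CARD('d) / 2 * Beta (lam + sig + 1) (mu + 1/2) * radial_moment A B"
proof -
  define \<phi> where "\<phi> s = (1 - s) ^ A * s ^ B * (s powr lam * (1 - s) powr (mu - 1/2))" for s :: real
  have m: "\<phi> \<in> borel_measurable borel" unfolding \<phi>_def by measurable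
  have a: "lam + sig + 1 > 0" and b: "mu + 1/2 > 0" using lam mu sig_nonneg by auto
  have w: "radial A B x * ball_weight0 lam mu x = \<phi> ((norm x)\<^sup>2)" for x :: "real^'d"
  proof -
    have "(norm x)\<^sup>2 powr lam = norm x powr (2 * lam)"
    proof (cases "norm x = 0")
      case False
      then have "(norm x)\<^sup>2 = norm x powr 2" by simp
      then show ?thesis by (simp only: powr_powr)
    qed simp
    then show ?thesis by (simp add: radial_def ball_weight0_def \<phi>_def)
  qed
  have e: "\<phi> s * s powr (real CARD('d) / 2 - 1) =
      s ^ B * (1 - s) ^ A * (s powr (lam + sig + 1 - 1) * (1 - s) powr (mu + 1/2 - 1))" for s
    unfolding \<phi>_def dim_half by (simp add: powr_add mult_ac)
  have i: "set_integrable lborel {0..1} (\<lambda>s. \<phi> s * s powr (real DIM(real^'d) / 2 - 1))"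
    using Beta_weight_moment(1)[OF a b, of B A] by (simp add: e)
  show "set_integrable lborel (cball 0 1) (\<lambda>x::real^'d. radial A B x * ball_weight0 lam mu x)"
    unfolding w by (rule set_integral_norm_square_ball(1)[OF m i])
  have "(LINT x:cball 0 1|lborel. radial A B x * ball_weight0 lam mu (x::real^'d)) =
      unit_ball_vol (real DIM(real^'d)) * real DIM(real^'d) / 2 * (LINT s:{0..1}|lborel. \<phi> s * s powr (real DIM(real^'d) / 2 - 1))"
    unfolding w by (rule set_integral_norm_square_ball(2)[OF m])
  also have "(LINT s:{0..1}|lborel. \<phi> s * s powr (real DIM(real^'d) / 2 - 1)) =
      Beta (lam + sig + 1) (mu + 1/2) * (pochhammer (lam + sig + 1) B * pochhammer (mu + 1/2) A / pochhammer (lam + sig + 1 + (mu + 1/2)) (B + A))"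
    using Beta_weight_moment(2)[OF a b, of B A] by (simp add: e)
  finally show "(LINT x:cball 0 1|lborel. radial A B x * ball_weight0 lam mu (x::real^'d)) =
     unit_ball_vol (real CARD('d)) * real CARD('d) / 2 * Beta (lam + sig + 1) (mu + 1/2) * radial_moment A B"
    unfolding nu_eq radial_moment_def by (simp add: mult_ac add.commute)
qed

definition ball_mass :: real where
  "ball_mass = unit_ball_vol (real CARD('d)) * real CARD('d) / 2 * Beta (lam + sig + 1) (mu + 1/2)"

lemma ball_mass_pos: "ball_mass > 0"
  unfolding ball_mass_def using lam mu sig_nonneg by (intro mult_pos_pos divide_pos_pos Beta_real_pos) auto

lemma W_eq: "W x = ball_weight0 lam mu x / ball_mass"
proof -
  have int: "(LINT z:cball 0 1|lborel. ball_weight0 lam mu (z::real^'d)) = ball_mass"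
    using ball_weight0_radial(2)[of 0 0] by (simp add: radial_def radial_moment_def ball_mass_def)
  have eq: "(LINT z:cball 0 1|lborel. b * ball_weight0 lam mu (z :: real ^ 'd)) = b * ball_mass" for b
    unfolding int[symmetric] by simp
  have "(THE b. (LINT z:cball 0 1|lborel. b * ball_weight0 lam mu (z :: real ^ 'd)) = 1) = 1 / ball_mass"
    unfolding eq using ball_mass_pos by (intro the_equality) (auto simp: field_simps)
  then show ?thesis by (simp add: W_def ball_weight_def)
qed

lemma W_nonneg: "W x \<ge> 0"
  unfolding W_eq ball_weight0_def using ball_mass_pos by simp

lemma W_integrable: "set_integrable lborel (cball 0 1) W"
proof -
  have "set_integrable lborel (cball 0 1) (\<lambda>x. (1 / ball_mass) * ball_weight0 lam mu (x::real^'d))"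
    by (rule set_integrable_mult_right) (use ball_weight0_radial(1)[of 0 0] in \<open>simp add: radial_def\<close>)
  moreover have "W = (\<lambda>x. (1 / ball_mass) * ball_weight0 lam mu x)" by (auto simp: W_eq)
  ultimately show ?thesis by simp
qed

lemma ball_E_integrable:
  "continuous_on (cball 0 1) f \<Longrightarrow> set_integrable lborel (cball 0 1) (\<lambda>x. f x * W x)"
  by (rule set_integrable_continuous_mult[OF W_integrable]) auto

lemma ball_E_add:
  assumes "continuous_on (cball 0 1) f" "continuous_on (cball 0 1) g"
  shows "ball_E (\<lambda>x. f x + g x) = ball_E f + ball_E g"
  unfolding ball_E_def distrib_right
  by (rule set_integral_add(2)) (intro ball_E_integrable assms)+

lemma ball_E_cmult: "ball_E (\<lambda>x. c * f x) = c * ball_E f"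
  unfolding ball_E_def mult.assoc by simp

lemma ball_E_zero: "ball_E (\<lambda>x. 0) = 0"
  unfolding ball_E_def by simp

lemma ball_E_sum:
  assumes "finite I" "\<And>i. i \<in> I \<Longrightarrow> continuous_on (cball 0 1) (f i)"
  shows "ball_E (\<lambda>x. \<Sum>i\<in>I. c i * f i x) = (\<Sum>i\<in>I. c i * ball_E (f i))"
  using assms
proof (induction I rule: finite_induct)
  case empty show ?case by (simp add: ball_E_zero)
next
  case (insert i I)
  have "ball_E (\<lambda>x. \<Sum>i\<in>insert i I. c i * f i x) = ball_E (\<lambda>x. c i * f i x + (\<Sum>i\<in>I. c i * f i x))"
    using insert.hyps by simp
  also have "\<dots> = ball_E (\<lambda>x. c i * f i x) + ball_E (\<lambda>x. \<Sum>i\<in>I. c i * f i x)"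
    by (rule ball_E_add) (use insert.prems in \<open>auto intro!: continuous_intros\<close>)
  finally show ?case using insert by (simp add: ball_E_cmult)
qed

lemma ball_E_cong: "(\<And>x. x \<in> cball 0 1 \<Longrightarrow> f x = g x) \<Longrightarrow> ball_E f = ball_E g"
  unfolding ball_E_def by (rule set_lebesgue_integral_cong) auto

lemma ball_E_nonneg: "(\<And>x. f x \<ge> 0) \<Longrightarrow> ball_E f \<ge> 0"
  unfolding ball_E_def set_lebesgue_integral_def
  by (rule integral_nonneg_AE) (use W_nonneg in \<open>auto simp: indicator_def\<close>)

lemma ball_E_radial: "ball_E (radial A B) = radial_moment A B"
proof -
  have "ball_E (radial A B) = (LINT x:cball 0 1|lborel. (1 / ball_mass) * (radial A B x * ball_weight0 lam mu x))"
    unfolding ball_E_def W_eq by (rule arg_cong[of _ _ "set_lebesgue_integral lborel (cball 0 1)"]) auto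
  also have "\<dots> = (1 / ball_mass) * (ball_mass * radial_moment A B)"
    unfolding set_integral_mult_right ball_weight0_radial(2) ball_mass_def ..
  finally show ?thesis using ball_mass_pos by simp
qed

lemma ball_E_orthogonal_transformation:
  assumes f: "orthogonal_transformation f" and g: "continuous_on (cball 0 1) g"
  shows "ball_E (\<lambda>x. g (f x)) = ball_E g"
proof -
  have "W (f x) = W x" for x
    by (simp add: W_eq ball_weight0_def orthogonal_transformation_norm[OF f])
  then have "ball_E (\<lambda>x. g (f x)) = (LINT x:cball 0 1|lborel. g (f x) * W (f x))"
    by (simp add: ball_E_def)
  also have "\<dots> = ball_E g" unfolding ball_E_def
    by (rule set_integral_orthogonal_transformation[OF f ball_E_integrable[OF g]])
  finally show ?thesis .
qed

lemma continuous_radial [continuous_intros]: "continuous_on S (radial A B)"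
  unfolding radial_def by (intro continuous_intros)

text \<open>
  By rotation invariance the coordinate chosen here is immaterial.
\<close>

definition ridge_moment :: "nat \<Rightarrow> nat \<Rightarrow> nat \<Rightarrow> real" where
  "ridge_moment A B k = ball_E (\<lambda>x. radial A B x * (x \<bullet> axis (SOME i. True) 1) ^ k)"

lemma ball_E_ridge:
  "ball_E (\<lambda>x. radial A B x * (x \<bullet> w) ^ k) = norm w ^ k * ridge_moment A B k"
proof -
  define e where "e = (axis (SOME i. True) 1 :: real ^ 'd)"
  have "norm (norm w *\<^sub>R e) = norm w" by (simp add: e_def)
  then obtain f where f: "orthogonal_transformation f" "f (norm w *\<^sub>R e) = w"
    using orthogonal_transformation_exists by metis
  have "ball_E (\<lambda>x. radial A B x * (x \<bullet> w) ^ k) = ball_E (\<lambda>x. radial A B (f x) * (f x \<bullet> w) ^ k)"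
    by (rule ball_E_orthogonal_transformation[OF f(1), symmetric]) (intro continuous_intros)
  also have "\<dots> = ball_E (\<lambda>x. norm w ^ k * (radial A B x * (x \<bullet> e) ^ k))"
  proof (rule ball_E_cong)
    fix x
    have "f x \<bullet> w = x \<bullet> (norm w *\<^sub>R e)"
      using f by (metis orthogonal_transformation_def)
    then have "f x \<bullet> w = norm w * (x \<bullet> e)" by simp
    then show "radial A B (f x) * (f x \<bullet> w) ^ k = norm w ^ k * (radial A B x * (x \<bullet> e) ^ k)"
      by (simp add: radial_def orthogonal_transformation_norm[OF f(1)] power_mult_distrib)
  qed
  finally show ?thesis by (simp add: ball_E_cmult ridge_moment_def e_def)
qed

lemma ball_E_ridge_product_odd:
  assumes "odd (n + m)"
  shows "ball_E (\<lambda>x. radial A B x * ((x \<bullet> y) ^ n * (x \<bullet> z) ^ m)) = 0"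
proof -
  have f: "orthogonal_transformation (\<lambda>x::real^'d. - x)"
    using orthogonal_transformation_neg[of "\<lambda>x::real^'d. x"] by simp
  have "ball_E (\<lambda>x. radial A B x * ((x \<bullet> y) ^ n * (x \<bullet> z) ^ m)) =
        ball_E (\<lambda>x. radial A B (- x) * ((- x \<bullet> y) ^ n * (- x \<bullet> z) ^ m))"
    by (rule ball_E_orthogonal_transformation[OF f, symmetric]) (intro continuous_intros)
  also have "\<dots> = ball_E (\<lambda>x. (-1) * (radial A B x * ((x \<bullet> y) ^ n * (x \<bullet> z) ^ m)))"
  proof (rule ball_E_cong)
    fix x
    have "(- x \<bullet> y) ^ n * (- x \<bullet> z) ^ m = ((-1) ^ n * (-1) ^ m) * ((x \<bullet> y) ^ n * (x \<bullet> z) ^ m)"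
      by (simp add: power_minus[of "x \<bullet> y"] power_minus[of "x \<bullet> z"])
    also have "(-1) ^ n * (-1) ^ m = (-1::real)" using assms by (simp flip: power_add)
    finally show "radial A B (- x) * ((- x \<bullet> y) ^ n * (- x \<bullet> z) ^ m) = (-1) * (radial A B x * ((x \<bullet> y) ^ n * (x \<bullet> z) ^ m))"
      by (simp add: radial_def)
  qed
  also have "\<dots> = - ball_E (\<lambda>x. radial A B x * ((x \<bullet> y) ^ n * (x \<bullet> z) ^ m))"
    unfolding ball_E_cmult by simp
  finally show ?thesis by simp
qed

text \<open>
  Compare the coefficients of \<open>\<tau>\<^sup>m\<close> in \<open>ball_E_ridge\<close> for the vector \<open>w = y + \<tau> z\<close>.
\<close>

lemma ball_E_ridge_product_even:
  assumes y: "norm y = 1" and z: "norm z = 1" and nm: "n + m = 2 * p"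
  shows "real ((2 * p) choose m) * ball_E (\<lambda>x. radial A B x * ((x \<bullet> y) ^ n * (x \<bullet> z) ^ m)) =
    ridge_moment A B (2 * p) * (fact p * (\<Sum>K\<le>m. (2 * (y \<bullet> z)) ^ K / fact K * half_fact n K * half_fact m K))"
proof -
  let ?a = "\<lambda>m. real ((2 * p) choose m) * ball_E (\<lambda>x. radial A B x * ((x \<bullet> y) ^ (2 * p - m) * (x \<bullet> z) ^ m))"
  let ?b = "\<lambda>m. ridge_moment A B (2 * p) * (fact p * (\<Sum>K\<le>m. (2 * (y \<bullet> z)) ^ K / fact K * half_fact (2 * p - m) K * half_fact m K))"
  have "(\<Sum>m\<le>2 * p. ?a m * \<tau> ^ m) = (\<Sum>m\<le>2 * p. ?b m * \<tau> ^ m)" for \<tau>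
  proof -
    have "(\<Sum>m\<le>2 * p. ?a m * \<tau> ^ m) =
        (\<Sum>m\<le>2 * p. (real ((2 * p) choose m) * \<tau> ^ m) * ball_E (\<lambda>x. radial A B x * ((x \<bullet> y) ^ (2 * p - m) * (x \<bullet> z) ^ m)))"
      by (simp add: mult_ac)
    also have "\<dots> = ball_E (\<lambda>x. \<Sum>m\<le>2 * p. (real ((2 * p) choose m) * \<tau> ^ m) * (radial A B x * ((x \<bullet> y) ^ (2 * p - m) * (x \<bullet> z) ^ m)))"
      by (rule ball_E_sum[symmetric]) (auto intro!: continuous_intros)
    also have "\<dots> = ball_E (\<lambda>x. radial A B x * (x \<bullet> (y + \<tau> *\<^sub>R z)) ^ (2 * p))"
    proof (rule ball_E_cong)
      fix x
      have "(x \<bullet> (y + \<tau> *\<^sub>R z)) ^ (2 * p) = (\<tau> * (x \<bullet> z) + x \<bullet> y) ^ (2 * p)"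
        by (simp add: inner_add_right add.commute)
      also have "\<dots> = (\<Sum>m\<le>2 * p. real ((2 * p) choose m) * (\<tau> * (x \<bullet> z)) ^ m * (x \<bullet> y) ^ (2 * p - m))"
        by (rule binomial_ring)
      finally show "(\<Sum>m\<le>2 * p. (real ((2 * p) choose m) * \<tau> ^ m) * (radial A B x * ((x \<bullet> y) ^ (2 * p - m) * (x \<bullet> z) ^ m))) =
          radial A B x * (x \<bullet> (y + \<tau> *\<^sub>R z)) ^ (2 * p)"
        by (simp add: sum_distrib_left power_mult_distrib mult_ac)
    qed
    also have "\<dots> = norm (y + \<tau> *\<^sub>R z) ^ (2 * p) * ridge_moment A B (2 * p)" by (rule ball_E_ridge)
    also have "norm (y + \<tau> *\<^sub>R z) ^ (2 * p) = (1 + 2 * (y \<bullet> z) * \<tau> + \<tau>\<^sup>2) ^ p"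
    proof -
      have "(norm (y + \<tau> *\<^sub>R z))\<^sup>2 = (norm y)\<^sup>2 + 2 * (y \<bullet> z) * \<tau> + \<tau>\<^sup>2 * (norm z)\<^sup>2"
        unfolding power2_norm_eq_inner
        by (simp add: inner_add_left inner_add_right inner_commute[of z y] power2_eq_square algebra_simps
              del: dot_square_norm)
      then show ?thesis using y z by (simp add: power_mult)
    qed
    also have "\<dots> * ridge_moment A B (2 * p) = (\<Sum>m\<le>2 * p. ?b m * \<tau> ^ m)"
      unfolding trinomial_expansion by (simp add: sum_distrib_left sum_distrib_right mult_ac)
    finally show ?thesis .
  qed
  then have "\<forall>m\<le>2 * p. ?a m = ?b m"
    by (rule polyfun_eq_coeffs[THEN iffD1, OF allI])
  moreover have mp: "m \<le> 2 * p" "2 * p - m = n" using nm by auto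
  ultimately have "?a m = ?b m" by blast
  then show ?thesis by (simp only: mp(2))
qed

text \<open>
  For \<open>i \<noteq> a\<close> the preceding lemma expresses the moment of \<open>x\<^sub>a\<^bsup>2p\<^esup> * x\<^sub>i\<^sup>2\<close> by that of \<open>x\<^sub>a\<^bsup>2p+2\<^esup>\<close>.  Summing over
  \<open>i\<close> produces a factor \<open>\<parallel>x\<parallel>\<^sup>2\<close>, which yields a recursion in \<open>p\<close> that ends at a radial moment.
\<close>

lemma ridge_moment_even:
  "ridge_moment A B (2 * p) = pochhammer (1/2) p / pochhammer (sig + 1) p * radial_moment A (B + p)"
proof (induction p arbitrary: B)
  case 0
  have "radial A B = (\<lambda>x. radial A B x * (x \<bullet> axis (SOME i. True) 1) ^ 0)" by simp
  then show ?case using ball_E_radial[of A B] by (simp add: ridge_moment_def)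
next
  case (Suc p)
  define a where "a = (SOME i::'d. True)"
  have ax: "ball_E (\<lambda>x. radial A B x * ((x \<bullet> axis a 1) ^ (2 * p) * (x \<bullet> axis i 1)\<^sup>2)) =
      ridge_moment A B (2 * Suc p) * (if i = a then 1 else 1 / (2 * real p + 1))" for i
  proof (cases "i = a")
    case True
    then show ?thesis by (simp add: ridge_moment_def a_def power2_eq_square mult_ac)
  next
    case False
    have nm: "2 * p + 2 = 2 * Suc p" by simp
    have orth: "axis a (1::real) \<bullet> axis i 1 = 0" using False by (simp add: inner_axis_axis)
    have "2 * p = 0 + 2 * p" by simp
    have h: "half_fact (2 * p) 0 = 1 / fact p" "half_fact 2 0 = 1"
      by (simp_all add: half_fact_def)
    have S: "(\<Sum>K\<le>2. (2 * (axis a (1::real) \<bullet> axis i 1)) ^ K / fact K * half_fact (2 * p) K * half_fact 2 K) = 1 / fact p"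
    proof -
      have "(\<Sum>K\<le>2. f K) = f 0 + f 1 + f 2" for f :: "nat \<Rightarrow> real" by (simp add: numeral_2_eq_2)
      then show ?thesis unfolding orth using h by simp
    qed
    have c: "real ((2 * Suc p) choose 2) = real (Suc p) * (2 * real p + 1)"
      by (simp add: choose_two field_simps)
    have "real (Suc p) * (2 * real p + 1) * ball_E (\<lambda>x. radial A B x * ((x \<bullet> axis a 1) ^ (2 * p) * (x \<bullet> axis i 1)\<^sup>2)) =
       ridge_moment A B (2 * Suc p) * real (Suc p)"
      using ball_E_ridge_product_even[of "axis a 1" "axis i 1" "2 * p" 2 "Suc p" A B, OF _ _ nm]
      unfolding S c by simp
    then have "(2 * real p + 1) * ball_E (\<lambda>x. radial A B x * ((x \<bullet> axis a 1) ^ (2 * p) * (x \<bullet> axis i 1)\<^sup>2)) =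
       ridge_moment A B (2 * Suc p)" by (simp only: mult.assoc mult.commute[of _ "real (Suc p)"]) simp
    then show ?thesis using False by (simp add: field_simps)
  qed
  have "ridge_moment A (Suc B) (2 * p) = ball_E (\<lambda>x. \<Sum>i\<in>UNIV. 1 * (radial A B x * ((x \<bullet> axis a 1) ^ (2 * p) * (x \<bullet> axis i 1)\<^sup>2)))"
    unfolding ridge_moment_def a_def[symmetric]
  proof (rule ball_E_cong)
    fix x :: "real ^ 'd"
    have "(norm x)\<^sup>2 = (\<Sum>i\<in>UNIV. (x \<bullet> axis i 1)\<^sup>2)"
      by (simp add: norm_vec_def L2_set_def sum_nonneg inner_axis)
    then have "radial A (Suc B) x = radial A B x * (\<Sum>i\<in>UNIV. (x \<bullet> axis i 1)\<^sup>2)" by (simp add: radial_def)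
    then show "radial A (Suc B) x * (x \<bullet> axis a 1) ^ (2 * p) =
        (\<Sum>i\<in>UNIV. 1 * (radial A B x * ((x \<bullet> axis a 1) ^ (2 * p) * (x \<bullet> axis i 1)\<^sup>2)))"
      by (simp add: sum_distrib_left mult_ac)
  qed
  also have "\<dots> = (\<Sum>i\<in>UNIV. 1 * ball_E (\<lambda>x. radial A B x * ((x \<bullet> axis a 1) ^ (2 * p) * (x \<bullet> axis i 1)\<^sup>2)))"
    by (rule ball_E_sum) (auto intro!: continuous_intros)
  also have "\<dots> = (\<Sum>i\<in>UNIV. ridge_moment A B (2 * Suc p) * (if i = a then 1 else 1 / (2 * real p + 1)))"
    unfolding ax by simp
  also have "\<dots> = ridge_moment A B (2 * Suc p) * (1 + (real CARD('d) - 1) / (2 * real p + 1))"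
    unfolding sum_distrib_left[symmetric]
    by (subst sum.remove[of _ a]) (auto simp: card_Diff_singleton of_nat_diff)
  finally have "ridge_moment A (Suc B) (2 * p) = ridge_moment A B (2 * Suc p) * ((2 * real p + real CARD('d)) / (2 * real p + 1))"
  proof -
    assume "ridge_moment A (Suc B) (2 * p) = ridge_moment A B (2 * Suc p) * (1 + (real CARD('d) - 1) / (2 * real p + 1))"
    moreover have "1 + (real CARD('d) - 1) / (2 * real p + 1) = (2 * real p + real CARD('d)) / (2 * real p + 1)"
      by (simp add: field_simps)
    ultimately show ?thesis by simp
  qed
  moreover have "2 * real p + real CARD('d) = 2 * (sig + 1 + real p)" "2 * real p + 1 = 2 * (1/2 + real p)" "sig + 1 + real p > 0"
    using dim_half sig_nonneg by auto
  ultimately have "ridge_moment A B (2 * Suc p) = (1/2 + real p) / (sig + 1 + real p) * ridge_moment A (Suc B) (2 * p)"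
    by (simp add: field_simps)
  then show ?case unfolding Suc.IH by (simp add: pochhammer_Suc mult_ac)
qed

text \<open>
  The pairing formula for ridge functions: apart from a radial factor it is the convolution of index
  \<open>\<sigma>\<close>, the index of zonal functions on the unit sphere of \<open>\<real>\<^sup>d\<close>.
\<close>

lemma ball_E_ridge_product:
  assumes y: "norm y = 1" and z: "norm z = 1"
  shows "ball_E (\<lambda>x. radial A B x * ((x \<bullet> y) ^ n / fact n * ((x \<bullet> z) ^ m / fact m))) =
    radial_moment A (B + (n + m) div 2) * (\<Sum>K\<le>n. conv_coeff sig n m K * ((y \<bullet> z) ^ K / fact K))"
proof -
  have l: "ball_E (\<lambda>x. radial A B x * ((x \<bullet> y) ^ n / fact n * ((x \<bullet> z) ^ m / fact m))) =
     1 / (fact n * fact m) * ball_E (\<lambda>x. radial A B x * ((x \<bullet> y) ^ n * (x \<bullet> z) ^ m))"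
    unfolding ball_E_cmult[symmetric] by (rule ball_E_cong) simp
  show ?thesis
  proof (cases "odd (n + m)")
    case True
    have "conv_coeff sig n m K = 0" for K
      using True by (cases n K rule: half_fact_cases; cases m K rule: half_fact_cases) (auto simp: conv_coeff_def)
    then show ?thesis unfolding l ball_E_ridge_product_odd[OF True] by simp
  next
    case False
    then have "even (n + m)" by blast
    then obtain p where p: "n + m = 2 * p" by (rule evenE)
    define S where "S = (\<Sum>K\<le>m. (2 * (y \<bullet> z)) ^ K / fact K * half_fact n K * half_fact m K)"
    have S: "S = (\<Sum>K\<le>n. (2 * (y \<bullet> z)) ^ K / fact K * half_fact n K * half_fact m K)"
      unfolding S_def
      by (rule trans[OF sum_atMost_extend[where m = "n + m"] sum_atMost_extend[symmetric]]) auto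
    have mp: "m \<le> 2 * p" "2 * p - m = n" using p by auto
    have b: "real ((2 * p) choose m) = fact (2 * p) / (fact m * fact n)"
      using binomial_fact[OF mp(1)] mp(2) by simp
    have "1 / (fact n * fact m) * ball_E (\<lambda>x. radial A B x * ((x \<bullet> y) ^ n * (x \<bullet> z) ^ m))
        = ridge_moment A B (2 * p) * (fact p * S) / fact (2 * p)"
      using ball_E_ridge_product_even[OF y z p, of A B] unfolding b S_def[symmetric]
      by (simp add: field_simps)
    also have "\<dots> = radial_moment A (B + p) * (S / (2 ^ (2 * p) * pochhammer (sig + 1) p))"
      unfolding ridge_moment_even fact_double[of p, where 'a = real]
      using pochhammer_ne_0[of "1/2" p] by (simp add: field_simps)
    also have "S / (2 ^ (2 * p) * pochhammer (sig + 1) p) = (\<Sum>K\<le>n. conv_coeff sig n m K * ((y \<bullet> z) ^ K / fact K))"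
      unfolding S conv_coeff_def p sum_divide_distrib
      by (intro sum.cong refl) (simp add: power_mult_distrib mult_ac)
    finally show ?thesis unfolding l p by simp
  qed
qed

end

section \<open>From the index of the sphere to the index of the weight\<close>

lemma mix_transform:
  assumes "lam \<ge> 0" "sig \<ge> 0"
  shows "(\<Sum>k\<le>n. expand_coeff (lam + sig) n k * (\<Sum>i\<le>k. zonal_coeff sig k i * g i)) =
         (\<Sum>i\<le>n. mix_coeff lam sig n i * g i)"
proof -
  have "(\<Sum>k\<le>n. expand_coeff (lam + sig) n k * (\<Sum>i\<le>k. zonal_coeff sig k i * g i)) =
        (\<Sum>k\<le>n. expand_coeff (lam + sig) n k * (\<Sum>i\<le>n. zonal_coeff sig k i * g i))"
    by (intro sum.cong refl arg_cong2[of _ _ _ _ "(*)"] sum_atMost_extend) (auto simp: zonal_coeff_eq_0)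
  also have "\<dots> = (\<Sum>i\<le>n. (\<Sum>k\<le>n. expand_coeff (lam + sig) n k * zonal_coeff sig k i) * g i)"
    unfolding sum_distrib_left sum_distrib_right by (subst sum.swap) (simp add: mult_ac)
  also have "\<dots> = (\<Sum>i\<le>n. mix_coeff lam sig n i * g i)"
    unfolding expand_zonal_coeff[OF assms] ..
  finally show ?thesis .
qed

lemma mix_coeff_zero:
  assumes "\<nu> \<ge> 0"
  shows "mix_coeff 0 \<nu> n c = (if n = c then 1 else 0)"
  using zonal_coeff_inverse[OF assms, of n c] expand_zonal_coeff[of 0 \<nu> n c] assms by simp

lemma zonal_transform_inverse:
  assumes "\<nu> \<ge> 0"
  shows "(\<Sum>k\<le>n. expand_coeff \<nu> n k * (\<Sum>i\<le>k. zonal_coeff \<nu> k i * g i)) = g n"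
proof -
  have "(\<Sum>k\<le>n. expand_coeff \<nu> n k * (\<Sum>i\<le>k. zonal_coeff \<nu> k i * g i)) = (\<Sum>i\<le>n. mix_coeff 0 \<nu> n i * g i)"
    using mix_transform[of 0 \<nu> n g] assms by simp
  also have "\<dots> = (\<Sum>i\<le>n. if n = i then g i else 0)"
    by (intro sum.cong refl) (auto simp: mix_coeff_zero[OF assms])
  finally show ?thesis by simp
qed

lemma double_transform:
  fixes \<beta> :: "nat \<Rightarrow> nat \<Rightarrow> real"
  assumes "\<And>n g. (\<Sum>k\<le>n. e n k * (\<Sum>i\<le>k. z k i * g i)) = (\<Sum>i\<le>n. w n i * (g i :: real))"
  shows "(\<Sum>k\<le>n. \<Sum>l\<le>m. e n k * e m l * (\<Sum>i\<le>k. \<Sum>j\<le>l. z k i * z l j * \<beta> i j)) =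
         (\<Sum>i\<le>n. \<Sum>j\<le>m. w n i * w m j * \<beta> i j)"
proof -
  have "(\<Sum>k\<le>n. \<Sum>l\<le>m. e n k * e m l * (\<Sum>i\<le>k. \<Sum>j\<le>l. z k i * z l j * \<beta> i j)) =
        (\<Sum>k\<le>n. e n k * (\<Sum>l\<le>m. e m l * (\<Sum>j\<le>l. z l j * (\<Sum>i\<le>k. z k i * \<beta> i j))))"
  proof -
    have "(\<Sum>i\<le>k. \<Sum>j\<le>l. z k i * z l j * \<beta> i j) = (\<Sum>j\<le>l. z l j * (\<Sum>i\<le>k. z k i * \<beta> i j))" for k l
      by (subst sum.swap) (simp add: sum_distrib_left mult_ac)
    then show ?thesis by (simp only: sum_distrib_left[of "e n _"] mult.assoc)
  qed
  also have "\<dots> = (\<Sum>k\<le>n. e n k * (\<Sum>j\<le>m. w m j * (\<Sum>i\<le>k. z k i * \<beta> i j)))"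
    unfolding assms ..
  also have "\<dots> = (\<Sum>j\<le>m. w m j * (\<Sum>k\<le>n. e n k * (\<Sum>i\<le>k. z k i * \<beta> i j)))"
    unfolding sum_distrib_left by (subst sum.swap) (simp add: mult_ac)
  also have "\<dots> = (\<Sum>j\<le>m. w m j * (\<Sum>i\<le>n. w n i * \<beta> i j))"
    unfolding assms ..
  also have "\<dots> = (\<Sum>i\<le>n. \<Sum>j\<le>m. w n i * w m j * \<beta> i j)"
    unfolding sum_distrib_left by (subst sum.swap) (simp add: mult_ac)
  finally show ?thesis .
qed

text \<open>
  Convolution of index \<open>\<nu>\<close> is diagonal in the \<open>Z\<^sub>k\<close>: if \<open>\<beta> i j\<close> is the value of the convolution of
  \<open>t\<^sup>i / i!\<close> and \<open>t\<^sup>j / j!\<close> under the linear map that takes \<open>t\<^sup>K / K!\<close> to \<open>g K\<close>, then the left-hand side is the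
  value of the convolution of \<open>Z\<^sub>k\<close> and \<open>Z\<^sub>l\<close>.
\<close>

lemma zonal_convolution:
  assumes nu: "\<nu> \<ge> 0" and \<beta>: "\<And>n m. \<beta> n m = (\<Sum>K\<le>n. conv_coeff \<nu> n m K * g K)"
  shows "(\<Sum>i\<le>k. \<Sum>j\<le>l. zonal_coeff \<nu> k i * zonal_coeff \<nu> l j * \<beta> i j) =
         (if k = l then \<Sum>i\<le>k. zonal_coeff \<nu> k i * g i else 0)"
proof (rule convolution_diagonal[OF nu, where b = \<beta>])
  fix n m
  have "(\<Sum>k\<le>n. \<Sum>l\<le>m. expand_coeff \<nu> n k * expand_coeff \<nu> m l *
          (\<Sum>i\<le>k. \<Sum>j\<le>l. zonal_coeff \<nu> k i * zonal_coeff \<nu> l j * \<beta> i j)) =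
        (\<Sum>i\<le>n. \<Sum>j\<le>m. mix_coeff 0 \<nu> n i * mix_coeff 0 \<nu> m j * \<beta> i j)"
    by (rule double_transform) (use mix_transform[of 0 \<nu>] nu in simp)
  also have "\<dots> = (\<Sum>i\<le>n. if n = i then \<Sum>j\<le>m. if m = j then \<beta> i j else 0 else 0)"
  proof -
    have "(if P then 1 else 0) * (if Q then 1 else 0) * x = (if P then if Q then x else 0 else 0)" for P Q and x :: real
      by simp
    then show ?thesis unfolding mix_coeff_zero[OF nu] by (intro sum.cong refl) simp
  qed
  also have "\<dots> = \<beta> n m" by simp
  finally show "\<beta> n m = (\<Sum>k\<le>n. \<Sum>l\<le>m. expand_coeff \<nu> n k * expand_coeff \<nu> m l *
          (\<Sum>i\<le>k. \<Sum>j\<le>l. zonal_coeff \<nu> k i * zonal_coeff \<nu> l j * \<beta> i j))" ..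
  show "\<beta> n m = (\<Sum>K\<le>n. conv_coeff \<nu> n m K * (\<Sum>k\<le>K. expand_coeff \<nu> K k * (\<Sum>i\<le>k. zonal_coeff \<nu> k i * g i)))"
    unfolding zonal_transform_inverse[OF nu] by (rule \<beta>)
qed

text \<open>
  Mixing maps \<open>Z\<^sub>k\<close> of index \<open>\<lambda> + \<sigma>\<close> to \<open>Z\<^sub>k\<close> of index \<open>\<sigma>\<close>, and each family is diagonal for the convolution
  of its own index; hence mixing carries one convolution to the other.
\<close>

lemma mix_convolution:
  assumes lam: "lam \<ge> 0" and sig: "sig \<ge> 0"
    and \<beta>: "\<And>n m. \<beta> n m = (\<Sum>K\<le>n. conv_coeff sig n m K * g K)"
  shows "(\<Sum>i\<le>p. \<Sum>j\<le>q. mix_coeff lam sig p i * mix_coeff lam sig q j * \<beta> i j) =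
         (\<Sum>K\<le>p. conv_coeff (lam + sig) p q K * (\<Sum>i\<le>K. mix_coeff lam sig K i * g i))"
proof -
  define f where "f k = (\<Sum>i\<le>k. zonal_coeff sig k i * g i)" for k
  have "(\<Sum>i\<le>p. \<Sum>j\<le>q. mix_coeff lam sig p i * mix_coeff lam sig q j * \<beta> i j) =
    (\<Sum>k\<le>p. \<Sum>l\<le>q. expand_coeff (lam + sig) p k * expand_coeff (lam + sig) q l *
       (\<Sum>i\<le>k. \<Sum>j\<le>l. zonal_coeff sig k i * zonal_coeff sig l j * \<beta> i j))"
    by (rule double_transform[symmetric]) (rule mix_transform[OF lam sig])
  also have "\<dots> = (\<Sum>k\<le>p. \<Sum>l\<le>q. if k = l then expand_coeff (lam + sig) p k * expand_coeff (lam + sig) q k * f k else 0)"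
    unfolding zonal_convolution[OF sig \<beta>] f_def by (intro sum.cong refl) auto
  also have "\<dots> = (\<Sum>k\<le>p. expand_coeff (lam + sig) p k * expand_coeff (lam + sig) q k * f k)"
    by (intro sum.cong refl) (auto simp: expand_coeff_eq_0)
  also have "\<dots> = (\<Sum>k\<le>p. (\<Sum>K\<le>p. conv_coeff (lam + sig) p q K * expand_coeff (lam + sig) K k) * f k)"
    using expand_coeff_mult[of "lam + sig"] lam sig by simp
  also have "\<dots> = (\<Sum>K\<le>p. conv_coeff (lam + sig) p q K * (\<Sum>k\<le>p. expand_coeff (lam + sig) K k * f k))"
    unfolding sum_distrib_left sum_distrib_right by (subst sum.swap) (simp add: mult_ac)
  also have "\<dots> = (\<Sum>K\<le>p. conv_coeff (lam + sig) p q K * (\<Sum>k\<le>K. expand_coeff (lam + sig) K k * f k))"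
    by (intro sum.cong refl arg_cong2[of _ _ _ _ "(*)"] sum_atMost_extend[symmetric]) (auto simp: expand_coeff_eq_0)
  also have "\<dots> = (\<Sum>K\<le>p. conv_coeff (lam + sig) p q K * (\<Sum>i\<le>K. mix_coeff lam sig K i * g i))"
    unfolding f_def mix_transform[OF lam sig] ..
  finally show ?thesis .
qed

text \<open>
  The averages of \<open>(A * u * v + B * (1 - u))\<^sup>n / n!\<close> over \<open>u\<close> and \<open>v\<close> and of
  \<open>(A * u * v + B * (1 - u) + C * t)\<^sup>n / n!\<close> over \<open>u\<close>, \<open>v\<close> and \<open>t\<close>.  They are even in \<open>A\<close> and in \<open>C\<close>, and are
  written in terms of \<open>A2 = A\<^sup>2\<close> and \<open>C2 = C\<^sup>2\<close>, so that with \<open>A = \<parallel>x\<parallel> * \<parallel>y\<parallel>\<close> and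
  \<open>C = sqrt (1 - \<parallel>x\<parallel>\<^sup>2) * sqrt (1 - \<parallel>y\<parallel>\<^sup>2)\<close> they are polynomials on the whole space.  The moments of the last
  variable, divided by factorials, are \<open>last_coeff\<close>; for \<open>\<mu> = 0\<close> this is \<open>1 / k!\<close> for even \<open>k\<close>, as it should
  be for the two point masses at \<open>\<plusminus>1\<close>.
\<close>

definition mixed_power :: "real \<Rightarrow> real \<Rightarrow> nat \<Rightarrow> real \<Rightarrow> real \<Rightarrow> real" where
  "mixed_power lam sig n A2 B = (\<Sum>c\<le>n. mix_coeff lam sig n c * (A2 ^ ((n - c) div 2) * (B ^ c / fact c)))"

definition last_coeff :: "real \<Rightarrow> nat \<Rightarrow> real" where
  "last_coeff mu k = (if even k then 1 / (2 ^ k * fact (k div 2) * pochhammer (mu + 1/2) (k div 2)) else 0)"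

definition zeta_power :: "real \<Rightarrow> real \<Rightarrow> real \<Rightarrow> nat \<Rightarrow> real \<Rightarrow> real \<Rightarrow> real \<Rightarrow> real" where
  "zeta_power lam mu sig n A2 B C2 =
     (\<Sum>k\<le>n. last_coeff mu k * (C2 ^ (k div 2) * mixed_power lam sig (n - k) A2 B))"

lemma mixed_power_scale: "mixed_power lam sig p (r\<^sup>2 * A2) (r * B) = r ^ p * mixed_power lam sig p A2 B"
  unfolding mixed_power_def sum_distrib_left
proof (rule sum.cong[OF refl])
  fix c
  show "mix_coeff lam sig p c * ((r\<^sup>2 * A2) ^ ((p - c) div 2) * ((r * B) ^ c / fact c)) =
     r ^ p * (mix_coeff lam sig p c * (A2 ^ ((p - c) div 2) * (B ^ c / fact c)))"
  proof (cases p c rule: half_fact_cases)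
    case 1 then show ?thesis by (simp add: mix_coeff_def)
  next
    case (2 i)
    then have "r ^ p = (r\<^sup>2) ^ i * r ^ c" by (simp add: power_add power_mult)
    moreover have "(p - c) div 2 = i" using 2 by simp
    ultimately show ?thesis by (simp add: power_mult_distrib mult_ac)
  qed
qed

text \<open>
  The counterpart of the pairing formula for the last variable alone.
\<close>

lemma last_coeff_mult:
  assumes "mu \<ge> 0"
  shows "last_coeff mu k * last_coeff mu l * pochhammer (mu + 1/2) (k div 2 + l div 2) * 2 ^ (k + l) =
    (\<Sum>j\<le>k. 2 ^ j * half_fact k j * half_fact l j * last_coeff mu j)"
proof -
  have zero: "2 ^ j * half_fact k j * half_fact l j * last_coeff mu j = 0" if "odd k \<or> odd l" for j
    using that by (auto simp: half_fact_def last_coeff_def)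
  show ?thesis
  proof (cases "odd k \<or> odd l")
    case True
    then show ?thesis unfolding sum.neutral[OF ballI, OF zero[OF True]] by (auto simp: last_coeff_def)
  next
    case False
    then have "even k" "even l" by auto
    then obtain a b where kl: "k = 2 * a" "l = 2 * b" by (auto elim!: evenE)
    let ?m = "mu + 1/2"
    have m: "?m > 0" using assms by simp
    note hf = half_fact_shift[of 0, unfolded add_0]
    have "(\<Sum>j\<le>0 + 2 * a. 2 ^ j * half_fact k j * half_fact l j * last_coeff mu j) =
       (\<Sum>i\<le>a. 2 ^ (0 + 2 * i) * half_fact k (0 + 2 * i) * half_fact l (0 + 2 * i) * last_coeff mu (0 + 2 * i))"
    proof (rule sum_same_parity)
      fix K :: nat assume "\<And>l. K \<noteq> 0 + 2 * l"
      then have "odd K" by (auto elim: evenE)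
      then show "2 ^ K * half_fact k K * half_fact l K * last_coeff mu K = 0" by (simp add: last_coeff_def)
    qed
    also have "\<dots> = (\<Sum>i\<le>a. if i \<le> b then 1 / (fact (a - i) * fact (b - i) * fact i * pochhammer ?m i) else 0)"
      unfolding kl add_0 hf last_coeff_def by (intro sum.cong refl) (auto simp: mult_ac)
    also have "\<dots> = pochhammer ?m (a + b) / (fact a * fact b * pochhammer ?m a * pochhammer ?m b)"
      by (rule pochhammer_ratio_sum[OF m])
    also have "\<dots> = last_coeff mu k * last_coeff mu l * pochhammer ?m (k div 2 + l div 2) * 2 ^ (k + l)"
      by (simp add: kl last_coeff_def power_add mult_ac)
    finally show ?thesis by (simp add: kl)
  qed
qed

text \<open>
  Up to the factor \<open>(1 - t\<^sup>2)\<^bsup>j/2\<^esup> * t\<^sup>K\<close>, and with \<open>n = j + K + 2 * i\<close>, this is the binomial expansion of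
  \<open>((1 - t\<^sup>2) + t\<^sup>2)\<^sup>i / i!\<close>.
\<close>

lemma half_fact_convolution:
  fixes t :: real
  assumes j: "even j"
  shows "(\<Sum>k\<le>n. half_fact k j * half_fact (n - k) K * ((1 - t\<^sup>2) ^ (k div 2) * t ^ (n - k))) =
    half_fact n (j + K) * ((1 - t\<^sup>2) ^ (j div 2) * t ^ K)"
proof (cases n "j + K" rule: half_fact_cases)
  case 1
  have "half_fact k j * half_fact (n - k) K = 0" if "k \<le> n" for k
  proof (cases k j rule: half_fact_cases)
    case k: (2 i)
    show ?thesis
    proof (cases "n - k" K rule: half_fact_cases)
      case (2 i')
      then have "n = j + K + 2 * (i + i')" using k that by simp
      with 1 show ?thesis by blast
    qed simp
  qed simp
  then have "(\<Sum>k\<le>n. half_fact k j * half_fact (n - k) K * ((1 - t\<^sup>2) ^ (k div 2) * t ^ (n - k))) = 0"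
    by (intro sum.neutral) simp
  with 1 show ?thesis by simp
next
  case (2 i)
  let ?f = "\<lambda>k. half_fact k j * half_fact (n - k) K * ((1 - t\<^sup>2) ^ (k div 2) * t ^ (n - k))"
  have "(\<Sum>k\<le>n. ?f k) = sum ?f ((\<lambda>a. j + 2 * a) ` {..i})"
  proof (rule sum.mono_neutral_right)
    show "\<forall>k\<in>{..n} - (\<lambda>a. j + 2 * a) ` {..i}. ?f k = 0"
    proof
      fix k assume k: "k \<in> {..n} - (\<lambda>a. j + 2 * a) ` {..i}"
      show "?f k = 0"
      proof (cases k j rule: half_fact_cases)
        case k': (2 a)
        then have "a > i" using k by (auto simp: image_iff)
        then have "n - k < K" using k' 2 k by auto
        then show ?thesis by simp
      qed simp
    qed
  qed (use 2 in auto)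
  also have "\<dots> = (\<Sum>a\<le>i. ?f (j + 2 * a))" by (subst sum.reindex) (auto simp: inj_on_def)
  also have "\<dots> = (\<Sum>a\<le>i. (1 - t\<^sup>2) ^ (j div 2) * t ^ K / fact i * (real (i choose a) * (1 - t\<^sup>2) ^ a * (t\<^sup>2) ^ (i - a)))"
  proof (rule sum.cong[OF refl])
    fix a assume "a \<in> {..i}"
    then have a: "a \<le> i" by simp
    then have e: "n - (j + 2 * a) = K + 2 * (i - a)" "(j + 2 * a) div 2 = j div 2 + a" using 2 j by auto
    show "?f (j + 2 * a) = (1 - t\<^sup>2) ^ (j div 2) * t ^ K / fact i * (real (i choose a) * (1 - t\<^sup>2) ^ a * (t\<^sup>2) ^ (i - a))"
      unfolding e half_fact_simps binomial_fact[OF a] power_add power_mult by simp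
  qed
  also have "\<dots> = (1 - t\<^sup>2) ^ (j div 2) * t ^ K / fact i * ((1 - t\<^sup>2) + t\<^sup>2) ^ i"
    unfolding binomial_ring sum_distrib_left ..
  finally show ?thesis using 2 by simp
qed

lemma sum_swap3:
  "(\<Sum>l\<in>B. \<Sum>j\<in>C. \<Sum>k\<in>D. f l j k) = (\<Sum>j\<in>C. \<Sum>k\<in>D. \<Sum>l\<in>B. f l j k)"
  by (subst sum.swap, intro sum.cong refl, rule sum.swap)

text \<open>
  The sums over \<open>k\<close> and \<open>l\<close> separate once the moments of \<open>t\<close> have been expanded by \<open>last_coeff_mult\<close>; this
  is the step in which the contributions \<open>\<mu> + 1/2\<close> and \<open>\<lambda> + \<sigma> + 1\<close> of the two groups of variables combine.
  The indices \<open>j\<close> and \<open>K\<close> count the powers that belong to the last variable and to the others.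
\<close>

lemma zeta_power_convolution:
  fixes Y Z :: real
  assumes mu: "mu \<ge> 0"
  shows "(\<Sum>k\<le>n. \<Sum>l\<le>m. last_coeff mu k * last_coeff mu l * pochhammer (mu + 1/2) (k div 2 + l div 2) * 2 ^ (k + l) *
      ((1 - Y\<^sup>2) ^ (k div 2) * Y ^ (n - k)) * ((1 - Z\<^sup>2) ^ (l div 2) * Z ^ (m - l)) *
      (\<Sum>K\<le>n - k. 2 ^ K * half_fact (n - k) K * half_fact (m - l) K * V K)) =
    (\<Sum>M\<le>n. half_fact n M * half_fact m M * 2 ^ M *
      (\<Sum>j\<le>M. last_coeff mu j * (((1 - Y\<^sup>2) * (1 - Z\<^sup>2)) ^ (j div 2) * ((Y * Z) ^ (M - j) * V (M - j)))))"
    (is "(\<Sum>k\<le>n. \<Sum>l\<le>m. ?f k l) = ?R")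
proof -
  define a where "a k = (1 - Y\<^sup>2) ^ (k div 2) * Y ^ (n - k)" for k
  define b where "b l = (1 - Z\<^sup>2) ^ (l div 2) * Z ^ (m - l)" for l
  define g where "g j K = half_fact n (j + K) * half_fact m (j + K) * 2 ^ (j + K) *
     (last_coeff mu j * (((1 - Y\<^sup>2) * (1 - Z\<^sup>2)) ^ (j div 2) * ((Y * Z) ^ K * V K)))" for j K
  let ?A = "\<lambda>k l. \<Sum>j\<le>n. 2 ^ j * half_fact k j * half_fact l j * last_coeff mu j"
  let ?B = "\<lambda>k l. \<Sum>K\<le>n. 2 ^ K * half_fact (n - k) K * half_fact (m - l) K * V K"
  let ?c = "\<lambda>j K. 2 ^ (j + K) * last_coeff mu j * V K"
  let ?d = "\<lambda>k l j K. ?c j K * (half_fact k j * half_fact (n - k) K * a k) * (half_fact l j * half_fact (m - l) K * b l)"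
  have "(\<Sum>k\<le>n. \<Sum>l\<le>m. ?f k l) = (\<Sum>k\<le>n. \<Sum>l\<le>m. ?A k l * a k * b l * ?B k l)"
  proof (intro sum.cong refl)
    fix k l assume "k \<in> {..n}" "l \<in> {..m}"
    then have k: "k \<le> n" by simp
    have 1: "(\<Sum>j\<le>k. 2 ^ j * half_fact k j * half_fact l j * last_coeff mu j) = ?A k l"
      by (rule sum_atMost_extend) (use k in auto)
    have 2: "(\<Sum>K\<le>n - k. 2 ^ K * half_fact (n - k) K * half_fact (m - l) K * V K) = ?B k l"
      by (rule sum_atMost_extend) auto
    show "?f k l = ?A k l * a k * b l * ?B k l"
      unfolding last_coeff_mult[OF mu] 1 2 a_def b_def ..
  qed
  also have "\<dots> = (\<Sum>k\<le>n. \<Sum>l\<le>m. \<Sum>j\<le>n. \<Sum>K\<le>n. ?d k l j K)"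
  proof (intro sum.cong refl)
    fix k l
    have "(\<Sum>j\<le>n. F j) * u * v * (\<Sum>K\<le>n. G K) = (\<Sum>j\<le>n. \<Sum>K\<le>n. F j * G K * (u * v))"
      for F G :: "nat \<Rightarrow> real" and u v
      unfolding sum_distrib_right[symmetric] sum_product[symmetric] by simp
    then show "?A k l * a k * b l * ?B k l = (\<Sum>j\<le>n. \<Sum>K\<le>n. ?d k l j K)"
      by (simp only:) (simp add: power_add mult_ac)
  qed
  also have "\<dots> = (\<Sum>j\<le>n. \<Sum>K\<le>n. \<Sum>k\<le>n. \<Sum>l\<le>m. ?d k l j K)"
    unfolding sum_swap3[where B = "{..m}"] by (rule sum_swap3)
  also have "\<dots> = (\<Sum>j\<le>n. \<Sum>K\<le>n. ?c j K *
       (\<Sum>k\<le>n. half_fact k j * half_fact (n - k) K * a k) * (\<Sum>l\<le>m. half_fact l j * half_fact (m - l) K * b l))"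
    unfolding sum_distrib_left sum_distrib_right
    by (rule sum.cong[OF refl], rule sum.cong[OF refl], rule sum.swap)
  also have "\<dots> = (\<Sum>j\<le>n. \<Sum>K\<le>n. g j K)"
  proof (intro sum.cong refl)
    fix j K
    show "?c j K *
       (\<Sum>k\<le>n. half_fact k j * half_fact (n - k) K * a k) * (\<Sum>l\<le>m. half_fact l j * half_fact (m - l) K * b l) = g j K"
    proof (cases "even j")
      case True
      show ?thesis unfolding a_def b_def half_fact_convolution[OF True] g_def by (simp add: power_mult_distrib mult_ac)
    next
      case False
      then show ?thesis by (simp add: g_def last_coeff_def)
    qed
  qed
  also have "\<dots> = sum (\<lambda>(j, K). g j K) ({..n} \<times> {..n})" by (simp add: sum.cartesian_product)
  also have "\<dots> = sum (\<lambda>(j, K). g j K) {(j, K). j + K \<le> n}"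
    by (rule sum.mono_neutral_right) (auto simp: g_def half_fact_def[of n] split: if_splits)
  also have "\<dots> = (\<Sum>M\<le>n. \<Sum>j\<le>M. g j (M - j))" by (rule sum.triangle_reindex_eq)
  also have "\<dots> = ?R" unfolding g_def sum_distrib_left by (intro sum.cong refl) simp
  finally show ?thesis .
qed

context radial_ball_weight
begin

lemma ball_E_bilinear:
  assumes "finite I" "finite J" "\<And>i. i \<in> I \<Longrightarrow> continuous_on (cball 0 1) (f i)" "\<And>j. j \<in> J \<Longrightarrow> continuous_on (cball 0 1) (g j)"
    "continuous_on (cball 0 1) h"
  shows "ball_E (\<lambda>x. h x * ((\<Sum>i\<in>I. a i * f i x) * (\<Sum>j\<in>J. b j * g j x))) =
     (\<Sum>i\<in>I. \<Sum>j\<in>J. a i * b j * ball_E (\<lambda>x. h x * (f i x * g j x)))"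
proof -
  have "ball_E (\<lambda>x. h x * ((\<Sum>i\<in>I. a i * f i x) * (\<Sum>j\<in>J. b j * g j x))) =
      ball_E (\<lambda>x. \<Sum>i\<in>I. a i * (\<Sum>j\<in>J. b j * (h x * (f i x * g j x))))"
    by (rule ball_E_cong, unfold sum_product, unfold sum_distrib_left, intro sum.cong refl)
       (simp add: mult_ac)
  also have "\<dots> = (\<Sum>i\<in>I. a i * ball_E (\<lambda>x. \<Sum>j\<in>J. b j * (h x * (f i x * g j x))))"
    by (rule ball_E_sum) (use assms in \<open>auto intro!: continuous_intros\<close>)
  also have "\<dots> = (\<Sum>i\<in>I. a i * (\<Sum>j\<in>J. b j * ball_E (\<lambda>x. h x * (f i x * g j x))))"
    by (intro sum.cong refl arg_cong2[of _ _ _ _ "(*)"] ball_E_sum) (use assms in \<open>auto intro!: continuous_intros\<close>)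
  finally show ?thesis by (simp add: sum_distrib_left mult_ac)
qed

lemma ball_E_mixed_power:
  assumes y: "norm y = 1" and z: "norm z = 1"
  shows "ball_E (\<lambda>x. radial A 0 x * (mixed_power lam sig p ((norm x)\<^sup>2) (x \<bullet> y) * mixed_power lam sig q ((norm x)\<^sup>2) (x \<bullet> z))) =
    radial_moment A ((p + q) div 2) *
      (\<Sum>K\<le>p. conv_coeff (lam + sig) p q K * mixed_power lam sig K 1 (y \<bullet> z))" (is "?L = _")
proof -
  let ?F = "\<lambda>i j. ball_E (\<lambda>x. radial A 0 x * ((((norm x)\<^sup>2) ^ ((p - i) div 2) * ((x \<bullet> y) ^ i / fact i)) * (((norm x)\<^sup>2) ^ ((q - j) div 2) * ((x \<bullet> z) ^ j / fact j))))"
  define \<beta> where "\<beta> n m = (\<Sum>K\<le>n. conv_coeff sig n m K * ((y \<bullet> z) ^ K / fact K))" for n m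
  have "?L =
    (\<Sum>i\<le>p. \<Sum>j\<le>q. mix_coeff lam sig p i * mix_coeff lam sig q j *
        ?F i j)"
    unfolding mixed_power_def by (rule ball_E_bilinear) (auto intro!: continuous_intros)
  also have "\<dots> = (\<Sum>i\<le>p. \<Sum>j\<le>q. radial_moment A ((p + q) div 2) * (mix_coeff lam sig p i * mix_coeff lam sig q j * \<beta> i j))"
  proof (intro sum.cong refl)
    fix i j
    show "mix_coeff lam sig p i * mix_coeff lam sig q j *
        ?F i j =
        radial_moment A ((p + q) div 2) * (mix_coeff lam sig p i * mix_coeff lam sig q j * \<beta> i j)"
    proof (cases p i rule: half_fact_cases)
      case 1 then show ?thesis by (simp add: mix_coeff_def)
    next
      case p: (2 a)
      show ?thesis
      proof (cases q j rule: half_fact_cases)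
        case 1 then show ?thesis by (simp add: mix_coeff_def)
      next
        case q: (2 b)
        have e: "(p - i) div 2 = a" "(q - j) div 2 = b" "a + b + (i + j) div 2 = (p + q) div 2"
          using p q by simp_all
        have "ball_E (\<lambda>x. radial A 0 x * ((((norm x)\<^sup>2) ^ a * ((x \<bullet> y) ^ i / fact i)) * (((norm x)\<^sup>2) ^ b * ((x \<bullet> z) ^ j / fact j)))) =
          ball_E (\<lambda>x. radial A (a + b) x * ((x \<bullet> y) ^ i / fact i * ((x \<bullet> z) ^ j / fact j)))"
          by (rule ball_E_cong) (simp add: radial_def power_add)
        also have "\<dots> = radial_moment A ((p + q) div 2) * \<beta> i j"
          unfolding ball_E_ridge_product[OF y z] e(3) \<beta>_def ..
        finally show ?thesis unfolding e by simp
      qed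
    qed
  qed
  also have "\<dots> = radial_moment A ((p + q) div 2) * (\<Sum>i\<le>p. \<Sum>j\<le>q. mix_coeff lam sig p i * mix_coeff lam sig q j * \<beta> i j)"
    by (simp add: sum_distrib_left)
  also have "(\<Sum>i\<le>p. \<Sum>j\<le>q. mix_coeff lam sig p i * mix_coeff lam sig q j * \<beta> i j) =
     (\<Sum>K\<le>p. conv_coeff (lam + sig) p q K * (\<Sum>i\<le>K. mix_coeff lam sig K i * ((y \<bullet> z) ^ i / fact i)))"
    by (rule mix_convolution) (use lam sig_nonneg in \<open>auto simp: \<beta>_def\<close>)
  finally show ?thesis by (simp add: mixed_power_def)
qed

definition zpow :: "nat \<Rightarrow> real ^ 'd \<Rightarrow> real ^ 'd \<Rightarrow> real" where
  "zpow n x y = zeta_power lam mu sig n ((norm x)\<^sup>2 * (norm y)\<^sup>2) (x \<bullet> y) ((1 - (norm x)\<^sup>2) * (1 - (norm y)\<^sup>2))"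

definition zonal_kernel :: "nat \<Rightarrow> real ^ 'd \<Rightarrow> real ^ 'd \<Rightarrow> real" where
  "zonal_kernel n x y = (\<Sum>i\<le>n. zonal_coeff nu n i * zpow i x y)"

lemma continuous_zpow [continuous_intros]: "continuous_on S (\<lambda>x. zpow n x y)"
  unfolding zpow_def zeta_power_def mixed_power_def by (intro continuous_intros) auto

text \<open>
  The vector \<open>0\<close> has a direction too, which saves a case distinction wherever homogeneity in \<open>y\<close> is used.
\<close>

lemma unit_direction:
  obtains r :: real and e :: "real ^ 'd" where "y = r *\<^sub>R e" "norm e = 1"
proof (cases "y = 0")
  case True
  then show ?thesis using that[of 0 "axis undefined 1"] by simp
next
  case False
  then show ?thesis using that[of "norm y" "y /\<^sub>R norm y"] by simp
qed

lemma zpow_scaleR: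
  assumes "norm e = 1"
  shows "zpow n x (r *\<^sub>R e) = (\<Sum>k\<le>n. last_coeff mu k * ((1 - r\<^sup>2) ^ (k div 2) * r ^ (n - k)) *
     ((1 - (norm x)\<^sup>2) ^ (k div 2) * mixed_power lam sig (n - k) ((norm x)\<^sup>2) (x \<bullet> e)))"
proof -
  have "mixed_power lam sig k ((norm x)\<^sup>2 * (norm (r *\<^sub>R e))\<^sup>2) (x \<bullet> r *\<^sub>R e) =
     r ^ k * mixed_power lam sig k ((norm x)\<^sup>2) (x \<bullet> e)" for k
    using mixed_power_scale[of lam sig k r "(norm x)\<^sup>2" "x \<bullet> e"] assms by (simp add: mult_ac power_mult_distrib)
  then show ?thesis using assms
    by (simp add: zpow_def zeta_power_def power_mult_distrib mult_ac)
qed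

text \<open>
  The pairing formula.  In polar form \<open>y = Y e\<close> and \<open>z = Z e'\<close> the integral splits into radial moments and
  pairings of mixed powers.  In the terms that do not vanish, the denominator of the radial moment
  depends on \<open>n + m\<close> only, so that it can be taken out as part of \<open>C\<close>.
\<close>

lemma ball_E_zpow:
  "ball_E (\<lambda>x. zpow n x y * zpow m x z) = (\<Sum>M\<le>n. conv_coeff nu n m M * zpow M y z)"
proof -
  obtain Y e where y: "y = Y *\<^sub>R e" "norm e = 1" by (rule unit_direction)
  obtain Z e' where z: "z = Z *\<^sub>R e'" "norm e' = 1" by (rule unit_direction)
  define s where "s = e \<bullet> e'"
  define V where "V k = mixed_power lam sig k 1 s" for k
  define C where "C = 1 / (2 ^ (n + m) * pochhammer (nu + 1) ((n + m) div 2))"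
  have pne: "pochhammer (lam + sig + 1) k \<noteq> 0" for k
    by (rule pochhammer_ne_0) (use lam sig_nonneg in simp)
  define a where "a k = (1 - Y\<^sup>2) ^ (k div 2) * Y ^ (n - k)" for k
  define b where "b l = (1 - Z\<^sup>2) ^ (l div 2) * Z ^ (m - l)" for l
  let ?T = "\<lambda>k l. ball_E (\<lambda>x. 1 * (((1 - (norm x)\<^sup>2) ^ (k div 2) * mixed_power lam sig (n - k) ((norm x)\<^sup>2) (x \<bullet> e)) *
     ((1 - (norm x)\<^sup>2) ^ (l div 2) * mixed_power lam sig (m - l) ((norm x)\<^sup>2) (x \<bullet> e'))))"
  have T: "last_coeff mu k * a k * (last_coeff mu l * b l) * ?T k l =
     C * (last_coeff mu k * last_coeff mu l * pochhammer (mu + 1/2) (k div 2 + l div 2) * 2 ^ (k + l) * a k * b l *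
      (\<Sum>K\<le>n - k. 2 ^ K * half_fact (n - k) K * half_fact (m - l) K * V K))"
    if "k \<le> n" "l \<le> m" for k l
  proof (cases "odd k \<or> odd l")
    case True then show ?thesis by (auto simp: last_coeff_def)
  next
    case False
    then have "even k" "even l" by auto
    then obtain k' l' where kl: "k = 2 * k'" "l = 2 * l'" by (auto elim!: evenE)
    have N: "k' + l' + (n - k + (m - l)) div 2 = (n + m) div 2" "k + l + (n - k + (m - l)) = n + m" using kl that by auto
    have "?T k l = ball_E (\<lambda>x. radial (k' + l') 0 x * (mixed_power lam sig (n - k) ((norm x)\<^sup>2) (x \<bullet> e) *
      mixed_power lam sig (m - l) ((norm x)\<^sup>2) (x \<bullet> e')))"
      by (rule ball_E_cong) (simp add: radial_def kl power_add)
    also have "\<dots> = radial_moment (k' + l') ((n - k + (m - l)) div 2) *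
      (\<Sum>K\<le>n - k. conv_coeff (lam + sig) (n - k) (m - l) K * V K)"
      unfolding V_def s_def by (rule ball_E_mixed_power[OF y(2) z(2)])
    also have "\<dots> = C * (pochhammer (mu + 1/2) (k' + l') * 2 ^ (k + l) *
        (\<Sum>K\<le>n - k. 2 ^ K * half_fact (n - k) K * half_fact (m - l) K * V K))"
      unfolding sum_distrib_left
    proof (intro sum.cong refl)
      fix K
      have p2: "2 ^ (n + m) = (2 ^ (k + l) * 2 ^ (n - k + (m - l)) :: real)"
        unfolding power_add[symmetric] N(2) ..
      show "radial_moment (k' + l') ((n - k + (m - l)) div 2) * (conv_coeff (lam + sig) (n - k) (m - l) K * V K) =
        C * (pochhammer (mu + 1/2) (k' + l') * 2 ^ (k + l) * (2 ^ K * half_fact (n - k) K * half_fact (m - l) K * V K))"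
        unfolding radial_moment_def conv_coeff_def N(1) C_def p2
        using pne[of "(n - k + (m - l)) div 2"] by (simp add: mult_ac)
    qed
    finally show ?thesis by (simp add: kl mult_ac)
  qed
  have "ball_E (\<lambda>x. zpow n x y * zpow m x z) = ball_E (\<lambda>x. 1 * (zpow n x y * zpow m x z))" by simp
  also have "\<dots> = (\<Sum>k\<le>n. \<Sum>l\<le>m. last_coeff mu k * a k * (last_coeff mu l * b l) * ?T k l)"
    unfolding y(1) z(1) zpow_scaleR[OF y(2)] zpow_scaleR[OF z(2)] a_def b_def
    by (rule ball_E_bilinear) (auto simp: mixed_power_def intro!: continuous_intros)
  also have "\<dots> = C * (\<Sum>k\<le>n. \<Sum>l\<le>m. last_coeff mu k * last_coeff mu l * pochhammer (mu + 1/2) (k div 2 + l div 2) * 2 ^ (k + l) * a k * b l *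
      (\<Sum>K\<le>n - k. 2 ^ K * half_fact (n - k) K * half_fact (m - l) K * V K))"
    unfolding sum_distrib_left[of C] by (intro sum.cong refl T) auto
  also have "\<dots> = C * (\<Sum>M\<le>n. half_fact n M * half_fact m M * 2 ^ M *
      (\<Sum>j\<le>M. last_coeff mu j * (((1 - Y\<^sup>2) * (1 - Z\<^sup>2)) ^ (j div 2) * ((Y * Z) ^ (M - j) * V (M - j)))))"
    unfolding a_def b_def zeta_power_convolution[OF mu] ..
  also have "\<dots> = (\<Sum>M\<le>n. conv_coeff nu n m M * zpow M y z)"
    unfolding sum_distrib_left[of C]
  proof (intro sum.cong refl)
    fix M
    have "zpow M y z = (\<Sum>j\<le>M. last_coeff mu j * (((1 - Y\<^sup>2) * (1 - Z\<^sup>2)) ^ (j div 2) * ((Y * Z) ^ (M - j) * V (M - j))))"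
    proof -
      have "mixed_power lam sig k ((norm y)\<^sup>2 * (norm z)\<^sup>2) (y \<bullet> z) = (Y * Z) ^ k * V k" for k
        using mixed_power_scale[of lam sig k "Y * Z" 1 s] y z by (simp add: V_def s_def mult_ac power_mult_distrib)
      then show ?thesis using y z by (simp add: zpow_def zeta_power_def)
    qed
    then show "C * (half_fact n M * half_fact m M * 2 ^ M *
      (\<Sum>j\<le>M. last_coeff mu j * (((1 - Y\<^sup>2) * (1 - Z\<^sup>2)) ^ (j div 2) * ((Y * Z) ^ (M - j) * V (M - j))))) =
      conv_coeff nu n m M * zpow M y z" by (simp add: C_def conv_coeff_def)
  qed
  finally show ?thesis .
qed

lemma ball_E_kernel:
  "ball_E (\<lambda>x. zonal_kernel k x y * zonal_kernel l x z) = (if k = l then zonal_kernel k y z else 0)"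
proof -
  have "ball_E (\<lambda>x. zonal_kernel k x y * zonal_kernel l x z) = ball_E (\<lambda>x. 1 * (zonal_kernel k x y * zonal_kernel l x z))" by simp
  also have "\<dots> = (\<Sum>i\<le>k. \<Sum>j\<le>l. zonal_coeff nu k i * zonal_coeff nu l j * ball_E (\<lambda>x. 1 * (zpow i x y * zpow j x z)))"
    unfolding zonal_kernel_def by (rule ball_E_bilinear) (auto intro!: continuous_intros)
  also have "\<dots> = (if k = l then \<Sum>i\<le>k. zonal_coeff nu k i * zpow i y z else 0)"
    by (rule zonal_convolution) (use nu_pos ball_E_zpow in auto)
  finally show ?thesis by (simp add: zonal_kernel_def)
qed

end

section \<open>Polynomials and linear functionals\<close>

abbreviation degree_of :: "('d::finite \<Rightarrow> nat) \<Rightarrow> nat" where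
  "degree_of \<alpha> \<equiv> \<Sum>i\<in>UNIV. \<alpha> i"

abbreviation monomial_at :: "('d::finite \<Rightarrow> nat) \<Rightarrow> real ^ 'd \<Rightarrow> real" where
  "monomial_at \<alpha> x \<equiv> \<Prod>i\<in>UNIV. x $ i ^ \<alpha> i"

lemma finite_multi_indices: "finite {\<alpha> :: 'd::finite \<Rightarrow> nat. degree_of \<alpha> \<le> n}"
proof (rule finite_subset)
  show "{\<alpha> :: 'd \<Rightarrow> nat. degree_of \<alpha> \<le> n} \<subseteq> PiE UNIV (\<lambda>_. {..n})"
  proof
    fix \<alpha> :: "'d \<Rightarrow> nat" assume "\<alpha> \<in> {\<alpha>. degree_of \<alpha> \<le> n}"
    moreover have "\<alpha> i \<le> degree_of \<alpha>" for i by (rule member_le_sum) auto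
    ultimately have "\<alpha> i \<le> n" for i using order_trans by blast
    then show "\<alpha> \<in> PiE UNIV (\<lambda>_. {..n})" by auto
  qed
  show "finite (PiE UNIV (\<lambda>_. {..n}) :: ('d \<Rightarrow> nat) set)" by (rule finite_PiE) auto
qed

lemma poly_deg_le_mono:
  fixes f :: "real ^ 'd \<Rightarrow> real"
  assumes "poly_deg_le n f" "n \<le> m" shows "poly_deg_le m f"
proof -
  obtain c where c: "f = (\<lambda>x. \<Sum>\<alpha> | degree_of \<alpha> \<le> n. c \<alpha> * monomial_at \<alpha> x)"
    using assms(1) unfolding poly_deg_le_def by blast
  have "f = (\<lambda>x. \<Sum>\<alpha> | degree_of \<alpha> \<le> m. (if degree_of \<alpha> \<le> n then c \<alpha> else 0) * monomial_at \<alpha> x)"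
  proof
    fix x
    show "f x = (\<Sum>\<alpha> | degree_of \<alpha> \<le> m. (if degree_of \<alpha> \<le> n then c \<alpha> else 0) * monomial_at \<alpha> x)"
      unfolding c using assms(2)
      by (intro sum.mono_neutral_cong_left finite_multi_indices) auto
  qed
  then show ?thesis unfolding poly_deg_le_def
    by (intro exI[of _ "\<lambda>\<alpha>. if degree_of \<alpha> \<le> n then c \<alpha> else 0"]) (auto simp: fun_eq_iff)
qed

lemma poly_deg_le_monomial:
  fixes \<alpha> :: "'d::finite \<Rightarrow> nat"
  assumes "degree_of \<alpha> \<le> n"
  shows "poly_deg_le n (\<lambda>x :: real ^ 'd. monomial_at \<alpha> x)"
  unfolding poly_deg_le_def
proof (intro exI ext)
  fix x :: "real ^ 'd"
  have "(\<Sum>\<beta> | degree_of \<beta> \<le> n. (if \<beta> = \<alpha> then 1 else 0) * monomial_at \<beta> x) =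
    (\<Sum>\<beta> | degree_of \<beta> \<le> n. if \<beta> = \<alpha> then monomial_at \<beta> x else 0)"
    by (intro sum.cong refl) auto
  also have "\<dots> = monomial_at \<alpha> x"
    using assms by (simp add: finite_multi_indices)
  finally show "monomial_at \<alpha> x = (\<Sum>\<beta> | degree_of \<beta> \<le> n. (if \<beta> = \<alpha> then 1 else 0) * monomial_at \<beta> x)" ..
qed

lemma poly_deg_le_add:
  assumes "poly_deg_le n f" "poly_deg_le n g" shows "poly_deg_le n (\<lambda>x. f x + g x)"
proof -
  from assms obtain c d where
    "f = (\<lambda>x. \<Sum>\<alpha> | degree_of \<alpha> \<le> n. c \<alpha> * monomial_at \<alpha> x)"
    "g = (\<lambda>x. \<Sum>\<alpha> | degree_of \<alpha> \<le> n. d \<alpha> * monomial_at \<alpha> x)"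
    unfolding poly_deg_le_def by blast
  then show ?thesis unfolding poly_deg_le_def
    by (intro exI[of _ "\<lambda>\<alpha>. c \<alpha> + d \<alpha>"]) (simp add: distrib_right sum.distrib)
qed

lemma poly_deg_le_cmult:
  assumes "poly_deg_le n f" shows "poly_deg_le n (\<lambda>x. a * f x)"
proof -
  from assms obtain c where
    "f = (\<lambda>x. \<Sum>\<alpha> | degree_of \<alpha> \<le> n. c \<alpha> * monomial_at \<alpha> x)"
    unfolding poly_deg_le_def by blast
  then show ?thesis unfolding poly_deg_le_def
    by (intro exI[of _ "\<lambda>\<alpha>. a * c \<alpha>"]) (simp add: sum_distrib_left mult_ac)
qed

lemma poly_deg_le_const: "poly_deg_le n (\<lambda>x :: real ^ 'd. a)"
proof -
  have "poly_deg_le n (\<lambda>x :: real ^ 'd. a * (\<Prod>i\<in>UNIV. x $ i ^ (\<lambda>_. 0) i))"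
    by (rule poly_deg_le_cmult, rule poly_deg_le_monomial) simp
  then show ?thesis by simp
qed

lemma poly_deg_le_sum:
  assumes "\<And>i. i \<in> I \<Longrightarrow> poly_deg_le n (f i)" shows "poly_deg_le n (\<lambda>x. \<Sum>i\<in>I. f i x)"
proof (cases "finite I")
  case True
  from True assms show ?thesis
    by (induction I rule: finite_induct) (auto intro: poly_deg_le_const poly_deg_le_add)
qed (simp add: poly_deg_le_const)

lemma poly_deg_le_mult:
  fixes f g :: "real ^ 'd \<Rightarrow> real"
  assumes "poly_deg_le n f" "poly_deg_le m g" shows "poly_deg_le (n + m) (\<lambda>x. f x * g x)"
proof -
  from assms obtain c d where
    f: "f = (\<lambda>x. \<Sum>\<alpha> | degree_of \<alpha> \<le> n. c \<alpha> * monomial_at \<alpha> x)" and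
    g: "g = (\<lambda>x. \<Sum>\<alpha> | degree_of \<alpha> \<le> m. d \<alpha> * monomial_at \<alpha> x)"
    unfolding poly_deg_le_def by blast
  have "(\<lambda>x. f x * g x) = (\<lambda>x. \<Sum>\<alpha> | degree_of \<alpha> \<le> n. \<Sum>\<beta> | degree_of \<beta> \<le> m.
      (c \<alpha> * d \<beta>) * (\<Prod>i\<in>UNIV. x $ i ^ (\<lambda>i. \<alpha> i + \<beta> i) i))"
    unfolding f g sum_product by (simp add: power_add prod.distrib mult_ac)
  moreover have "poly_deg_le (n + m) \<dots>"
    by (intro poly_deg_le_sum poly_deg_le_cmult poly_deg_le_monomial) (auto simp: sum.distrib)
  ultimately show ?thesis by simp
qed

lemma poly_deg_le_power:
  assumes "poly_deg_le n f" shows "poly_deg_le (n * k) (\<lambda>x. f x ^ k)"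
proof (induction k)
  case (Suc k)
  then show ?case using poly_deg_le_mult[OF assms Suc.IH] by simp
qed (simp add: poly_deg_le_const)

lemma poly_deg_le_component: "poly_deg_le 1 (\<lambda>x :: real ^ 'd. x $ j)"
proof -
  have "poly_deg_le 1 (\<lambda>x :: real ^ 'd. \<Prod>i\<in>UNIV. x $ i ^ (\<lambda>i. if i = j then 1 else 0) i)"
    by (rule poly_deg_le_monomial) simp
  moreover have "(\<Prod>i\<in>UNIV. x $ i ^ (\<lambda>i. if i = j then 1 else 0) i) = x $ j" for x :: "real ^ 'd"
  proof -
    have "(\<Prod>i\<in>UNIV. x $ i ^ (\<lambda>i. if i = j then 1 else 0) i) = (\<Prod>i\<in>UNIV. if i = j then x $ i else 1)"
      by (intro prod.cong) auto
    then show ?thesis by simp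
  qed
  ultimately show ?thesis by simp
qed

lemma poly_deg_le_inner: "poly_deg_le 1 (\<lambda>x :: real ^ 'd. x \<bullet> w)"
proof -
  have "(\<lambda>x :: real ^ 'd. x \<bullet> w) = (\<lambda>x. \<Sum>i\<in>UNIV. w $ i * x $ i)"
    by (simp add: inner_vec_def mult.commute)
  then show ?thesis by (simp only:) (intro poly_deg_le_sum poly_deg_le_cmult poly_deg_le_component)
qed

lemma poly_deg_le_norm_square: "poly_deg_le 2 (\<lambda>x :: real ^ 'd. (norm x)\<^sup>2)"
proof -
  have "(\<lambda>x :: real ^ 'd. (norm x)\<^sup>2) = (\<lambda>x. \<Sum>i\<in>UNIV. (x $ i)\<^sup>2)"
    by (simp add: norm_vec_def L2_set_def sum_nonneg)
  moreover have "poly_deg_le 2 (\<lambda>x :: real ^ 'd. (x $ i)\<^sup>2)" for i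
    using poly_deg_le_power[OF poly_deg_le_component[of i], of 2] by simp
  ultimately show ?thesis by (auto intro!: poly_deg_le_sum)
qed

lemma poly_deg_le_continuous: "poly_deg_le n f \<Longrightarrow> continuous_on S f"
  unfolding poly_deg_le_def by (auto intro!: continuous_intros)

lemma linear_product_of_monomial:
  fixes \<alpha> :: "'d::finite \<Rightarrow> nat"
  shows "\<exists>ws. length ws = degree_of \<alpha> \<and> (\<forall>x::real^'d. prod_list (map (\<lambda>w. x \<bullet> w) ws) = monomial_at \<alpha> x)"
proof -
  have "\<exists>ws. length ws = (\<Sum>i\<in>S. \<alpha> i) \<and> (\<forall>x::real^'d. prod_list (map (\<lambda>w. x \<bullet> w) ws) = (\<Prod>i\<in>S. x $ i ^ \<alpha> i))"
    if "finite S" for S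
    using that
  proof (induction S rule: finite_induct)
    case empty
    show ?case by (rule exI[of _ "[]"]) simp
  next
    case (insert i S)
    then obtain ws where ws: "length ws = (\<Sum>i\<in>S. \<alpha> i)"
      "\<forall>x::real^'d. prod_list (map (\<lambda>w. x \<bullet> w) ws) = (\<Prod>i\<in>S. x $ i ^ \<alpha> i)" by blast
    show ?case
      by (rule exI[of _ "replicate (\<alpha> i) (axis i 1) @ ws"])
         (use insert.hyps ws in \<open>simp add: inner_axis\<close>)
  qed
  from this[OF finite[of UNIV]] show ?thesis .
qed

text \<open>
  Additivity is required only for continuous functions, because other integrals need not exist.
\<close>

definition linear_on_continuous :: "((real ^ 'd \<Rightarrow> real) \<Rightarrow> real) \<Rightarrow> bool" where
  "linear_on_continuous L \<longleftrightarrow>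
     (\<forall>f g. continuous_on UNIV f \<longrightarrow> continuous_on UNIV g \<longrightarrow> L (\<lambda>x. f x + g x) = L f + L g) \<and>
     (\<forall>c f. L (\<lambda>x. c * f x) = c * L f)"

lemma linear_on_continuous_add:
  "linear_on_continuous L \<Longrightarrow> continuous_on UNIV f \<Longrightarrow> continuous_on UNIV g \<Longrightarrow> L (\<lambda>x. f x + g x) = L f + L g"
  and linear_on_continuous_cmult: "linear_on_continuous L \<Longrightarrow> L (\<lambda>x. c * f x) = c * L f"
  by (simp_all add: linear_on_continuous_def)

lemma linear_on_continuous_sum:
  assumes L: "linear_on_continuous L" and "finite I" "\<And>i. i \<in> I \<Longrightarrow> continuous_on UNIV (f i)"
  shows "L (\<lambda>x. \<Sum>i\<in>I. c i * f i x) = (\<Sum>i\<in>I. c i * L (f i))"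
  using assms(2,3)
proof (induction I rule: finite_induct)
  case empty
  show ?case using linear_on_continuous_cmult[OF L, of 0 "\<lambda>x. 0"] by simp
next
  case (insert i I)
  have "L (\<lambda>x. \<Sum>i\<in>insert i I. c i * f i x) = L (\<lambda>x. c i * f i x + (\<Sum>i\<in>I. c i * f i x))"
    using insert.hyps by simp
  also have "\<dots> = L (\<lambda>x. c i * f i x) + L (\<lambda>x. \<Sum>i\<in>I. c i * f i x)"
    by (rule linear_on_continuous_add[OF L]) (use insert.prems in \<open>auto intro!: continuous_intros\<close>)
  also have "L (\<lambda>x. c i * f i x) = c i * L (f i)" by (rule linear_on_continuous_cmult[OF L])
  finally show ?case using insert by simp
qed

text \<open>
  Polarization: the derivative of \<open>(x \<bullet> (z + \<tau> w))\<^bsup>k+1\<^esup>\<close> at \<open>\<tau> = 0\<close> trades one factor \<open>x \<bullet> z\<close> for \<open>x \<bullet> w\<close>.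
\<close>

lemma vanishes_on_linear_products:
  assumes L: "linear_on_continuous L"
    and pow: "\<And>z. L (\<lambda>x. (x \<bullet> z) ^ p) = 0"
  shows "k + length ws = p \<Longrightarrow> L (\<lambda>x. (x \<bullet> z) ^ k * prod_list (map (\<lambda>w. x \<bullet> w) ws)) = 0"
proof (induction ws arbitrary: k z)
  case Nil
  then show ?case using pow[of z] by simp
next
  case (Cons w ws)
  let ?P = "\<lambda>x. prod_list (map (\<lambda>w. x \<bullet> w) ws)"
  have cP: "continuous_on UNIV ?P"
    by (induction ws) (auto intro!: continuous_intros)
  let ?c = "\<lambda>j. real (Suc k choose j) * L (\<lambda>x. (x \<bullet> w) ^ j * (x \<bullet> z) ^ (Suc k - j) * ?P x)"
  have "(\<Sum>j\<le>Suc k. ?c j * \<tau> ^ j) = 0" for \<tau>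
  proof -
    have "(\<lambda>x. (x \<bullet> (z + \<tau> *\<^sub>R w)) ^ Suc k * ?P x) =
      (\<lambda>x. \<Sum>j\<le>Suc k. (real (Suc k choose j) * \<tau> ^ j) * ((x \<bullet> w) ^ j * (x \<bullet> z) ^ (Suc k - j) * ?P x))"
    proof
      fix x
      have "(x \<bullet> (z + \<tau> *\<^sub>R w)) ^ Suc k = (\<tau> * (x \<bullet> w) + x \<bullet> z) ^ Suc k"
        by (simp add: inner_add_right add.commute)
      also have "\<dots> = (\<Sum>j\<le>Suc k. real (Suc k choose j) * (\<tau> * (x \<bullet> w)) ^ j * (x \<bullet> z) ^ (Suc k - j))"
        by (rule binomial_ring)
      finally have e: "(x \<bullet> (z + \<tau> *\<^sub>R w)) ^ Suc k = (\<Sum>j\<le>Suc k. real (Suc k choose j) * (\<tau> * (x \<bullet> w)) ^ j * (x \<bullet> z) ^ (Suc k - j))" .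
      show "(x \<bullet> (z + \<tau> *\<^sub>R w)) ^ Suc k * ?P x = (\<Sum>j\<le>Suc k. (real (Suc k choose j) * \<tau> ^ j) * ((x \<bullet> w) ^ j * (x \<bullet> z) ^ (Suc k - j) * ?P x))"
        unfolding e sum_distrib_right by (intro sum.cong refl) (simp add: power_mult_distrib mult_ac)
    qed
    then have "L (\<lambda>x. (x \<bullet> (z + \<tau> *\<^sub>R w)) ^ Suc k * ?P x) =
      (\<Sum>j\<le>Suc k. (real (Suc k choose j) * \<tau> ^ j) * L (\<lambda>x. (x \<bullet> w) ^ j * (x \<bullet> z) ^ (Suc k - j) * ?P x))"
      by (simp only:, intro linear_on_continuous_sum[OF L]) (auto intro!: continuous_intros cP)
    moreover have "L (\<lambda>x. (x \<bullet> (z + \<tau> *\<^sub>R w)) ^ Suc k * ?P x) = 0"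
      by (rule Cons.IH) (use Cons.prems in simp)
    ultimately show ?thesis by (simp add: mult_ac)
  qed
  then have *: "\<forall>j\<le>Suc k. ?c j = 0" by (rule polyfun_eq_0[THEN iffD1, OF allI])
  have "?c 1 = 0" by (rule *[rule_format]) simp
  then have "L (\<lambda>x. (x \<bullet> w) ^ 1 * (x \<bullet> z) ^ (Suc k - 1) * ?P x) = 0" by simp
  then show ?case by (simp add: mult_ac)
qed

lemma vanishes_on_polynomials:
  fixes L :: "(real ^ 'd \<Rightarrow> real) \<Rightarrow> real"
  assumes L: "linear_on_continuous L"
    and pow: "\<And>p z. p \<le> n \<Longrightarrow> L (\<lambda>x. (x \<bullet> z) ^ p) = 0"
    and q: "poly_deg_le n q"
  shows "L q = 0"
proof -
  obtain c where c: "q = (\<lambda>x. \<Sum>\<alpha> | degree_of \<alpha> \<le> n. c \<alpha> * monomial_at \<alpha> x)"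
    using q unfolding poly_deg_le_def by blast
  have "L q = (\<Sum>\<alpha> | degree_of \<alpha> \<le> n. c \<alpha> * L (\<lambda>x. monomial_at \<alpha> x))"
    unfolding c by (rule linear_on_continuous_sum[OF L finite_multi_indices]) (auto intro!: continuous_intros)
  also have "\<dots> = 0"
  proof (rule sum.neutral, rule ballI)
    fix \<alpha> :: "'d \<Rightarrow> nat" assume \<alpha>: "\<alpha> \<in> {\<alpha>. degree_of \<alpha> \<le> n}"
    obtain ws where ws: "length ws = degree_of \<alpha>"
      "\<And>x::real^'d. prod_list (map (\<lambda>w. x \<bullet> w) ws) = monomial_at \<alpha> x"
      using linear_product_of_monomial[of \<alpha>] by blast
    have "L (\<lambda>x. (x \<bullet> 0) ^ 0 * prod_list (map (\<lambda>w. x \<bullet> w) ws)) = 0"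
      by (rule vanishes_on_linear_products[OF L pow, of "length ws"]) (use \<alpha> ws(1) in auto)
    then show "c \<alpha> * L (\<lambda>x. monomial_at \<alpha> x) = 0" by (simp add: ws(2))
  qed
  finally show ?thesis .
qed

section \<open>The reproducing property\<close>

context radial_ball_weight
begin

lemma poly_deg_le_zpow: "poly_deg_le n (\<lambda>x. zpow n x y)"
proof -
  have one: "poly_deg_le (2 * a) (\<lambda>x :: real ^ 'd. ((1 - (norm x)\<^sup>2) * t) ^ a)" for a t
  proof -
    have "poly_deg_le 2 (\<lambda>x :: real ^ 'd. t + (- t) * (norm x)\<^sup>2)"
      by (intro poly_deg_le_add poly_deg_le_const poly_deg_le_cmult poly_deg_le_norm_square)
    moreover have "(\<lambda>x :: real ^ 'd. t + (- t) * (norm x)\<^sup>2) = (\<lambda>x. (1 - (norm x)\<^sup>2) * t)" by (auto simp: algebra_simps)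
    ultimately show ?thesis using poly_deg_le_power by simp
  qed
  have two: "poly_deg_le (2 * a) (\<lambda>x :: real ^ 'd. ((norm x)\<^sup>2 * t) ^ a)" for a t
    using poly_deg_le_power[OF poly_deg_le_cmult[OF poly_deg_le_norm_square, of t]] by (simp add: mult.commute)
  have three: "poly_deg_le c (\<lambda>x :: real ^ 'd. (x \<bullet> y) ^ c / fact c)" for c
    using poly_deg_le_cmult[OF poly_deg_le_power[OF poly_deg_le_inner[of y], of c], of "1 / fact c"] by simp
  have M: "poly_deg_le p (\<lambda>x :: real ^ 'd. mixed_power lam sig p ((norm x)\<^sup>2 * (norm y)\<^sup>2) (x \<bullet> y))" for p
    unfolding mixed_power_def
  proof (intro poly_deg_le_sum poly_deg_le_cmult)
    fix c assume "c \<in> {..p}"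
    then have "2 * ((p - c) div 2) + c \<le> p" by auto
    then show "poly_deg_le p (\<lambda>x :: real ^ 'd. ((norm x)\<^sup>2 * (norm y)\<^sup>2) ^ ((p - c) div 2) * ((x \<bullet> y) ^ c / fact c))"
      by (rule poly_deg_le_mono[OF poly_deg_le_mult[OF two three]])
  qed
  show ?thesis unfolding zpow_def zeta_power_def
  proof (intro poly_deg_le_sum poly_deg_le_cmult)
    fix k assume "k \<in> {..n}"
    then have "2 * (k div 2) + (n - k) \<le> n" by auto
    then show "poly_deg_le n (\<lambda>x :: real ^ 'd. ((1 - (norm x)\<^sup>2) * (1 - (norm y)\<^sup>2)) ^ (k div 2) *
       mixed_power lam sig (n - k) ((norm x)\<^sup>2 * (norm y)\<^sup>2) (x \<bullet> y))"
      by (rule poly_deg_le_mono[OF poly_deg_le_mult[OF one M]])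
  qed
qed

lemma poly_deg_le_kernel: "poly_deg_le n (\<lambda>x. zonal_kernel n x y)"
  unfolding zonal_kernel_def
  by (intro poly_deg_le_sum poly_deg_le_cmult) (auto intro: poly_deg_le_mono[OF poly_deg_le_zpow])

lemma continuous_kernel [continuous_intros]: "continuous_on S (\<lambda>x. zonal_kernel n x y)"
  by (rule poly_deg_le_continuous[OF poly_deg_le_kernel])

lemma zpow_eq_kernels: "zpow n x y = (\<Sum>k\<le>n. expand_coeff nu n k * zonal_kernel k x y)"
  unfolding zonal_kernel_def using zonal_transform_inverse[of nu n "\<lambda>i. zpow i x y"] nu_pos by simp

text \<open>
  Let the functional act on \<open>zpow m x (r e)\<close>.  After division by \<open>r\<^sup>m\<close> the result is a polynomial in
  \<open>\<tau> = (1 - r\<^sup>2) / r\<^sup>2\<close>, which takes every value \<open>\<ge> 0\<close>; so all its coefficients vanish.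
\<close>

lemma vanishes_on_separated:
  assumes L: "linear_on_continuous L"
    and zero: "\<And>m z. m \<le> N \<Longrightarrow> L (\<lambda>x. zpow m x z) = 0"
    and e: "norm e = 1" and N: "2 * a + p \<le> N"
  shows "L (\<lambda>x. (1 - (norm x)\<^sup>2) ^ a * mixed_power lam sig p ((norm x)\<^sup>2) (x \<bullet> e)) = 0"
proof -
  define m where "m = 2 * a + p"
  define F where "F b q = L (\<lambda>x. (1 - (norm x)\<^sup>2) ^ b * mixed_power lam sig q ((norm x)\<^sup>2) (x \<bullet> e))" for b q
  have id: "(\<Sum>k\<le>m. last_coeff mu k * ((1 - r\<^sup>2) ^ (k div 2) * r ^ (m - k)) * F (k div 2) (m - k)) = 0" for r
  proof -
    have "L (\<lambda>x. zpow m x (r *\<^sub>R e)) = (\<Sum>k\<le>m. last_coeff mu k * ((1 - r\<^sup>2) ^ (k div 2) * r ^ (m - k)) * F (k div 2) (m - k))"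
      unfolding zpow_scaleR[OF e] F_def
      by (rule linear_on_continuous_sum[OF L]) (auto simp: mixed_power_def intro!: continuous_intros)
    then show ?thesis using zero[of m "r *\<^sub>R e"] N by (simp add: m_def)
  qed
  define c where "c b = last_coeff mu (2 * b) * F b (m - 2 * b)" for b
  have c0: "(\<Sum>b\<le>m div 2. c b * \<tau> ^ b) = 0" if "\<tau> \<ge> 0" for \<tau> :: real
  proof -
    \<comment> \<open>This choice solves \<open>\<tau> = (1 - r\<^sup>2) / r\<^sup>2\<close>.\<close>
    define r where "r = 1 / sqrt (1 + \<tau>)"
    have r: "r > 0" "r\<^sup>2 = 1 / (1 + \<tau>)" using that by (auto simp: r_def power_divide)
    have \<tau>: "1 - r\<^sup>2 = \<tau> * r\<^sup>2" using that unfolding r by (simp add: field_simps)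
    have "(\<Sum>k\<le>m. last_coeff mu k * ((1 - r\<^sup>2) ^ (k div 2) * r ^ (m - k)) * F (k div 2) (m - k)) =
      sum (\<lambda>k. last_coeff mu k * ((1 - r\<^sup>2) ^ (k div 2) * r ^ (m - k)) * F (k div 2) (m - k)) ((\<lambda>b. 2 * b) ` {..m div 2})"
    proof (rule sum.mono_neutral_right)
      show "\<forall>k\<in>{..m} - (\<lambda>b. 2 * b) ` {..m div 2}. last_coeff mu k * ((1 - r\<^sup>2) ^ (k div 2) * r ^ (m - k)) * F (k div 2) (m - k) = 0"
      proof
        fix k assume k: "k \<in> {..m} - (\<lambda>b. 2 * b) ` {..m div 2}"
        have "odd k"
        proof
          assume "even k"
          then obtain b where "k = 2 * b" by (rule evenE)
          moreover from this k have "b \<le> m div 2" by auto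
          ultimately show False using k by auto
        qed
        then show "last_coeff mu k * ((1 - r\<^sup>2) ^ (k div 2) * r ^ (m - k)) * F (k div 2) (m - k) = 0"
          by (simp add: last_coeff_def)
      qed
    qed auto
    also have "\<dots> = (\<Sum>b\<le>m div 2. last_coeff mu (2 * b) * ((1 - r\<^sup>2) ^ b * r ^ (m - 2 * b)) * F b (m - 2 * b))"
      by (subst sum.reindex) (auto simp: inj_on_def)
    also have "\<dots> = (\<Sum>b\<le>m div 2. r ^ m * (c b * \<tau> ^ b))"
    proof (intro sum.cong refl)
      fix b assume "b \<in> {..m div 2}"
      then have "m = 2 * b + (m - 2 * b)" by auto
      then have "r ^ m = (r\<^sup>2) ^ b * r ^ (m - 2 * b)" by (metis power_add power_mult)
      then show "last_coeff mu (2 * b) * ((1 - r\<^sup>2) ^ b * r ^ (m - 2 * b)) * F b (m - 2 * b) = r ^ m * (c b * \<tau> ^ b)"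
        unfolding \<tau> c_def by (simp add: power_mult_distrib mult_ac)
    qed
    finally have "r ^ m * (\<Sum>b\<le>m div 2. c b * \<tau> ^ b) = 0" using id[of r] by (simp add: sum_distrib_left)
    then show ?thesis using r by simp
  qed
  have "c a = 0"
  proof (rule ccontr)
    assume "c a \<noteq> 0"
    moreover have "a \<le> m div 2" by (simp add: m_def)
    ultimately have "finite {\<tau>. (\<Sum>b\<le>m div 2. c b * \<tau> ^ b) = 0}"
      by (subst polyfun_finite_roots) blast
    moreover have "{0..} \<subseteq> {\<tau>. (\<Sum>b\<le>m div 2. c b * \<tau> ^ b) = 0}" using c0 by auto
    ultimately show False using infinite_Ici finite_subset by blast
  qed
  moreover have "pochhammer (mu + 1/2) a \<noteq> 0" using mu by (intro pochhammer_ne_0) simp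
  ultimately show ?thesis by (simp add: c_def F_def m_def last_coeff_def)
qed

text \<open>
  The mixed power of degree \<open>p\<close> has leading term \<open>(x \<bullet> e)\<^sup>p\<close>.  In its other terms \<open>\<parallel>x\<parallel>\<^sup>2\<close> is rewritten as
  \<open>1 - (1 - \<parallel>x\<parallel>\<^sup>2)\<close>, which reduces them to smaller \<open>p\<close> and larger \<open>a\<close> without raising the degree.
\<close>

lemma vanishes_on_ridges:
  assumes L: "linear_on_continuous L"
    and zero: "\<And>m z. m \<le> N \<Longrightarrow> L (\<lambda>x. zpow m x z) = 0"
    and e: "norm e = 1"
  shows "2 * a + p \<le> N \<Longrightarrow> L (\<lambda>x. (1 - (norm x)\<^sup>2) ^ a * (x \<bullet> e) ^ p) = 0"
proof (induction p arbitrary: a rule: less_induct)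
  case (less p)
  let ?G = "\<lambda>c x. (1 - (norm x)\<^sup>2) ^ a * (((norm x)\<^sup>2) ^ ((p - c) div 2) * ((x \<bullet> e) ^ c / fact c))"
  have low: "mix_coeff lam sig p c * L (?G c) = 0" if c: "c < p" for c
  proof (cases p c rule: half_fact_cases)
    case 1 then show ?thesis by (simp add: mix_coeff_def)
  next
    case (2 b)
    have b: "(p - c) div 2 = b" using 2 by simp
    have "?G c = (\<lambda>x. \<Sum>i\<le>b. (real (b choose i) * (-1) ^ i / fact c) * ((1 - (norm x)\<^sup>2) ^ (a + i) * (x \<bullet> e) ^ c))"
    proof
      fix x :: "real ^ 'd"
      have "((norm x)\<^sup>2) ^ b = (- (1 - (norm x)\<^sup>2) + 1) ^ b" by simp
      also have "\<dots> = (\<Sum>i\<le>b. real (b choose i) * (- (1 - (norm x)\<^sup>2)) ^ i * 1 ^ (b - i))"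
        by (rule binomial_ring)
      finally have s: "((norm x)\<^sup>2) ^ b = (\<Sum>i\<le>b. real (b choose i) * (-1) ^ i * (1 - (norm x)\<^sup>2) ^ i)"
        by (simp only: power_minus[of "1 - (norm x)\<^sup>2"] power_one mult_1_right mult.assoc)
      show "?G c x = (\<Sum>i\<le>b. (real (b choose i) * (-1) ^ i / fact c) * ((1 - (norm x)\<^sup>2) ^ (a + i) * (x \<bullet> e) ^ c))"
        unfolding b s sum_distrib_left sum_distrib_right
        by (intro sum.cong refl) (simp add: power_add)
    qed
    then have "L (?G c) = (\<Sum>i\<le>b. (real (b choose i) * (-1) ^ i / fact c) * L (\<lambda>x. (1 - (norm x)\<^sup>2) ^ (a + i) * (x \<bullet> e) ^ c))"
      by (simp only:, intro linear_on_continuous_sum[OF L]) (auto intro!: continuous_intros)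
    also have "\<dots> = 0"
    proof (rule sum.neutral, rule ballI)
      fix i assume "i \<in> {..b}"
      then have "2 * (a + i) + c \<le> N" using less.prems 2 by auto
      from less.IH[OF c this] show "(real (b choose i) * (-1) ^ i / fact c) * L (\<lambda>x. (1 - (norm x)\<^sup>2) ^ (a + i) * (x \<bullet> e) ^ c) = 0"
        by simp
    qed
    finally show ?thesis by simp
  qed
  have "0 = L (\<lambda>x. (1 - (norm x)\<^sup>2) ^ a * mixed_power lam sig p ((norm x)\<^sup>2) (x \<bullet> e))"
    by (rule vanishes_on_separated[OF L zero e less.prems, symmetric])
  also have "(\<lambda>x. (1 - (norm x)\<^sup>2) ^ a * mixed_power lam sig p ((norm x)\<^sup>2) (x \<bullet> e)) =
     (\<lambda>x. \<Sum>c\<le>p. mix_coeff lam sig p c * ?G c x)"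
    by (simp add: mixed_power_def sum_distrib_left mult_ac)
  also have "L \<dots> = (\<Sum>c\<le>p. mix_coeff lam sig p c * L (?G c))"
    by (rule linear_on_continuous_sum[OF L]) (auto intro!: continuous_intros)
  also have "\<dots> = (\<Sum>c\<le>p. if c = p then mix_coeff lam sig p p * L (?G p) else 0)"
    by (intro sum.cong refl) (use low in auto)
  also have "\<dots> = mix_coeff lam sig p p * L (\<lambda>x. 1 / fact p * ((1 - (norm x)\<^sup>2) ^ a * (x \<bullet> e) ^ p))"
    by simp
  also have "L (\<lambda>x. 1 / fact p * ((1 - (norm x)\<^sup>2) ^ a * (x \<bullet> e) ^ p)) = 1 / fact p * L (\<lambda>x. (1 - (norm x)\<^sup>2) ^ a * (x \<bullet> e) ^ p)"
    by (rule linear_on_continuous_cmult[OF L])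
  finally show ?case
    using pochhammer_ne_0[of "sig + 1" p] pochhammer_ne_0[of "lam + sig + 1" p] lam sig_nonneg
    by (simp add: mix_coeff_def)
qed

text \<open>
  The difference of the two sides is a linear functional of \<open>q\<close>.  It vanishes on each \<open>zpow m x z\<close>, because
  this function is a combination of orthogonal kernels.
\<close>

lemma kernel_reproduces:
  assumes q: "poly_deg_le n q"
  shows "q y = (\<Sum>m\<le>n. ball_E (\<lambda>x. zonal_kernel m x y * q x))"
proof -
  define L where "L f = f y - (\<Sum>m\<le>n. ball_E (\<lambda>x. zonal_kernel m x y * f x))" for f
  have L: "linear_on_continuous L"
    unfolding linear_on_continuous_def
  proof (intro conjI allI impI)
    fix f g :: "real ^ 'd \<Rightarrow> real" assume fg: "continuous_on UNIV f" "continuous_on UNIV g"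
    have "ball_E (\<lambda>x. zonal_kernel m x y * (f x + g x)) = ball_E (\<lambda>x. zonal_kernel m x y * f x) + ball_E (\<lambda>x. zonal_kernel m x y * g x)" for m
      unfolding distrib_left
      by (rule ball_E_add) (use fg in \<open>auto intro!: continuous_intros elim: continuous_on_subset\<close>)
    then show "L (\<lambda>x. f x + g x) = L f + L g" by (simp add: L_def sum.distrib)
  next
    fix c and f :: "real ^ 'd \<Rightarrow> real"
    have "ball_E (\<lambda>x. zonal_kernel m x y * (c * f x)) = c * ball_E (\<lambda>x. zonal_kernel m x y * f x)" for m
      unfolding ball_E_cmult[symmetric] by (simp add: mult_ac)
    then show "L (\<lambda>x. c * f x) = c * L f" by (simp add: L_def sum_distrib_left right_diff_distrib)
  qed
  have zero: "L (\<lambda>x. zpow m x z) = 0" if m: "m \<le> n" for m z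
  proof -
    have "ball_E (\<lambda>x. zonal_kernel j x y * zpow m x z) = expand_coeff nu m j * zonal_kernel j y z" for j
    proof -
      have "ball_E (\<lambda>x. zonal_kernel j x y * zpow m x z) = ball_E (\<lambda>x. \<Sum>k\<le>m. expand_coeff nu m k * (zonal_kernel j x y * zonal_kernel k x z))"
        by (rule ball_E_cong) (simp add: zpow_eq_kernels sum_distrib_left mult_ac)
      also have "\<dots> = (\<Sum>k\<le>m. expand_coeff nu m k * ball_E (\<lambda>x. zonal_kernel j x y * zonal_kernel k x z))"
        by (rule ball_E_sum) (auto intro!: continuous_intros)
      also have "\<dots> = (\<Sum>k\<le>m. if j = k then expand_coeff nu m j * zonal_kernel j y z else 0)"
        unfolding ball_E_kernel by (intro sum.cong refl) auto
      also have "\<dots> = expand_coeff nu m j * zonal_kernel j y z" by (auto simp: expand_coeff_eq_0)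
      finally show ?thesis .
    qed
    then have "(\<Sum>j\<le>n. ball_E (\<lambda>x. zonal_kernel j x y * zpow m x z)) = (\<Sum>j\<le>n. expand_coeff nu m j * zonal_kernel j y z)" by simp
    also have "\<dots> = (\<Sum>j\<le>m. expand_coeff nu m j * zonal_kernel j y z)"
      by (rule sum_atMost_extend[symmetric]) (use m in \<open>auto simp: expand_coeff_eq_0\<close>)
    finally show ?thesis by (simp add: L_def zpow_eq_kernels)
  qed
  have "L q = 0"
  proof (rule vanishes_on_polynomials[OF L _ q])
    fix p and z :: "real ^ 'd" assume p: "p \<le> n"
    obtain r e where z: "z = r *\<^sub>R e" "norm e = 1" by (rule unit_direction)
    have "L (\<lambda>x. (1 - (norm x)\<^sup>2) ^ 0 * (x \<bullet> e) ^ p) = 0"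
      by (rule vanishes_on_ridges[OF L zero z(2)]) (use p in auto)
    moreover have "L (\<lambda>x. r ^ p * (x \<bullet> e) ^ p) = r ^ p * L (\<lambda>x. (x \<bullet> e) ^ p)"
      by (rule linear_on_continuous_cmult[OF L])
    ultimately show "L (\<lambda>x. (x \<bullet> z) ^ p) = 0" by (simp add: z(1) power_mult_distrib)
  qed
  then show ?thesis by (simp add: L_def)
qed

lemma ball_inner_eq: "ball_inner W f g = ball_E (\<lambda>x. f x * g x)"
  by (simp add: ball_inner_def ball_E_def)

text \<open>
  The degenerate case of the Cauchy-Schwarz inequality.
\<close>

lemma ball_E_null:
  assumes f: "continuous_on (cball 0 1) f" and g: "continuous_on (cball 0 1) g" and null: "ball_E (\<lambda>x. f x * f x) = 0"
  shows "ball_E (\<lambda>x. g x * f x) = 0"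
proof (rule ccontr)
  assume ne: "ball_E (\<lambda>x. g x * f x) \<noteq> 0"
  define P where "P = ball_E (\<lambda>x. g x * f x)"
  \<comment> \<open>Any \<open>t\<close> beyond the zero of the linear function below does; this one gives the value \<open>-1\<close>.\<close>
  define t where "t = - (ball_E (\<lambda>x. g x * g x) + 1) / (2 * P)"
  have "0 \<le> ball_E (\<lambda>x. (g x + t * f x) * (g x + t * f x))" by (rule ball_E_nonneg) simp
  also have "\<dots> = ball_E (\<lambda>x. g x * g x + (2 * t * (g x * f x) + t\<^sup>2 * (f x * f x)))"
    by (rule ball_E_cong) (simp add: algebra_simps power2_eq_square)
  also have "\<dots> = ball_E (\<lambda>x. g x * g x) + 2 * t * P"
    using f g null by (simp add: ball_E_add ball_E_cmult P_def continuous_intros)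
  also have "\<dots> = - 1" using ne by (simp add: t_def P_def field_simps)
  finally show False by simp
qed

text \<open>
  A polynomial of norm \<open>0\<close> vanishes everywhere, not only on the ball, because the reproducing property
  holds at every point \<open>y\<close>.
\<close>

lemma poly_ball_E_pos:
  assumes f: "poly_deg_le n f" and null: "ball_E (\<lambda>x. f x * f x) = 0"
  shows "f = (\<lambda>x. 0)"
proof
  fix y
  have "ball_E (\<lambda>x. zonal_kernel m x y * f x) = 0" for m
    by (rule ball_E_null[OF _ _ null]) (use poly_deg_le_continuous[OF f] in \<open>auto intro!: continuous_intros\<close>)
  then show "f y = 0" using kernel_reproduces[OF f, of y] by simp
qed

lemma orth_poly_space_iff:
  "f \<in> orth_poly_space W n \<longleftrightarrow>
     poly_deg_le n f \<and> (\<forall>m g. m < n \<longrightarrow> poly_deg_le m g \<longrightarrow> ball_E (\<lambda>x. f x * g x) = 0)"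
proof
  assume "f \<in> orth_poly_space W n"
  then show "poly_deg_le n f \<and> (\<forall>m g. m < n \<longrightarrow> poly_deg_le m g \<longrightarrow> ball_E (\<lambda>x. f x * g x) = 0)"
    unfolding orth_poly_space_def poly_deg_less_def ball_inner_eq
    using poly_deg_le_const[of n 0] by (auto simp: ball_E_zero)
next
  assume *: "poly_deg_le n f \<and> (\<forall>m g. m < n \<longrightarrow> poly_deg_le m g \<longrightarrow> ball_E (\<lambda>x. f x * g x) = 0)"
  show "f \<in> orth_poly_space W n"
  proof (cases "poly_deg_less n f")
    case True
    then obtain m where "m < n" "poly_deg_le m f" unfolding poly_deg_less_def by blast
    then have "f = (\<lambda>x. 0)" using * poly_ball_E_pos by blast
    then show ?thesis by (simp add: orth_poly_space_def)
  next
    case False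
    then show ?thesis using * unfolding orth_poly_space_def poly_deg_less_def ball_inner_eq by blast
  qed
qed

lemma orth_poly_space_continuous: "f \<in> orth_poly_space W n \<Longrightarrow> continuous_on S f"
  using poly_deg_le_continuous orth_poly_space_iff by blast

text \<open>
  For \<open>g\<close> of smaller degree both the sum up to \<open>n - 1\<close> and the sum up to \<open>n\<close> in \<open>kernel_reproduces\<close> equal
  \<open>g y\<close>, so the last term of the latter vanishes.
\<close>

lemma kernel_in_orth_poly_space: "(\<lambda>x. zonal_kernel n x y) \<in> orth_poly_space W n"
  unfolding orth_poly_space_iff
proof (intro conjI allI impI poly_deg_le_kernel)
  fix m and g :: "real ^ 'd \<Rightarrow> real" assume m: "m < n" and g: "poly_deg_le m g"
  obtain k where n: "n = Suc k" using m by (cases n) auto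
  have "poly_deg_le k g" "poly_deg_le n g" using m n g by (auto intro: poly_deg_le_mono)
  from kernel_reproduces[OF this(1), of y] kernel_reproduces[OF this(2), of y]
  show "ball_E (\<lambda>x. zonal_kernel n x y * g x) = 0" by (simp add: n)
qed

lemma orth_poly_space_reproduces:
  assumes f: "f \<in> orth_poly_space W n"
  shows "ball_E (\<lambda>x. zonal_kernel n x y * f x) = f y"
proof -
  have low: "ball_E (\<lambda>x. zonal_kernel m x y * f x) = 0" if "m < n" for m
  proof -
    have "ball_E (\<lambda>x. zonal_kernel m x y * f x) = ball_E (\<lambda>x. f x * zonal_kernel m x y)"
      by (rule ball_E_cong) (rule mult.commute)
    also have "\<dots> = 0" using f that poly_deg_le_kernel[of m y] unfolding orth_poly_space_iff by blast
    finally show ?thesis .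
  qed
  have "f y = (\<Sum>m\<le>n. ball_E (\<lambda>x. zonal_kernel m x y * f x))"
    using f by (intro kernel_reproduces) (simp add: orth_poly_space_iff)
  also have "\<dots> = (\<Sum>m\<le>n. if m = n then ball_E (\<lambda>x. zonal_kernel n x y * f x) else 0)"
    by (intro sum.cong refl) (auto simp: low)
  finally show ?thesis by simp
qed

lemma orth_poly_space_add:
  assumes "f \<in> orth_poly_space W n" "g \<in> orth_poly_space W n"
  shows "(\<lambda>x. f x + g x) \<in> orth_poly_space W n"
  using assms unfolding orth_poly_space_iff
  by (auto simp: distrib_right poly_deg_le_add ball_E_add poly_deg_le_continuous continuous_intros)

lemma orth_poly_space_cmult:
  assumes "f \<in> orth_poly_space W n"
  shows "(\<lambda>x. c * f x) \<in> orth_poly_space W n"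
  using assms unfolding orth_poly_space_iff
  by (auto simp: mult.assoc poly_deg_le_cmult ball_E_cmult)

lemma orth_poly_space_sum:
  assumes "finite I" "\<And>i. i \<in> I \<Longrightarrow> f i \<in> orth_poly_space W n"
  shows "(\<lambda>x. \<Sum>i\<in>I. c i * f i x) \<in> orth_poly_space W n"
  using assms
proof (induction I rule: finite_induct)
  case empty
  show ?case by (simp add: orth_poly_space_def)
next
  case (insert i I)
  then show ?case by (simp add: orth_poly_space_add orth_poly_space_cmult)
qed

definition orthonormal_subset :: "nat \<Rightarrow> (real ^ 'd \<Rightarrow> real) set \<Rightarrow> bool" where
  "orthonormal_subset n B \<longleftrightarrow> finite B \<and> B \<subseteq> orth_poly_space W n \<and>
     (\<forall>p\<in>B. \<forall>q\<in>B. ball_E (\<lambda>x. p x * q x) = (if p = q then 1 else 0))"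

lemma orthonormal_coefficient:
  assumes B: "orthonormal_subset n B" and q: "q \<in> B"
  shows "ball_E (\<lambda>x. (\<Sum>p\<in>B. c p * p x) * q x) = c q"
proof -
  have fin: "finite B" and cont: "\<And>p. p \<in> B \<Longrightarrow> continuous_on (cball 0 1) p"
    using B orth_poly_space_continuous unfolding orthonormal_subset_def by blast+
  have "ball_E (\<lambda>x. (\<Sum>p\<in>B. c p * p x) * q x) = ball_E (\<lambda>x. \<Sum>p\<in>B. c p * (p x * q x))"
    by (simp add: sum_distrib_right mult.assoc)
  also have "\<dots> = (\<Sum>p\<in>B. c p * ball_E (\<lambda>x. p x * q x))"
    by (rule ball_E_sum[OF fin]) (use cont q in \<open>auto intro!: continuous_intros\<close>)
  also have "\<dots> = (\<Sum>p\<in>B. if p = q then c q else 0)"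
    by (intro sum.cong refl) (use B q in \<open>auto simp: orthonormal_subset_def\<close>)
  also have "\<dots> = c q" using fin q by simp
  finally show ?thesis .
qed

text \<open>
  Bessel's inequality for the kernel at \<open>y\<close>, whose coefficients are the values \<open>p y\<close>.
\<close>

lemma orthonormal_subset_bessel:
  assumes B: "orthonormal_subset n B"
  shows "(\<Sum>p\<in>B. p y * p y) \<le> zonal_kernel n y y"
proof -
  have fin: "finite B" and V: "B \<subseteq> orth_poly_space W n" and cont: "\<And>p. p \<in> B \<Longrightarrow> continuous_on (cball 0 1) p"
    using B orth_poly_space_continuous unfolding orthonormal_subset_def by blast+
  define s where "s x = (\<Sum>p\<in>B. p y * p x)" for x
  define K where "K x = zonal_kernel n x y" for x
  have cs: "continuous_on (cball 0 1) s" unfolding s_def using cont by (auto intro!: continuous_intros)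
  have cK: "continuous_on (cball 0 1) K" unfolding K_def by (intro continuous_intros)
  have sV: "s \<in> orth_poly_space W n"
    unfolding s_def[abs_def] by (rule orth_poly_space_sum[OF fin]) (use V in auto)
  have Ks: "ball_E (\<lambda>x. K x * s x) = (\<Sum>p\<in>B. p y * p y)"
    unfolding K_def orth_poly_space_reproduces[OF sV] by (simp add: s_def)
  have ss: "ball_E (\<lambda>x. s x * s x) = (\<Sum>p\<in>B. p y * p y)"
  proof -
    have "ball_E (\<lambda>x. s x * s x) = ball_E (\<lambda>x. \<Sum>q\<in>B. q y * (s x * q x))"
      by (rule ball_E_cong) (simp add: s_def[of x for x] sum_distrib_left sum_distrib_right mult_ac)
    also have "\<dots> = (\<Sum>q\<in>B. q y * ball_E (\<lambda>x. s x * q x))"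
      by (rule ball_E_sum[OF fin]) (use cont cs in \<open>auto intro!: continuous_intros\<close>)
    also have "\<dots> = (\<Sum>q\<in>B. q y * q y)"
      by (intro sum.cong refl) (simp add: s_def orthonormal_coefficient[OF B])
    finally show ?thesis .
  qed
  have KK: "ball_E (\<lambda>x. K x * K x) = zonal_kernel n y y" unfolding K_def ball_E_kernel by simp
  have "0 \<le> ball_E (\<lambda>x. (K x + (-1) * s x) * (K x + (-1) * s x))" by (rule ball_E_nonneg) simp
  also have "\<dots> = ball_E (\<lambda>x. K x * K x + ((-2) * (K x * s x) + s x * s x))"
    by (rule ball_E_cong) (simp add: algebra_simps)
  also have "\<dots> = ball_E (\<lambda>x. K x * K x) + ((-2) * ball_E (\<lambda>x. K x * s x) + ball_E (\<lambda>x. s x * s x))"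
    unfolding ball_E_cmult[symmetric]
    by (rule trans[OF ball_E_add arg_cong2[of _ _ _ _ "(+)", OF refl ball_E_add]])
       (use cs cK in \<open>auto intro!: continuous_intros\<close>)
  finally show ?thesis unfolding Ks ss KK by simp
qed

lemma orthonormal_subset_card_le:
  assumes B: "orthonormal_subset n B"
  shows "real (card B) \<le> ball_E (\<lambda>y. zonal_kernel n y y)"
proof -
  have fin: "finite B" and cont: "\<And>p. p \<in> B \<Longrightarrow> continuous_on (cball 0 1) p"
    using B orth_poly_space_continuous unfolding orthonormal_subset_def by blast+
  have cK: "continuous_on (cball 0 1) (\<lambda>y. zonal_kernel n y y)"
    unfolding zonal_kernel_def zpow_def zeta_power_def mixed_power_def by (intro continuous_intros) auto
  have "real (card B) = (\<Sum>p\<in>B. 1 * ball_E (\<lambda>y. p y * p y))"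
    using B by (simp add: orthonormal_subset_def)
  also have "\<dots> = ball_E (\<lambda>y. \<Sum>p\<in>B. 1 * (p y * p y))"
    by (rule ball_E_sum[OF fin, symmetric]) (use cont in \<open>auto intro!: continuous_intros\<close>)
  finally have card: "real (card B) = ball_E (\<lambda>y. \<Sum>p\<in>B. p y * p y)" by simp
  have "0 \<le> ball_E (\<lambda>y. zonal_kernel n y y + (-1) * (\<Sum>p\<in>B. p y * p y))"
    by (rule ball_E_nonneg) (use orthonormal_subset_bessel[OF B] in simp)
  also have "\<dots> = ball_E (\<lambda>y. zonal_kernel n y y) + (-1) * ball_E (\<lambda>y. \<Sum>p\<in>B. p y * p y)"
    unfolding ball_E_cmult[symmetric] by (rule ball_E_add) (use cont cK in \<open>auto intro!: continuous_intros\<close>)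
  finally show ?thesis unfolding card by simp
qed

text \<open>
  Integrating Bessel's inequality bounds the size of orthonormal sets, so there is one of maximal size.
  It spans: otherwise the normalized remainder of some polynomial could be added to it.
\<close>

lemma orthonormal_basis_exists: "\<exists>B. orthonormal_basis W n B"
proof -
  define N where "N = nat \<lceil>ball_E (\<lambda>y. zonal_kernel n y y)\<rceil>"
  have le: "card B \<le> N" if "orthonormal_subset n B" for B
    using orthonormal_subset_card_le[OF that] unfolding N_def by linarith
  have "orthonormal_subset n {}" by (simp add: orthonormal_subset_def)
  then obtain B where B: "orthonormal_subset n B" and max: "\<And>C. orthonormal_subset n C \<Longrightarrow> card C \<le> card B"
    using ex_has_greatest_nat[of "orthonormal_subset n" "{}" card "Suc N"] le by (auto simp: less_Suc_eq_le)
  have fin: "finite B" and V: "B \<subseteq> orth_poly_space W n" and cont: "\<And>p. p \<in> B \<Longrightarrow> continuous_on (cball 0 1) p"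
    using B orth_poly_space_continuous unfolding orthonormal_subset_def by blast+
  have "\<exists>c. f = (\<lambda>x. \<Sum>p\<in>B. c p * p x)" if f: "f \<in> orth_poly_space W n" for f
  proof -
    define c where "c p = ball_E (\<lambda>x. f x * p x)" for p
    define r where "r x = f x + (-1) * (\<Sum>p\<in>B. c p * p x)" for x
    have rV: "r \<in> orth_poly_space W n"
      unfolding r_def[abs_def]
      by (intro orth_poly_space_add orth_poly_space_cmult orth_poly_space_sum fin f) (use V in auto)
    have cr: "continuous_on (cball 0 1) r" by (rule orth_poly_space_continuous[OF rV])
    have rq: "ball_E (\<lambda>x. r x * q x) = 0" if q: "q \<in> B" for q
    proof -
      have "ball_E (\<lambda>x. r x * q x) = ball_E (\<lambda>x. f x * q x + (-1) * ((\<Sum>p\<in>B. c p * p x) * q x))"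
        by (rule ball_E_cong) (simp add: r_def algebra_simps)
      also have "\<dots> = ball_E (\<lambda>x. f x * q x) + (-1) * ball_E (\<lambda>x. (\<Sum>p\<in>B. c p * p x) * q x)"
        unfolding ball_E_cmult[symmetric]
        by (rule ball_E_add) (use cont q orth_poly_space_continuous[OF f] in \<open>auto intro!: continuous_intros\<close>)
      also have "\<dots> = 0" unfolding orthonormal_coefficient[OF B q] by (simp add: c_def)
      finally show ?thesis .
    qed
    have "r = (\<lambda>x. 0)"
    proof (rule ccontr)
      assume ne: "r \<noteq> (\<lambda>x. 0)"
      define S where "S = ball_E (\<lambda>x. r x * r x)"
      have "S \<noteq> 0" using ne rV poly_ball_E_pos unfolding S_def orth_poly_space_iff by blast
      moreover have "S \<ge> 0" unfolding S_def by (rule ball_E_nonneg) simp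
      ultimately have S: "S > 0" by simp
      define q where "q x = (1 / sqrt S) * r x" for x
      have qV: "q \<in> orth_poly_space W n" unfolding q_def[abs_def] by (rule orth_poly_space_cmult[OF rV])
      have qq: "ball_E (\<lambda>x. q x * q x) = 1"
      proof -
        have "ball_E (\<lambda>x. q x * q x) = ball_E (\<lambda>x. (1 / S) * (r x * r x))"
          by (rule ball_E_cong) (use S in \<open>simp add: q_def\<close>)
        then show ?thesis unfolding ball_E_cmult using S by (simp add: S_def)
      qed
      have qp: "ball_E (\<lambda>x. q x * p x) = 0" if "p \<in> B" for p
        unfolding q_def mult.assoc ball_E_cmult rq[OF that] by simp
      then have "q \<notin> B" using qq by force
      moreover have "orthonormal_subset n (insert q B)"
        using B qV qq qp \<open>q \<notin> B\<close> unfolding orthonormal_subset_def by (auto simp: mult.commute)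
      ultimately show False using max[of "insert q B"] fin by simp
    qed
    then have "f = (\<lambda>x. \<Sum>p\<in>B. c p * p x)" by (auto simp: r_def fun_eq_iff)
    then show ?thesis by blast
  qed
  then have "orthonormal_basis W n B"
    using B unfolding orthonormal_basis_def orthonormal_subset_def ball_inner_eq by blast
  then show ?thesis by blast
qed

theorem repr_kernel_eq: "repr_kernel W n x y = zonal_kernel n x y"
proof -
  have eq: "(\<Sum>p\<in>B. p x * p y) = zonal_kernel n x y" if B: "orthonormal_basis W n B" for B
  proof -
    have B': "orthonormal_subset n B" using B unfolding orthonormal_basis_def orthonormal_subset_def ball_inner_eq by blast
    obtain c where c: "(\<lambda>x. zonal_kernel n x y) = (\<lambda>x. \<Sum>p\<in>B. c p * p x)"
      using B kernel_in_orth_poly_space[of n y] unfolding orthonormal_basis_def by blast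
    have "c q = q y" if q: "q \<in> B" for q
    proof -
      have "q \<in> orth_poly_space W n" using B q unfolding orthonormal_basis_def by blast
      then have "q y = ball_E (\<lambda>x. zonal_kernel n x y * q x)" by (simp add: orth_poly_space_reproduces)
      also have "\<dots> = ball_E (\<lambda>x. (\<Sum>p\<in>B. c p * p x) * q x)" using fun_cong[OF c] by simp
      also have "\<dots> = c q" by (rule orthonormal_coefficient[OF B' q])
      finally show ?thesis ..
    qed
    then show ?thesis using fun_cong[OF c, of x] by (simp add: mult.commute)
  qed
  obtain B where "orthonormal_basis W n B" using orthonormal_basis_exists by blast
  then show ?thesis unfolding repr_kernel_def
    using eq by (intro the_equality) auto
qed

end

section \<open>Identification of the Gegenbauer polynomials\<close>

lemma set_integral_sum_mult:
  fixes f :: "'i \<Rightarrow> real \<Rightarrow> real"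
  assumes "finite S" "\<And>s. s \<in> S \<Longrightarrow> set_integrable M A (\<lambda>x. f s x * w x)"
  shows "(LINT x:A|M. (\<Sum>s\<in>S. e s * f s x) * w x) = (\<Sum>s\<in>S. e s * (LINT x:A|M. f s x * w x))"
proof -
  have "(LINT x:A|M. (\<Sum>s\<in>S. e s * f s x) * w x) = (LINT x|M. (\<Sum>s\<in>S. e s * (indicator A x *\<^sub>R (f s x * w x))))"
    unfolding set_lebesgue_integral_def
    by (rule Bochner_Integration.integral_cong) (auto simp: sum_distrib_left sum_distrib_right mult_ac)
  also have "\<dots> = (\<Sum>s\<in>S. LINT x|M. e s * (indicator A x *\<^sub>R (f s x * w x)))"
    by (rule Bochner_Integration.integral_sum)
       (use assms in \<open>auto simp: set_integrable_def intro!: Bochner_Integration.integrable_mult_right\<close>)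
  finally show ?thesis by (simp add: set_lebesgue_integral_def)
qed

lemma divided_power_add:
  "(a + b :: real) ^ n / fact n = (\<Sum>k\<le>n. (b ^ k / fact k) * (a ^ (n - k) / fact (n - k)))"
proof -
  have "(a + b) ^ n = (\<Sum>k\<le>n. real (n choose k) * b ^ k * a ^ (n - k))"
    using binomial_ring[of b a n] by (simp add: add.commute)
  then show ?thesis
    unfolding sum_divide_distrib by (auto simp: sum_divide_distrib binomial_fact intro!: sum.cong)
qed

text \<open>
  The value \<open>Z\<^sub>n\<^sup>\<nu>(1)\<close>, which the normalization of the Gegenbauer polynomials requires in closed form.
  The next lemmas contain the differential equation
  \<open>(1 - t\<^sup>2) Z'' - (2 \<nu> + 1) t Z' + n (n + 2 \<nu>) Z = 0\<close> and the derivative of \<open>Z\<^sub>n\<^sup>\<nu>\<close>, which is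
  \<open>2 (\<nu> + 1)\<close> times \<open>Z\<^sub>n\<^sub>-\<^sub>1\<close> of index \<open>\<nu> + 1\<close>, on the level of coefficients.  At \<open>t = 1\<close> the second derivative
  drops out, and a recursion in \<open>n\<close> remains.
\<close>

definition zonal_at_one :: "real \<Rightarrow> nat \<Rightarrow> real" where
  "zonal_at_one \<nu> n = (\<Sum>i\<le>n. zonal_coeff \<nu> n i * (1 / fact i))"

lemma zonal_coeff_closed:
  assumes "n \<ge> 1"
  shows "zonal_coeff \<nu> n i = half_fact n i * (-1) ^ ((n - i) div 2) * 2 ^ i * (real n + \<nu>) * pochhammer (\<nu> + 1) ((n + i) div 2 - 1)"
proof (cases n i rule: half_fact_cases)
  case 1 then show ?thesis by (simp add: zonal_coeff_def)
next
  case (2 a)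
  obtain M where M: "i + a = Suc M" using 2(1) assms by (cases "i + a") auto
  have e: "(n + i) div 2 = Suc M" "(n - i) div 2 = a" "real n + \<nu> = \<nu> + 1 + real M + real a"
    using 2(1) M by auto
  show ?thesis unfolding zonal_coeff_def e pochhammer_Suc by (simp add: algebra_simps)
qed

lemma zonal_coeff_ode:
  assumes "n \<ge> 1"
  shows "zonal_coeff \<nu> n (i + 2) + (real n * (real n + 2 * \<nu>) - real i * (real i + 2 * \<nu>)) * zonal_coeff \<nu> n i = 0"
proof (cases n i rule: half_fact_cases)
  case 1
  have "half_fact n (i + 2) = 0"
  proof (cases n "i + 2" rule: half_fact_cases)
    case (2 a)
    then have "n = i + 2 * Suc a" by simp
    with 1 show ?thesis by blast
  qed
  with 1 show ?thesis by (simp add: zonal_coeff_def)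
next
  case (2 a)
  show ?thesis
  proof (cases a)
    case 0
    then show ?thesis using 2 by (simp add: zonal_coeff_def)
  next
    case (Suc b)
    have n: "n = (i + 2) + 2 * b" using 2 Suc by simp
    have e: "(n + (i + 2)) div 2 = Suc (Suc (i + b))" "(n - (i + 2)) div 2 = b"
      "(n + i) div 2 = Suc (i + b)" "(n - i) div 2 = Suc b" "half_fact n i = 1 / fact (Suc b)"
      using 2 Suc n by auto
    have h: "half_fact n (i + 2) = 1 / fact b" unfolding n by (rule half_fact_simps(1))
    have "real n * (real n + 2 * \<nu>) - real i * (real i + 2 * \<nu>) = 4 * real (Suc b) * (\<nu> + 1 + real (i + b))"
      unfolding n by (simp add: algebra_simps)
    moreover have "fact (Suc b) = real (Suc b) * (fact b :: real)" by simp
    ultimately show ?thesis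
      unfolding zonal_coeff_closed[OF assms] e h diff_Suc_1 pochhammer_Suc
      by (simp add: field_simps del: fact_Suc of_nat_Suc)
  qed
qed

lemma zonal_coeff_derivative: "zonal_coeff \<nu> (Suc n) (Suc i) = 2 * (\<nu> + 1) * zonal_coeff (\<nu> + 1) n i"
proof (cases n i rule: half_fact_cases)
  case 1
  have "half_fact (Suc n) (Suc i) = half_fact n i" by (auto simp: half_fact_def)
  then show ?thesis using 1 by (simp add: zonal_coeff_def)
next
  case (2 a)
  have h: "half_fact (Suc n) (Suc i) = half_fact n i" by (auto simp: half_fact_def)
  have e: "(Suc n + Suc i) div 2 = Suc (i + a)" "(Suc n - Suc i) div 2 = a" "(n + i) div 2 = i + a" "(n - i) div 2 = a"
    using 2 by auto
  have p: "pochhammer (\<nu> + 1) (Suc k) = (\<nu> + 1) * pochhammer (\<nu> + 1 + 1) k" for k by (rule pochhammer_rec)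
  show ?thesis
  proof (cases a)
    case 0
    then show ?thesis unfolding zonal_coeff_def h e p by simp
  next
    case (Suc b)
    then obtain k where k: "i + a = Suc k" by simp
    show ?thesis unfolding zonal_coeff_def h e k diff_Suc_1 p by (simp add: algebra_simps)
  qed
qed

lemma zonal_at_one_rec:
  "real (Suc n) * (real (Suc n) + 2 * \<nu>) * zonal_at_one \<nu> (Suc n) = (2 * \<nu> + 1) * (2 * (\<nu> + 1)) * zonal_at_one (\<nu> + 1) n"
proof -
  let ?z = "zonal_coeff \<nu> (Suc n)"
  let ?N = "Suc n"
  have shift: "(\<Sum>i\<le>?N. real i * (g i / fact i)) = (\<Sum>i\<le>n. g (Suc i) / fact i)" for g :: "nat \<Rightarrow> real"
    by (subst sum.atMost_Suc_shift) (simp add: field_simps del: of_nat_Suc)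
  have D1: "(\<Sum>i\<le>?N. real i * (?z i / fact i)) = 2 * (\<nu> + 1) * zonal_at_one (\<nu> + 1) n"
    unfolding shift zonal_coeff_derivative zonal_at_one_def by (simp add: sum_distrib_left)
  have D2: "(\<Sum>i\<le>?N. real i * (real i - 1) * (?z i / fact i)) = (\<Sum>i\<le>?N. ?z (i + 2) / fact i)"
  proof -
    have "(\<Sum>i\<le>?N. real i * (real i - 1) * (?z i / fact i)) = (\<Sum>i\<le>?N. real i * (((real i - 1) * ?z i) / fact i))"
      by (simp add: mult.assoc)
    also have "\<dots> = (\<Sum>i\<le>n. real i * (?z (Suc i) / fact i))" unfolding shift by simp
    also have "\<dots> = (\<Sum>i\<le>?N. real i * (?z (Suc i) / fact i))"
      by (rule sum_atMost_extend) (auto simp: zonal_coeff_eq_0)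
    also have "\<dots> = (\<Sum>i\<le>n. ?z (Suc (Suc i)) / fact i)" by (rule shift)
    also have "\<dots> = (\<Sum>i\<le>?N. ?z (Suc (Suc i)) / fact i)"
      by (rule sum_atMost_extend) (auto simp: zonal_coeff_eq_0)
    finally show ?thesis by simp
  qed
  have "0 = (\<Sum>i\<le>?N. (?z (i + 2) + (real ?N * (real ?N + 2 * \<nu>) - real i * (real i + 2 * \<nu>)) * ?z i) / fact i)"
    using zonal_coeff_ode[of ?N \<nu>] by simp
  also have "\<dots> = (\<Sum>i\<le>?N. ?z (i + 2) / fact i + real ?N * (real ?N + 2 * \<nu>) * (?z i * (1 / fact i))
       - real i * (real i - 1) * (?z i / fact i) - (2 * \<nu> + 1) * (real i * (?z i / fact i)))"
    by (intro sum.cong refl) (simp add: algebra_simps add_divide_distrib diff_divide_distrib)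
  also have "\<dots> = (\<Sum>i\<le>?N. ?z (i + 2) / fact i) + real ?N * (real ?N + 2 * \<nu>) * zonal_at_one \<nu> ?N
       - (\<Sum>i\<le>?N. real i * (real i - 1) * (?z i / fact i)) - (2 * \<nu> + 1) * (\<Sum>i\<le>?N. real i * (?z i / fact i))"
    unfolding zonal_at_one_def sum_distrib_left sum_subtractf sum.distrib ..
  finally show ?thesis unfolding D1 D2 by simp
qed

lemma zonal_at_one_eq:
  assumes "\<nu> > 0"
  shows "zonal_at_one \<nu> n = (real n + \<nu>) / \<nu> * (pochhammer (2 * \<nu>) n / fact n)"
  using assms
proof (induction n arbitrary: \<nu>)
  case 0
  then show ?case by (simp add: zonal_at_one_def zonal_coeff_def)
next
  case (Suc n)
  have IH: "zonal_at_one (\<nu> + 1) n = (real n + (\<nu> + 1)) / (\<nu> + 1) * (pochhammer (2 * (\<nu> + 1)) n / fact n)"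
    using Suc.prems by (intro Suc.IH) simp
  have P: "pochhammer (2 * \<nu>) (Suc n) * (2 * \<nu> + real (Suc n)) = 2 * \<nu> * ((2 * \<nu> + 1) * pochhammer (2 * (\<nu> + 1)) n)"
  proof -
    have "pochhammer (2 * \<nu>) (Suc n) * (2 * \<nu> + real (Suc n)) = pochhammer (2 * \<nu>) (Suc (Suc n))"
      by (simp only: pochhammer_Suc)
    also have "\<dots> = 2 * \<nu> * ((2 * \<nu> + 1) * pochhammer (2 * \<nu> + 1 + 1) n)" by (simp only: pochhammer_rec)
    finally show ?thesis by (simp add: algebra_simps)
  qed
  define X where "X = real (Suc n) * (real (Suc n) + 2 * \<nu>)"
  have X: "X > 0" unfolding X_def using Suc.prems by (intro mult_pos_pos) auto
  have f: "fact (Suc n) = real (Suc n) * (fact n :: real)" by simp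
  have "X * zonal_at_one \<nu> (Suc n) = (2 * \<nu> + 1) * (2 * (\<nu> + 1)) * ((real n + (\<nu> + 1)) / (\<nu> + 1) * (pochhammer (2 * (\<nu> + 1)) n / fact n))"
    unfolding X_def zonal_at_one_rec IH ..
  also have "\<dots> = 2 * (real (Suc n) + \<nu>) * ((2 * \<nu> + 1) * pochhammer (2 * (\<nu> + 1)) n) / fact n"
  proof -
    have "(2 * \<nu> + 1) * (2 * u) * (r / u * (P / F)) = 2 * r * ((2 * \<nu> + 1) * P) / F" if "u \<noteq> 0" for u r P F :: real
      using that by simp
    moreover have "\<nu> + 1 \<noteq> 0" "real n + (\<nu> + 1) = real (Suc n) + \<nu>" using Suc.prems by simp_all
    ultimately show ?thesis by metis
  qed
  also have "\<dots> = (real (Suc n) + \<nu>) / \<nu> * (2 * \<nu> * ((2 * \<nu> + 1) * pochhammer (2 * (\<nu> + 1)) n)) / fact n"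
    using Suc.prems by simp
  also have "\<dots> = (real (Suc n) + \<nu>) / \<nu> * (pochhammer (2 * \<nu>) (Suc n) * (2 * \<nu> + real (Suc n))) / fact n"
    unfolding P ..
  also have "\<dots> = X * ((real (Suc n) + \<nu>) / \<nu> * (pochhammer (2 * \<nu>) (Suc n) / fact (Suc n)))"
    unfolding X_def f by (simp add: add.commute del: of_nat_Suc fact_Suc)
  finally show ?case by (rule mult_left_cancel[THEN iffD1, rotated]) (use X in simp)
qed

lemma zonal_at_one_pos: "\<nu> > 0 \<Longrightarrow> zonal_at_one \<nu> n > 0"
  unfolding zonal_at_one_eq by (intro mult_pos_pos divide_pos_pos pochhammer_pos) auto

text \<open>
  The moments of the weight are the values at \<open>1\<close> of the convolutions of \<open>t\<^sup>n / n!\<close> and \<open>t\<^sup>m / m!\<close>: this is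
  the trinomial expansion at \<open>s = 1\<close>, where \<open>1 + 2 \<tau> + \<tau>\<^sup>2 = (1 + \<tau>)\<^sup>2\<close>.  Orthogonality of the \<open>Z\<^sub>k\<close> is
  therefore another instance of the diagonality of the convolution.
\<close>

lemma even_moment_convolution:
  "even_moment \<nu> (n + m) / (fact n * fact m) = (\<Sum>K\<le>n. conv_coeff \<nu> n m K * (1 / fact K))"
proof (cases "even (n + m)")
  case False
  have "conv_coeff \<nu> n m K = 0" for K
    using False by (cases n K rule: half_fact_cases; cases m K rule: half_fact_cases) (auto simp: conv_coeff_def)
  then show ?thesis using False by (simp add: even_moment_def)
next
  case True
  then obtain p where p: "n + m = 2 * p" by (rule evenE)
  define S where "S = (\<Sum>K\<le>m. 2 ^ K / fact K * half_fact n K * half_fact m K)"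
  have S: "S = (\<Sum>K\<le>n. 2 ^ K / fact K * half_fact n K * half_fact m K)"
    unfolding S_def by (rule trans[OF sum_atMost_extend[where m = "n + m"] sum_atMost_extend[symmetric]]) auto
  let ?b = "\<lambda>m. fact p * (\<Sum>K\<le>m. (2 * 1) ^ K / fact K * half_fact (2 * p - m) K * half_fact m K)"
  have "(\<Sum>m\<le>2 * p. real ((2 * p) choose m) * \<tau> ^ m) = (\<Sum>m\<le>2 * p. ?b m * \<tau> ^ m)" for \<tau> :: real
  proof -
    have "(\<Sum>m\<le>2 * p. real ((2 * p) choose m) * \<tau> ^ m) = (\<tau> + 1) ^ (2 * p)"
      using binomial_ring[of \<tau> 1 "2 * p"] by simp
    also have "\<dots> = ((\<tau> + 1)\<^sup>2) ^ p" by (rule power_mult)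
    also have "(\<tau> + 1)\<^sup>2 = 1 + 2 * 1 * \<tau> + \<tau>\<^sup>2" by (simp add: power2_sum)
    finally show ?thesis unfolding trinomial_expansion .
  qed
  then have *: "\<forall>m\<le>2 * p. real ((2 * p) choose m) = ?b m" by (rule polyfun_eq_coeffs[THEN iffD1, OF allI])
  have mp: "m \<le> 2 * p" "2 * p - m = n" using p by auto
  have "real ((2 * p) choose m) = ?b m" using * mp by blast
  then have "real ((2 * p) choose m) = fact p * S" unfolding S_def mp(2) by simp
  moreover have "real ((2 * p) choose m) = fact (2 * p) / (fact m * fact n)"
    using binomial_fact[OF mp(1)] mp(2) by simp
  ultimately have "fact (2 * p) / (fact m * fact n) = fact p * S" by simp
  then have "pochhammer (1/2) p / (fact n * fact m) = S / 2 ^ (2 * p)"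
    unfolding fact_double[of p, where 'a = real] by (simp add: field_simps)
  moreover have "even_moment \<nu> (n + m) / (fact n * fact m) = pochhammer (1/2) p / (fact n * fact m) / pochhammer (\<nu> + 1) p"
    by (simp add: even_moment_def p)
  ultimately have "even_moment \<nu> (n + m) / (fact n * fact m) = S / (2 ^ (2 * p) * pochhammer (\<nu> + 1) p)"
    by simp
  also have "\<dots> = (\<Sum>K\<le>n. conv_coeff \<nu> n m K * (1 / fact K))"
    unfolding S conv_coeff_def p sum_divide_distrib by (intro sum.cong refl) (simp add: mult_ac)
  finally show ?thesis .
qed

lemma zonal_moment:
  assumes "\<nu> \<ge> 0"
  shows "(\<Sum>i\<le>n. zonal_coeff \<nu> n i * (even_moment \<nu> (i + m) / (fact i * fact m))) = expand_coeff \<nu> m n * zonal_at_one \<nu> n"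
proof -
  define g where "g j = (\<Sum>i\<le>n. zonal_coeff \<nu> n i * (even_moment \<nu> (i + j) / (fact i * fact j)))" for j
  have "(\<Sum>j\<le>l. zonal_coeff \<nu> l j * g j) = (if n = l then zonal_at_one \<nu> n else 0)" for l
  proof -
    have "(\<Sum>j\<le>l. zonal_coeff \<nu> l j * g j) =
       (\<Sum>i\<le>n. \<Sum>j\<le>l. zonal_coeff \<nu> n i * zonal_coeff \<nu> l j * (even_moment \<nu> (i + j) / (fact i * fact j)))"
      unfolding g_def sum_distrib_left by (subst sum.swap) (simp add: mult_ac)
    also have "\<dots> = (if n = l then zonal_at_one \<nu> n else 0)"
      unfolding zonal_at_one_def by (rule zonal_convolution[OF assms even_moment_convolution])
    finally show ?thesis .
  qed
  then have "g m = (\<Sum>l\<le>m. expand_coeff \<nu> m l * (if n = l then zonal_at_one \<nu> n else 0))"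
    using zonal_transform_inverse[OF assms, of m g] by simp
  also have "\<dots> = (\<Sum>l\<le>m. if n = l then expand_coeff \<nu> m n * zonal_at_one \<nu> n else 0)"
    by (intro sum.cong refl) auto
  also have "\<dots> = expand_coeff \<nu> m n * zonal_at_one \<nu> n" by (auto simp: expand_coeff_eq_0)
  finally show ?thesis by (simp add: g_def)
qed

definition zonal_poly :: "real \<Rightarrow> nat \<Rightarrow> real poly" where
  "zonal_poly \<nu> n = (\<Sum>i\<le>n. monom (zonal_coeff \<nu> n i / fact i) i)"

lemma poly_zonal_poly: "poly (zonal_poly \<nu> n) t = (\<Sum>i\<le>n. zonal_coeff \<nu> n i * (t ^ i / fact i))"
  by (simp add: zonal_poly_def poly_sum poly_monom)

lemma coeff_zonal_poly: "coeff (zonal_poly \<nu> n) i = zonal_coeff \<nu> n i / fact i"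
  by (auto simp: zonal_poly_def coeff_sum zonal_coeff_eq_0 not_le)

lemma degree_zonal_poly:
  assumes "\<nu> \<ge> 0" shows "degree (zonal_poly \<nu> n) = n"
proof (rule antisym)
  show "degree (zonal_poly \<nu> n) \<le> n"
    by (rule degree_le) (simp add: coeff_zonal_poly zonal_coeff_eq_0)
  have "zonal_coeff \<nu> n n \<noteq> 0"
    using pochhammer_ne_0[of "\<nu> + 1" n] assms by (simp add: zonal_coeff_def)
  then show "n \<le> degree (zonal_poly \<nu> n)" by (intro le_degree) (simp add: coeff_zonal_poly)
qed

lemma poly_eq_zonal_sum:
  assumes "\<nu> \<ge> 0" "degree p \<le> n"
  shows "poly p t = (\<Sum>k\<le>n. (\<Sum>j\<le>n. coeff p j * fact j * expand_coeff \<nu> j k) * poly (zonal_poly \<nu> k) t)"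
proof -
  have "poly p t = (\<Sum>j\<le>n. coeff p j * t ^ j)"
    unfolding poly_altdef by (rule sum_atMost_extend) (use assms(2) in \<open>auto simp: coeff_eq_0\<close>)
  also have "\<dots> = (\<Sum>j\<le>n. coeff p j * fact j * (t ^ j / fact j))" by simp
  also have "\<dots> = (\<Sum>j\<le>n. coeff p j * fact j * (\<Sum>k\<le>j. expand_coeff \<nu> j k * poly (zonal_poly \<nu> k) t))"
    unfolding poly_zonal_poly zonal_transform_inverse[OF assms(1)] ..
  also have "\<dots> = (\<Sum>j\<le>n. coeff p j * fact j * (\<Sum>k\<le>n. expand_coeff \<nu> j k * poly (zonal_poly \<nu> k) t))"
    by (intro sum.cong refl arg_cong2[of _ _ _ _ "(*)"] sum_atMost_extend) (auto simp: expand_coeff_eq_0)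
  also have "\<dots> = (\<Sum>k\<le>n. (\<Sum>j\<le>n. coeff p j * fact j * expand_coeff \<nu> j k) * poly (zonal_poly \<nu> k) t)"
    unfolding sum_distrib_left sum_distrib_right by (subst sum.swap) (simp add: mult_ac)
  finally show ?thesis .
qed

lemma set_integrable_poly_weight:
  assumes "\<alpha> > (-1/2::real)" "continuous_on {-1..1} g"
  shows "set_integrable lborel {-1..1} (\<lambda>t. g t * (1 - t\<^sup>2) powr (\<alpha> - 1/2))"
  by (rule set_integrable_continuous_mult[OF set_integrable_symmetric_weight]) (use assms in auto)

definition weight_mass :: "real \<Rightarrow> real" where
  "weight_mass \<alpha> = (LINT t:{-1..1}|lborel. (1 - t\<^sup>2) powr (\<alpha> - 1/2))"

lemma weight_mass_pos: "\<alpha> > -1/2 \<Longrightarrow> weight_mass \<alpha> > 0"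
  unfolding weight_mass_def by (rule symmetric_weight_integral_pos)

lemma zonal_inner:
  assumes nu: "\<nu> \<ge> 0" and deg: "degree p \<le> n"
  shows "(LINT t:{-1<..<1}|lborel. poly p t * poly (zonal_poly \<nu> k) t * (1 - t\<^sup>2) powr (\<nu> - 1/2)) =
    weight_mass \<nu> * zonal_at_one \<nu> k * (\<Sum>j\<le>n. coeff p j * fact j * expand_coeff \<nu> j k)"
proof -
  let ?w = "\<lambda>t::real. (1 - t\<^sup>2) powr (\<nu> - 1/2)"
  have nu': "\<nu> > -1/2" using nu by simp
  have "(LINT t:{-1<..<1}|lborel. poly p t * poly (zonal_poly \<nu> k) t * ?w t) =
        (LINT t:{-1..1}|lborel. poly p t * poly (zonal_poly \<nu> k) t * ?w t)"
    unfolding set_lebesgue_integral_def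
    by (rule integral_discrete_difference[where X = "{-1, 1}"]) (auto simp: indicator_def)
  also have "\<dots> = (LINT t:{-1..1}|lborel. (\<Sum>s\<in>{..n} \<times> {..k}. (coeff p (fst s) * zonal_coeff \<nu> k (snd s) / fact (snd s)) * t ^ (fst s + snd s)) * ?w t)"
  proof (rule set_lebesgue_integral_cong)
    show "\<forall>t. t \<in> {- 1..1} \<longrightarrow> poly p t * poly (zonal_poly \<nu> k) t * ?w t =
       (\<Sum>s\<in>{..n} \<times> {..k}. (coeff p (fst s) * zonal_coeff \<nu> k (snd s) / fact (snd s)) * t ^ (fst s + snd s)) * ?w t"
    proof (intro allI impI)
      fix t :: real
      have "poly p t = (\<Sum>j\<le>n. coeff p j * t ^ j)"
        unfolding poly_altdef by (rule sum_atMost_extend) (use deg in \<open>auto simp: coeff_eq_0\<close>)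
      then have "poly p t * poly (zonal_poly \<nu> k) t = (\<Sum>j\<le>n. \<Sum>i\<le>k. (coeff p j * zonal_coeff \<nu> k i / fact i) * t ^ (j + i))"
        unfolding poly_zonal_poly by (simp only: sum_product) (simp add: power_add mult_ac)
      then show "poly p t * poly (zonal_poly \<nu> k) t * ?w t =
       (\<Sum>s\<in>{..n} \<times> {..k}. (coeff p (fst s) * zonal_coeff \<nu> k (snd s) / fact (snd s)) * t ^ (fst s + snd s)) * ?w t"
        by (simp add: sum.cartesian_product case_prod_beta)
    qed
  qed simp
  also have "\<dots> = (\<Sum>s\<in>{..n} \<times> {..k}. (coeff p (fst s) * zonal_coeff \<nu> k (snd s) / fact (snd s)) * (LINT t:{-1..1}|lborel. t ^ (fst s + snd s) * ?w t))"
    by (rule set_integral_sum_mult) (auto intro!: set_integrable_poly_weight nu' continuous_intros)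
  also have "\<dots> = (\<Sum>j\<le>n. \<Sum>i\<le>k. (coeff p j * zonal_coeff \<nu> k i / fact i) * (weight_mass \<nu> * even_moment \<nu> (j + i)))"
    unfolding symmetric_weight_moment[OF nu'] weight_mass_def
    by (simp add: sum.cartesian_product case_prod_beta)
  also have "\<dots> = (\<Sum>j\<le>n. weight_mass \<nu> * (coeff p j * fact j) * (\<Sum>i\<le>k. zonal_coeff \<nu> k i * (even_moment \<nu> (i + j) / (fact i * fact j))))"
    unfolding sum_distrib_left by (intro sum.cong refl) (simp add: add.commute)
  also have "\<dots> = weight_mass \<nu> * zonal_at_one \<nu> k * (\<Sum>j\<le>n. coeff p j * fact j * expand_coeff \<nu> j k)"
    unfolding zonal_moment[OF nu] sum_distrib_left by (simp add: mult_ac)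
  finally show ?thesis .
qed

text \<open>
  A polynomial of degree \<open>n\<close> that is orthogonal to all lower degrees has only one nonzero coefficient in
  its expansion in the \<open>Z\<^sub>k\<close>, since \<open>Z\<^sub>k(1) > 0\<close> is, up to the mass of the weight, the square norm of
  \<open>Z\<^sub>k\<close>.  Its value at \<open>1\<close> then determines it.
\<close>

lemma gegenbauer_eq:
  assumes nu: "\<nu> > 0"
  shows "gegenbauer n \<nu> = smult (\<nu> / (real n + \<nu>)) (zonal_poly \<nu> n)" (is "_ = ?G")
  unfolding gegenbauer_def
proof (rule the_equality)
  have c: "\<nu> / (real n + \<nu>) \<noteq> 0" using nu by simp
  have nu0: "\<nu> \<ge> 0" using nu by simp
  have one: "poly ?G 1 = (real n + 2 * \<nu> - 1) gchoose n"
  proof -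
    have "poly (zonal_poly \<nu> n) 1 = zonal_at_one \<nu> n" by (simp add: poly_zonal_poly zonal_at_one_def)
    moreover have "real n + \<nu> \<noteq> 0" using nu by linarith
    ultimately show ?thesis using nu
      by (simp add: zonal_at_one_eq[OF nu] gbinomial_pochhammer')
  qed
  show "degree ?G = n \<and>
     (\<forall>q. degree q < n \<longrightarrow> (LINT t:{-1<..<1}|lborel. poly ?G t * poly q t * (1 - t\<^sup>2) powr (\<nu> - 1 / 2)) = 0) \<and>
     poly ?G 1 = (real n + 2 * \<nu> - 1) gchoose n"
  proof (intro conjI allI impI one)
    show "degree ?G = n"
      using c degree_zonal_poly[OF nu0, of n] by simp
    fix q :: "real poly" assume q: "degree q < n"
    have "(LINT t:{-1<..<1}|lborel. poly ?G t * poly q t * (1 - t\<^sup>2) powr (\<nu> - 1 / 2)) =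
      (LINT t:{-1<..<1}|lborel. (\<nu> / (real n + \<nu>)) * (poly q t * poly (zonal_poly \<nu> n) t * (1 - t\<^sup>2) powr (\<nu> - 1 / 2)))"
      by (rule arg_cong[of _ _ "set_lebesgue_integral lborel {-1<..<1}"]) auto
    also have "\<dots> = 0"
      unfolding set_integral_mult_right zonal_inner[OF nu0 order_refl]
      using q by (simp add: expand_coeff_eq_0)
    finally show "(LINT t:{-1<..<1}|lborel. poly ?G t * poly q t * (1 - t\<^sup>2) powr (\<nu> - 1 / 2)) = 0" .
  qed
  fix p assume p: "degree p = n \<and>
     (\<forall>q. degree q < n \<longrightarrow> (LINT t:{-1<..<1}|lborel. poly p t * poly q t * (1 - t\<^sup>2) powr (\<nu> - 1 / 2)) = 0) \<and>
     poly p 1 = (real n + 2 * \<nu> - 1) gchoose n"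
  define a where "a k = (\<Sum>j\<le>n. coeff p j * fact j * expand_coeff \<nu> j k)" for k
  have low: "a k = 0" if k: "k < n" for k
  proof -
    have "(LINT t:{-1<..<1}|lborel. poly p t * poly (zonal_poly \<nu> k) t * (1 - t\<^sup>2) powr (\<nu> - 1 / 2)) = 0"
      using conjunct1[OF conjunct2[OF p], rule_format, of "zonal_poly \<nu> k"] k degree_zonal_poly[OF nu0, of k] by simp
    then have "weight_mass \<nu> * zonal_at_one \<nu> k * a k = 0"
      using zonal_inner[OF nu0, of p n k] p by (simp add: a_def)
    then show ?thesis using weight_mass_pos[of \<nu>] zonal_at_one_pos[OF nu, of k] nu by simp
  qed
  have eq: "poly p t = a n * poly (zonal_poly \<nu> n) t" for t
  proof -
    have "poly p t = (\<Sum>k\<le>n. a k * poly (zonal_poly \<nu> k) t)"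
      unfolding a_def by (rule poly_eq_zonal_sum[OF nu0]) (use p in simp)
    also have "\<dots> = (\<Sum>k\<le>n. if k = n then a n * poly (zonal_poly \<nu> n) t else 0)"
      by (intro sum.cong refl) (auto simp: low)
    finally show ?thesis by simp
  qed
  have "a n * poly (zonal_poly \<nu> n) 1 = \<nu> / (real n + \<nu>) * poly (zonal_poly \<nu> n) 1"
    using one p eq[of 1] by simp
  moreover have "poly (zonal_poly \<nu> n) 1 > 0"
    using zonal_at_one_pos[OF nu, of n] by (simp add: poly_zonal_poly zonal_at_one_def)
  ultimately have "a n = \<nu> / (real n + \<nu>)"
    by (metis mult_right_cancel less_irrefl)
  then have "poly p = poly ?G" using eq by auto
  then show "p = ?G" by (simp add: poly_eq_poly_eq_iff)
qed

lemma gegenbauer_Z_eq: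
  assumes "\<nu> > 0"
  shows "gegenbauer_Z n \<nu> t = (\<Sum>i\<le>n. zonal_coeff \<nu> n i * (t ^ i / fact i))"
proof -
  have "real n + \<nu> \<noteq> 0" using assms by linarith
  then show ?thesis using assms
    by (simp add: gegenbauer_Z_def gegenbauer_eq poly_zonal_poly)
qed

section \<open>Evaluation of the integrals\<close>

lemma even_moment_last_coeff: "even_moment (mu - 1/2) k / fact k = last_coeff mu k"
proof (cases "even k")
  case True
  then obtain a where a: "k = 2 * a" by (rule evenE)
  have "pochhammer (1/2 :: real) a \<noteq> 0" by (rule pochhammer_ne_0) simp
  moreover have e: "mu - 1/2 + 1 = mu + (1/2 :: real)" by simp
  ultimately show ?thesis
    unfolding a even_moment_def last_coeff_def fact_double[of a, where 'a = real] e by simp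
qed (simp add: even_moment_def last_coeff_def)

lemma even_power_square: "even k \<Longrightarrow> (C::real) ^ k = (C\<^sup>2) ^ (k div 2)"
  by (auto elim!: evenE simp: power_mult)

lemma sum_divided_powers_pairs:
  fixes b :: "nat \<Rightarrow> real"
  shows "(\<Sum>i\<le>n. b i * ((\<alpha> + \<gamma>) ^ i / fact i)) =
    (\<Sum>s\<in>Sigma {..n} (\<lambda>i. {..i}). (b (fst s) * (\<alpha> ^ (fst s - snd s) / fact (fst s - snd s))) * (\<gamma> ^ snd s / fact (snd s)))"
proof -
  have "(\<Sum>i\<le>n. b i * ((\<alpha> + \<gamma>) ^ i / fact i)) =
      (\<Sum>i\<le>n. \<Sum>k\<le>i. (b i * (\<alpha> ^ (i - k) / fact (i - k))) * (\<gamma> ^ k / fact k))"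
    unfolding divided_power_add sum_distrib_left by (simp add: mult_ac)
  also have "\<dots> = (\<Sum>s\<in>Sigma {..n} (\<lambda>i. {..i}). (b (fst s) * (\<alpha> ^ (fst s - snd s) / fact (fst s - snd s))) * (\<gamma> ^ snd s / fact (snd s)))"
    by (subst sum.Sigma) (auto simp: case_prod_beta)
  finally show ?thesis .
qed

text \<open>
  The pairs \<open>s = (i, k)\<close> with \<open>k \<le> i\<close> enumerate the terms of degree \<open>k\<close> in \<open>t\<close> of the \<open>i\<close>-th power.
\<close>

lemma last_variable_integral:
  fixes b :: "nat \<Rightarrow> real"
  assumes mu: "mu > 0"
  shows "(LINT t:{-1..1}|lborel. (\<Sum>i\<le>n. b i * ((\<alpha> + C * t) ^ i / fact i)) * (1 - t\<^sup>2) powr (mu - 1)) =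
    weight_mass (mu - 1/2) * (\<Sum>s\<in>Sigma {..n} (\<lambda>i. {..i}). (b (fst s) * last_coeff mu (snd s) * (C\<^sup>2) ^ (snd s div 2)) *
        (\<alpha> ^ (fst s - snd s) / fact (fst s - snd s)))"
proof -
  let ?c = "\<lambda>s. b (fst s) * (\<alpha> ^ (fst s - snd s) / fact (fst s - snd s)) * (C ^ snd s / fact (snd s))"
  let ?r = "\<lambda>s. (b (fst s) * last_coeff mu (snd s) * (C\<^sup>2) ^ (snd s div 2)) *
        (\<alpha> ^ (fst s - snd s) / fact (fst s - snd s))"
  let ?w = "\<lambda>t::real. (1 - t\<^sup>2) powr (mu - 1/2 - 1/2)"
  let ?S = "Sigma {..n} (\<lambda>i. {..i})"
  have a: "mu - 1/2 > -1/2" using mu by simp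
  have w: "(1 - t\<^sup>2) powr (mu - 1) = ?w t" for t :: real by simp
  have "(LINT t:{-1..1}|lborel. (\<Sum>i\<le>n. b i * ((\<alpha> + C * t) ^ i / fact i)) * ?w t) =
    (LINT t:{-1..1}|lborel. (\<Sum>s\<in>?S. ?c s * t ^ snd s) * ?w t)"
    unfolding sum_divided_powers_pairs by (simp add: power_mult_distrib mult_ac)
  also have "\<dots> = (\<Sum>s\<in>?S. ?c s * (LINT t:{-1..1}|lborel. t ^ snd s * ?w t))"
    by (rule set_integral_sum_mult[OF _ set_integrable_poly_weight[OF a]]) (auto intro!: continuous_intros)
  also have "\<dots> = (\<Sum>s\<in>?S. weight_mass (mu - 1/2) * ?r s)"
  proof (intro sum.cong refl)
    fix s :: "nat \<times> nat"
    have "C ^ snd s * last_coeff mu (snd s) = (C\<^sup>2) ^ (snd s div 2) * last_coeff mu (snd s)"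
      using even_power_square[of "snd s" C] by (cases "even (snd s)") (simp_all add: last_coeff_def)
    moreover have "C ^ snd s / fact (snd s) * even_moment (mu - 1/2) (snd s) = C ^ snd s * last_coeff mu (snd s)"
      unfolding even_moment_last_coeff[symmetric] by simp
    ultimately have "C ^ snd s / fact (snd s) * even_moment (mu - 1/2) (snd s) = (C\<^sup>2) ^ (snd s div 2) * last_coeff mu (snd s)" by simp
    then have q: "(v * (C ^ snd s / fact (snd s))) * (I * even_moment (mu - 1/2) (snd s)) =
        I * (v * ((C\<^sup>2) ^ (snd s div 2) * last_coeff mu (snd s)))" for v I
      by (simp only: mult.assoc mult.left_commute[of _ I])
    show "?c s * (LINT t:{-1..1}|lborel. t ^ snd s * ?w t) =
      weight_mass (mu - 1/2) * ?r s"
      unfolding symmetric_weight_moment[OF a] weight_mass_def[symmetric] q by (simp only: mult_ac)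
  qed
  finally show ?thesis unfolding w sum_distrib_left .
qed

text \<open>
  The analogue for \<open>\<mu> = 0\<close>, where the odd powers of \<open>C\<close> cancel.
\<close>

lemma last_variable_average:
  fixes b :: "nat \<Rightarrow> real"
  shows "1 / 2 * ((\<Sum>i\<le>n. b i * ((\<alpha> + C * 1) ^ i / fact i)) + (\<Sum>i\<le>n. b i * ((\<alpha> + C * (- 1)) ^ i / fact i))) =
    (\<Sum>s\<in>Sigma {..n} (\<lambda>i. {..i}). (b (fst s) * last_coeff 0 (snd s) * (C\<^sup>2) ^ (snd s div 2)) *
        (\<alpha> ^ (fst s - snd s) / fact (fst s - snd s)))"
  unfolding sum_divided_powers_pairs sum.distrib[symmetric] sum_distrib_left
proof (intro sum.cong refl)
  fix s :: "nat \<times> nat"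
  have l: "1 / 2 * ((C * 1) ^ k / fact k + (C * (- 1)) ^ k / fact k) = last_coeff 0 k * (C\<^sup>2) ^ (k div 2)" for k
  proof (cases "even k")
    case True
    have "even_moment (0 - 1/2) k = 1"
      using pochhammer_ne_0[of "1/2" "k div 2"] True by (simp add: even_moment_def)
    then have "last_coeff 0 k = 1 / fact k" using even_moment_last_coeff[of 0 k] by simp
    then show ?thesis using even_power_square[OF True, of C] True by (simp add: power_mult_distrib)
  next
    case False
    then show ?thesis by (simp add: last_coeff_def)
  qed
  show "1 / 2 * (b (fst s) * (\<alpha> ^ (fst s - snd s) / fact (fst s - snd s)) * ((C * 1) ^ snd s / fact (snd s)) +
       b (fst s) * (\<alpha> ^ (fst s - snd s) / fact (fst s - snd s)) * ((C * (- 1)) ^ snd s / fact (snd s))) =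
    b (fst s) * last_coeff 0 (snd s) * (C\<^sup>2) ^ (snd s div 2) * (\<alpha> ^ (fst s - snd s) / fact (fst s - snd s))"
    unfolding distrib_left[symmetric] mult.assoc[of _ "last_coeff 0 (snd s)"] l[symmetric] by (simp only: mult_ac)
qed

lemma mixing_integral_u:
  fixes lam sig :: real
  assumes lam: "lam > 0" and sig: "sig \<ge> 0"
  shows "set_integrable lborel {0..1} (\<lambda>u. (A * u * v + B * (1 - u)) ^ m / fact m * (u powr (lam - 1) * (1 - u) powr sig))" (is "set_integrable _ _ ?f")
    and "(LINT u:{0..1}|lborel. (A * u * v + B * (1 - u)) ^ m / fact m * (u powr (lam - 1) * (1 - u) powr sig)) =
      Beta lam (sig + 1) * (\<Sum>c\<le>m. (pochhammer lam (m - c) * pochhammer (sig + 1) c / pochhammer (lam + sig + 1) m *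
        (A ^ (m - c) / fact (m - c)) * (B ^ c / fact c)) * v ^ (m - c))" (is "_ = ?R")
proof -
  let ?c = "\<lambda>c. (B ^ c / fact c) * (A ^ (m - c) / fact (m - c)) * v ^ (m - c)"
  have s: "sig + 1 > 0" using sig by simp
  have w: "set_integrable lborel {0..1} (\<lambda>u::real. u powr (lam - 1) * (1 - u) powr sig)"
    using integrable_Beta[OF lam s] by simp
  show "set_integrable lborel {0..1} ?f"
    by (rule set_integrable_continuous_mult[OF w]) (auto intro!: continuous_intros)
  have e: "(A * u * v + B * (1 - u)) ^ m / fact m =
     (\<Sum>c\<le>m. ?c c * (u ^ (m - c) * (1 - u) ^ c))" for u
    unfolding divided_power_add by (intro sum.cong refl) (simp add: power_mult_distrib)
  have "(LINT u:{0..1}|lborel. ?f u) =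
    (\<Sum>c\<le>m. ?c c *
       (LINT u:{0..1}|lborel. u ^ (m - c) * (1 - u) ^ c * (u powr (lam - 1) * (1 - u) powr sig)))"
    unfolding e by (rule set_integral_sum_mult) (use Beta_weight_moment(1)[OF lam s] in auto)
  also have "\<dots> = (\<Sum>c\<le>m. ?c c *
       (Beta lam (sig + 1) * (pochhammer lam (m - c) * pochhammer (sig + 1) c / pochhammer (lam + sig + 1) m)))"
  proof (intro sum.cong refl)
    fix c assume "c \<in> {..m}"
    then have "m - c + c = m" by simp
    then show "?c c * (LINT u:{0..1}|lborel. u ^ (m - c) * (1 - u) ^ c * (u powr (lam - 1) * (1 - u) powr sig)) =
      ?c c * (Beta lam (sig + 1) * (pochhammer lam (m - c) * pochhammer (sig + 1) c / pochhammer (lam + sig + 1) m))"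
      using Beta_weight_moment(2)[OF lam s, of "m - c" c] by (simp add: add.assoc)
  qed
  finally show "(LINT u:{0..1}|lborel. ?f u) = ?R"
    by (simp add: sum_distrib_left mult_ac)
qed

lemma mixing_integral_v:
  fixes lam sig :: real
  assumes lam: "lam > 0"
  shows "(LINT v:{-1..1}|lborel. (\<Sum>c\<le>m. (pochhammer lam (m - c) * pochhammer (sig + 1) c / pochhammer (lam + sig + 1) m *
        (A ^ (m - c) / fact (m - c)) * (B ^ c / fact c)) * v ^ (m - c)) * (1 - v\<^sup>2) powr (lam - 1/2)) =
    weight_mass lam * mixed_power lam sig m (A\<^sup>2) B"
proof -
  have l: "lam > -1/2" using lam by simp
  let ?e = "\<lambda>c. pochhammer lam (m - c) * pochhammer (sig + 1) c / pochhammer (lam + sig + 1) m *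
        (A ^ (m - c) / fact (m - c)) * (B ^ c / fact c)"
  have "(LINT v:{-1..1}|lborel. (\<Sum>c\<le>m. ?e c * v ^ (m - c)) * (1 - v\<^sup>2) powr (lam - 1/2)) =
    (\<Sum>c\<le>m. ?e c * (LINT v:{-1..1}|lborel. v ^ (m - c) * (1 - v\<^sup>2) powr (lam - 1/2)))"
    by (rule set_integral_sum_mult[OF _ set_integrable_poly_weight[OF l]]) (auto intro!: continuous_intros)
  also have "\<dots> = (\<Sum>c\<le>m. weight_mass lam * (mix_coeff lam sig m c * ((A\<^sup>2) ^ ((m - c) div 2) * (B ^ c / fact c))))"
  proof (intro sum.cong refl)
    fix c assume "c \<in> {..m}"
    show "?e c * (LINT v:{-1..1}|lborel. v ^ (m - c) * (1 - v\<^sup>2) powr (lam - 1/2)) =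
      weight_mass lam * (mix_coeff lam sig m c * ((A\<^sup>2) ^ ((m - c) div 2) * (B ^ c / fact c)))"
    proof (cases m c rule: half_fact_cases)
      case 1
      have "odd (m - c)"
      proof
        assume "even (m - c)"
        then obtain a where "m - c = 2 * a" by (rule evenE)
        then have "m = c + 2 * a" using \<open>c \<in> {..m}\<close> by auto
        with 1 show False by blast
      qed
      with 1 show ?thesis unfolding symmetric_weight_moment[OF l] by (simp add: even_moment_def mix_coeff_def)
    next
      case (2 a)
      have mc: "m - c = 2 * a" using 2 by simp
      have p: "pochhammer (1/2 :: real) a \<noteq> 0" by (rule pochhammer_ne_0) simp
      have "A ^ (2 * a) = (A\<^sup>2) ^ a" by (rule power_mult)
      moreover have "even_moment lam (2 * a) = half_fact m c / (2 ^ (2 * a) * pochhammer (lam + 1) a) * fact (2 * a)"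
        unfolding 2(2) even_moment_def fact_double[of a, where 'a = real] using p by simp
      ultimately show ?thesis
        unfolding symmetric_weight_moment[OF l] weight_mass_def[symmetric] mix_coeff_def mc
        by simp (simp add: mult_ac)
    qed
  qed
  finally show ?thesis by (simp add: mixed_power_def sum_distrib_left)
qed

lemma mixing_integral:
  fixes lam sig :: real and m :: "'i \<Rightarrow> nat"
  assumes lam: "lam > 0" and sig: "sig \<ge> 0" and S: "finite S"
  shows "(LINT v:{-1..1}|lborel. (LINT u:{0..1}|lborel.
      (\<Sum>s\<in>S. e s * ((A * u * v + B * (1 - u)) ^ m s / fact (m s))) * u powr (lam - 1) * (1 - u) powr sig) *
       (1 - v\<^sup>2) powr (lam - 1/2)) =
    weight_mass lam * Beta lam (sig + 1) * (\<Sum>s\<in>S. e s * mixed_power lam sig (m s) (A\<^sup>2) B)"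
proof -
  let ?U = "\<lambda>s v. \<Sum>c\<le>m s. (pochhammer lam (m s - c) * pochhammer (sig + 1) c / pochhammer (lam + sig + 1) (m s) *
        (A ^ (m s - c) / fact (m s - c)) * (B ^ c / fact c)) * v ^ (m s - c)"
  have l: "lam > -1/2" using lam by simp
  have u: "(LINT u:{0..1}|lborel. (\<Sum>s\<in>S. e s * ((A * u * v + B * (1 - u)) ^ m s / fact (m s))) * u powr (lam - 1) * (1 - u) powr sig) =
      (\<Sum>s\<in>S. (e s * Beta lam (sig + 1)) * ?U s v)" for v
    unfolding mult.assoc[of _ "_ powr (lam - 1)"]
    by (subst set_integral_sum_mult[OF S mixing_integral_u(1)[OF lam sig]])
       (unfold mixing_integral_u(2)[OF lam sig], simp add: mult_ac)
  have "(LINT v:{-1..1}|lborel. (\<Sum>s\<in>S. (e s * Beta lam (sig + 1)) * ?U s v) * (1 - v\<^sup>2) powr (lam - 1/2)) =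
    (\<Sum>s\<in>S. (e s * Beta lam (sig + 1)) * (LINT v:{-1..1}|lborel. ?U s v * (1 - v\<^sup>2) powr (lam - 1/2)))"
    by (rule set_integral_sum_mult[OF S]) (intro set_integrable_poly_weight l continuous_intros)
  then show ?thesis unfolding u mixing_integral_v[OF lam] by (simp add: sum_distrib_left mult_ac)
qed

lemma sum_pairs_zeta_power:
  "(\<Sum>s\<in>Sigma {..n} (\<lambda>i. {..i}). (b (fst s) * last_coeff mu (snd s) * C2 ^ (snd s div 2)) * mixed_power lam sig (fst s - snd s) A2 B) =
   (\<Sum>i\<le>n. b i * zeta_power lam mu sig i A2 B C2)"
proof -
  have "(\<Sum>i\<le>n. b i * zeta_power lam mu sig i A2 B C2) =
    (\<Sum>i\<le>n. \<Sum>k\<le>i. (b i * last_coeff mu k * C2 ^ (k div 2)) * mixed_power lam sig (i - k) A2 B)"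
    unfolding zeta_power_def sum_distrib_left by (simp add: mult_ac)
  then show ?thesis by (simp add: sum.Sigma case_prod_beta)
qed

context radial_ball_weight
begin

lemma kernel_integrals:
  fixes x y :: "real ^ 'd"
  assumes x: "x \<in> cball 0 1" and y: "y \<in> cball 0 1"
  shows "mu > 0 \<Longrightarrow> kernel_integral lam mu n x y =
      weight_mass (mu - 1/2) * (weight_mass lam * Beta lam (sig + 1)) * zonal_kernel n x y"
    and "mu = 0 \<Longrightarrow> kernel_integral_0 lam n x y = weight_mass lam * Beta lam (sig + 1) * zonal_kernel n x y"
proof -
  define A where "A = norm x * norm y"
  define B where "B = x \<bullet> y"
  define C where "C = sqrt (1 - (norm x)\<^sup>2) * sqrt (1 - (norm y)\<^sup>2)"
  have A2: "A\<^sup>2 = (norm x)\<^sup>2 * (norm y)\<^sup>2" by (simp add: A_def power_mult_distrib)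
  have "(norm x)\<^sup>2 \<le> 1" "(norm y)\<^sup>2 \<le> 1" using x y by (simp_all add: power_le_one)
  then have C2: "C\<^sup>2 = (1 - (norm x)\<^sup>2) * (1 - (norm y)\<^sup>2)" by (simp add: C_def power_mult_distrib)
  have z: "zeta_arg x y u v t = (A * u * v + B * (1 - u)) + C * t" for u v t
    by (simp add: zeta_arg_def A_def B_def C_def)
  have sg: "(real CARD('d) - 2) / 2 = sig" by (simp add: sig_def)
  have ker: "(\<Sum>s\<in>Sigma {..n} (\<lambda>i. {..i}). (zonal_coeff nu n (fst s) * last_coeff mu (snd s) * (C\<^sup>2) ^ (snd s div 2)) *
       mixed_power lam sig (fst s - snd s) (A\<^sup>2) B) = zonal_kernel n x y"
    unfolding sum_pairs_zeta_power zonal_kernel_def zpow_def A2 B_def C2 ..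
  let ?S = "Sigma {..n} (\<lambda>i. {..i})"
  let ?e = "\<lambda>s. zonal_coeff nu n (fst s) * last_coeff mu (snd s) * (C\<^sup>2) ^ (snd s div 2)"
  have fin: "finite ?S" by simp
  {
    assume mu0: "mu > 0"
    have "kernel_integral lam mu n x y = (LINT v:{-1..1}|lborel. (LINT u:{0..1}|lborel.
        (\<Sum>s\<in>?S. (weight_mass (mu - 1/2) * ?e s) * ((A * u * v + B * (1 - u)) ^ (fst s - snd s) / fact (fst s - snd s))) *
        u powr (lam - 1) * (1 - u) powr sig) * (1 - v\<^sup>2) powr (lam - 1/2))"
      unfolding kernel_integral_def nu_def[symmetric] gegenbauer_Z_eq[OF nu_pos] z sg last_variable_integral[OF mu0]
      by (simp only: sum_distrib_left mult.assoc)
    also have "\<dots> = weight_mass lam * Beta lam (sig + 1) * (\<Sum>s\<in>?S. (weight_mass (mu - 1/2) * ?e s) * mixed_power lam sig (fst s - snd s) (A\<^sup>2) B)"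
      by (rule mixing_integral[OF lam sig_nonneg fin])
    also have "(\<Sum>s\<in>?S. (weight_mass (mu - 1/2) * ?e s) * mixed_power lam sig (fst s - snd s) (A\<^sup>2) B) =
       weight_mass (mu - 1/2) * zonal_kernel n x y"
      unfolding ker[symmetric] sum_distrib_left by (simp only: mult.assoc)
    finally show "kernel_integral lam mu n x y =
      weight_mass (mu - 1/2) * (weight_mass lam * Beta lam (sig + 1)) * zonal_kernel n x y" by simp
  }
  {
    assume mu0: "mu = 0"
    have nu: "lam + (real CARD('d) - 1) / 2 = nu" using mu0 by (simp add: nu_def)
    have "kernel_integral_0 lam n x y = (LINT v:{-1..1}|lborel. (LINT u:{0..1}|lborel.
        (\<Sum>s\<in>?S. ?e s * ((A * u * v + B * (1 - u)) ^ (fst s - snd s) / fact (fst s - snd s))) *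
        u powr (lam - 1) * (1 - u) powr sig) * (1 - v\<^sup>2) powr (lam - 1/2))"
      unfolding kernel_integral_0_def nu gegenbauer_Z_eq[OF nu_pos] z sg last_variable_average mu0 ..
    also have "\<dots> = weight_mass lam * Beta lam (sig + 1) * (\<Sum>s\<in>?S. ?e s * mixed_power lam sig (fst s - snd s) (A\<^sup>2) B)"
      by (rule mixing_integral[OF lam sig_nonneg fin])
    finally show "kernel_integral_0 lam n x y = weight_mass lam * Beta lam (sig + 1) * zonal_kernel n x y"
      unfolding ker .
  }
qed

lemma zonal_kernel_0: "zonal_kernel 0 x y = 1"
  by (simp add: zonal_kernel_def zpow_def zeta_power_def mixed_power_def zonal_coeff_def last_coeff_def mix_coeff_def)

text \<open>
  The normalizing constant is read off at \<open>n = 0\<close>, where the kernel is \<open>1\<close>.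
\<close>

lemma repr_kernel_eq_normalized:
  fixes K :: "nat \<Rightarrow> real ^ 'd \<Rightarrow> real ^ 'd \<Rightarrow> real"
  assumes c: "c \<noteq> 0" and K: "\<And>n x y. x \<in> cball 0 1 \<Longrightarrow> y \<in> cball 0 1 \<Longrightarrow> K n x y = c * zonal_kernel n x y"
    and x: "x \<in> cball 0 1" and y: "y \<in> cball 0 1"
  shows "repr_kernel W n x y = normalizer K * K n x y"
proof -
  have "normalizer K = 1 / c"
    unfolding normalizer_def
  proof (rule the_equality)
    show "\<forall>x\<in>cball 0 1. \<forall>y\<in>cball 0 1. 1 / c * K 0 x y = 1"
      using c by (simp add: K zonal_kernel_0)
    fix a assume "\<forall>x\<in>cball 0 1. \<forall>y\<in>cball 0 1. a * K 0 x y = 1"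
    then have "a * K 0 x y = 1" using x y by blast
    then have "a * c = 1" using K[OF x y, of 0] by (simp add: zonal_kernel_0)
    then show "a = 1 / c" using c by (simp add: field_simps)
  qed
  then show ?thesis using c K[OF x y] by (simp add: repr_kernel_eq)
qed

end

theorem theorem3p4:
  fixes x y :: "real ^ 'd" and n :: nat and lam mu :: real
  assumes "CARD('d) \<ge> 2"
    and "x \<in> cball 0 1" and "y \<in> cball 0 1"
    and "lam > 0"
  shows "(mu > 0 \<longrightarrow>
            repr_kernel (ball_weight lam mu) n x y =
            normalizer (kernel_integral lam mu :: nat \<Rightarrow> real ^ 'd \<Rightarrow> real ^ 'd \<Rightarrow> real) *
            kernel_integral lam mu n x y) \<and>
         repr_kernel (ball_weight lam 0) n x y =
         normalizer (kernel_integral_0 lam :: nat \<Rightarrow> real ^ 'd \<Rightarrow> real ^ 'd \<Rightarrow> real) *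
         kernel_integral_0 lam n x y"
proof (intro conjI impI)
  define sig where "sig = (real CARD('d) - 2) / 2"
  have "sig \<ge> 0" using assms(1) by (simp add: sig_def)
  then have pos: "weight_mass lam * Beta lam (sig + 1) > 0"
    using assms(4) by (intro mult_pos_pos weight_mass_pos Beta_real_pos) auto
  {
    assume mu_pos: "mu > 0"
    define nu where "nu = lam + mu + (real CARD('d) - 1) / 2"
    interpret radial_ball_weight lam mu sig nu "ball_weight lam mu :: real ^ 'd \<Rightarrow> real"
      by unfold_locales (use assms mu_pos in \<open>auto simp: sig_def nu_def\<close>)
    show "repr_kernel (ball_weight lam mu) n x y =
            normalizer (kernel_integral lam mu :: nat \<Rightarrow> real ^ 'd \<Rightarrow> real ^ 'd \<Rightarrow> real) *
            kernel_integral lam mu n x y"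
    proof (rule repr_kernel_eq_normalized[OF _ kernel_integrals(1) assms(2,3)])
      have "weight_mass (mu - 1/2) > 0" using mu_pos by (intro weight_mass_pos) simp
      from mult_pos_pos[OF this pos]
      show "weight_mass (mu - 1/2) * (weight_mass lam * Beta lam (sig + 1)) \<noteq> 0"
        by (rule less_imp_neq[THEN not_sym])
    qed (use mu_pos in auto)
  }
  define nu where "nu = lam + 0 + (real CARD('d) - 1) / 2"
  interpret radial_ball_weight lam 0 sig nu "ball_weight lam 0 :: real ^ 'd \<Rightarrow> real"
    by unfold_locales (use assms in \<open>auto simp: sig_def nu_def\<close>)
  show "repr_kernel (ball_weight lam 0) n x y =
         normalizer (kernel_integral_0 lam :: nat \<Rightarrow> real ^ 'd \<Rightarrow> real ^ 'd \<Rightarrow> real) *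
         kernel_integral_0 lam n x y"
    by (rule repr_kernel_eq_normalized[OF less_imp_neq[OF pos, THEN not_sym] kernel_integrals(2) assms(2,3)])
       simp_all
qed

end
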